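(* Let $f:X\to\mathbf R$ be a smooth function, let $b>0$, and set $$A^f_t=\int_0^t\nabla^{TX}_{Y^{TX}_s}\nabla_{Y^{TX}_s}f(x_s)\,ds+\int_0^t\nabla_{\delta w^{TX}_s}f(x_s).$$ The following identity holds: $$\left(b^2\frac d{dt}+1\right)f(x_t)=\left(b^2\frac d{dt}+1\right)f(x_t)\Big|_{t=0}+A^f_t.$$ Moreover, $$f(x_t)=f(x_0)+b^2\frac d{dt}f(x_t)\Big|_{t=0}\left(1-e^{-t/b^2}\right)+\int_0^t\frac{e^{-(t-s)/b^2}}{b^2}A^f_s\,ds.$$
   Context: $X=G/K$ is the Riemannian symmetric space associated with a connected, simply connected real reductive Lie group $G$ with Cartan involution $\theta$, maximal compact subgroup $K$, Cartan decomposition $\mathfrak g=\mathfrak p\oplus\mathfrak k$ and metric induced by a $G$- and $\theta$-invariant nondegenerate symmetric bilinear form on $\mathfrak g$, positive on $\mathfrak p$ and negative on $\mathfrak k$; $x_0=p1$ is the base point, $T_{x_0}X\simeq\mathfrak p$, $\nabla^{TX}$ is the Levi-Civita connection. $w^{TX}_\cdot$ is a standard Brownian motion in $T_{x_0}X$. The hypoelliptic diffusion $(x_\cdot,Y^{TX}_\cdot)$ with values in the total space of $TX$ is the solution of $$\dot x=\frac{Y^{TX}}b,\qquad\dot Y^{TX}=-\frac{Y^{TX}}{b^2}+\frac{\dot w^{TX}}b,\qquad x_0=p1,\quad Y^{TX}_0=Y^{\mathfrak p}\in\mathfrak p,$$ where $\dot Y^{TX}$ is the covariant derivative along $x_\cdot$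 with respect to $\nabla^{TX}$ and $\dot w^{TX}$ is transported from $T_{x_0}X$ to $T_{x_t}X$ by parallel transport along $x_\cdot$. $\delta w^{TX}$ is the Itô differential of $w^{TX}$ (again parallel transported along $x_\cdot$), so the last term of $A^f$ is the Itô integral $\int_0^t\langle\nabla f(x_s),\delta w^{TX}_s\rangle$. $\nabla^{TX}_Y\nabla_Yf$ denotes the Hessian of $f$ evaluated on $(Y,Y)$. *)

theory Defs
  imports "HOL-Probability.Probability" "HOL-Algebra.Left_Coset"
begin

section \<open>Smooth manifolds\<close>

text \<open>
  Manifolds are modelled on a linear subspace \<open>E\<close> of a Euclidean space rather than on a whole type
  of class \<open>euclidean_space\<close>, so that the dimension is not forced to be positive.
  \<open>E = UNIV\<close> gives the usual notions. \<open>dd E h u a\<close> is the derivative of \<open>h\<close> (defined near \<open>u\<close> in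
  \<open>E\<close>) at \<open>u\<close> in the direction \<open>a\<close>; it is only meaningful for \<open>a \<in> E\<close>.
\<close>

definition dd :: "'e::euclidean_space set \<Rightarrow> ('e \<Rightarrow> 'b::real_normed_vector) \<Rightarrow> 'e \<Rightarrow> 'e \<Rightarrow> 'b" where
  "dd E h u a = frechet_derivative h (at u within E) a"

primrec Ck_on :: "'e::euclidean_space set \<Rightarrow> 'e set \<Rightarrow> nat \<Rightarrow> ('e \<Rightarrow> 'b::real_normed_vector) \<Rightarrow> bool" where
  "Ck_on E S 0 h \<longleftrightarrow> continuous_on S h"
| "Ck_on E S (Suc k) h \<longleftrightarrow>
     (\<forall>u\<in>S. h differentiable (at u within E)) \<and> (\<forall>a\<in>E. Ck_on E S k (\<lambda>u. dd E h u a))"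

definition smooth_on :: "'e::euclidean_space set \<Rightarrow> 'e set \<Rightarrow> ('e \<Rightarrow> 'b::real_normed_vector) \<Rightarrow> bool" where
  "smooth_on E S h \<longleftrightarrow> (\<forall>k. Ck_on E S k h)"

type_synonym ('m, 'e) chart = "'m set \<times> ('m \<Rightarrow> 'e)"

record ('m, 'e) manifold =
  model :: "'e set"
  atlas :: "('m, 'e) chart set"

definition points :: "('m, 'e) manifold \<Rightarrow> 'm set" where
  "points N = \<Union> (fst ` atlas N)"

definition charts_at :: "('m, 'e) manifold \<Rightarrow> 'm \<Rightarrow> ('m, 'e) chart set" where
  "charts_at N x = {c \<in> atlas N. x \<in> fst c}"

definition chart_inv :: "('m, 'e) chart \<Rightarrow> 'e \<Rightarrow> 'm" where
  "chart_inv c = inv_into (fst c) (snd c)"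

definition mtop :: "('m, 'e::euclidean_space) manifold \<Rightarrow> 'm topology" where
  "mtop N = topology (\<lambda>W. W \<subseteq> points N \<and>
     (\<forall>c\<in>atlas N. openin (top_of_set (model N)) (snd c ` (W \<inter> fst c))))"

definition smooth_manifold :: "('m, 'e::euclidean_space) manifold \<Rightarrow> bool" where
  "smooth_manifold N \<longleftrightarrow>
     subspace (model N) \<and>
     (\<forall>c\<in>atlas N. inj_on (snd c) (fst c) \<and> openin (top_of_set (model N)) (snd c ` fst c)) \<and>
     (\<forall>c\<in>atlas N. \<forall>d\<in>atlas N.
        openin (top_of_set (model N)) (snd c ` (fst c \<inter> fst d)) \<and>
        smooth_on (model N) (snd c ` (fst c \<inter> fst d)) (snd d \<circ> chart_inv c)) \<and>
     Hausdorff_space (mtop N) \<and> second_countable (mtop N)"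

definition smooth_fun :: "('m, 'e::euclidean_space) manifold \<Rightarrow> ('m \<Rightarrow> real) \<Rightarrow> bool" where
  "smooth_fun N f \<longleftrightarrow> (\<forall>c\<in>atlas N. smooth_on (model N) (snd c ` fst c) (f \<circ> chart_inv c))"

definition smooth_map ::
  "('m, 'e::euclidean_space) manifold \<Rightarrow> ('n, 'e'::euclidean_space) manifold \<Rightarrow> ('m \<Rightarrow> 'n) \<Rightarrow> bool" where
  "smooth_map N N' h \<longleftrightarrow> h \<in> points N \<rightarrow> points N' \<and>
     (\<forall>c\<in>atlas N. \<forall>d\<in>atlas N'.
        openin (top_of_set (model N)) (snd c ` (fst c \<inter> h -` fst d)) \<and>
        smooth_on (model N) (snd c ` (fst c \<inter> h -` fst d)) (snd d \<circ> h \<circ> chart_inv c))"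

definition prod_manifold ::
  "('m, 'e) manifold \<Rightarrow> ('n, 'e') manifold \<Rightarrow> ('m \<times> 'n, 'e \<times> 'e') manifold" where
  "prod_manifold N N' = \<lparr>model = model N \<times> model N',
     atlas = {(fst c \<times> fst d, map_prod (snd c) (snd d)) | c d. c \<in> atlas N \<and> d \<in> atlas N'}\<rparr>"

text \<open>
  A tangent vector at \<open>x\<close> is the family of its components in the charts around \<open>x\<close>, transforming by
  the Jacobian of the transition maps (and set to \<open>0\<close> at charts not containing \<open>x\<close>). Vector space
  operations are therefore pointwise in the chart.
\<close>

type_synonym ('m, 'e) tvec = "('m, 'e) chart \<Rightarrow> 'e"

definition tangent :: "('m, 'e::euclidean_space) manifold \<Rightarrow> 'm \<Rightarrow> ('m, 'e) tvec set" where
  "tangent N x = {v. (\<forall>c. c \<notin> charts_at N x \<longrightarrow> v c = 0) \<and>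
     (\<forall>c\<in>charts_at N x. v c \<in> model N \<and>
        (\<forall>d\<in>charts_at N x. v d = dd (model N) (snd d \<circ> chart_inv c) (snd c x) (v c)))}"

definition coord_vector ::
  "('m, 'e::euclidean_space) manifold \<Rightarrow> ('m, 'e) chart \<Rightarrow> 'm \<Rightarrow> 'e \<Rightarrow> ('m, 'e) tvec" where
  "coord_vector N c x a =
     (\<lambda>d. if d \<in> charts_at N x then dd (model N) (snd d \<circ> chart_inv c) (snd c x) a else 0)"

text \<open>The expressions below using a chosen chart do not depend on the choice.\<close>

definition some_chart :: "('m, 'e) manifold \<Rightarrow> 'm \<Rightarrow> ('m, 'e) chart" where
  "some_chart N x = (SOME c. c \<in> charts_at N x)"

definition dmap ::
  "('m, 'e::euclidean_space) manifold \<Rightarrow> ('n, 'e'::euclidean_space) manifold \<Rightarrow> ('m \<Rightarrow> 'n) \<Rightarrow> 'm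
    \<Rightarrow> ('m, 'e) tvec \<Rightarrow> ('n, 'e') tvec" where
  "dmap N N' h x v = (\<lambda>d. if d \<in> charts_at N' (h x)
     then dd (model N) (snd d \<circ> h \<circ> chart_inv (some_chart N x)) (snd (some_chart N x) x)
            (v (some_chart N x))
     else 0)"

definition dfun :: "('m, 'e::euclidean_space) manifold \<Rightarrow> ('m \<Rightarrow> real) \<Rightarrow> 'm \<Rightarrow> ('m, 'e) tvec \<Rightarrow> real" where
  "dfun N f x v =
     dd (model N) (f \<circ> chart_inv (some_chart N x)) (snd (some_chart N x) x) (v (some_chart N x))"

definition tsubspace :: "('i \<Rightarrow> 'e::real_vector) set \<Rightarrow> bool" where
  "tsubspace S \<longleftrightarrow> (\<lambda>_. 0) \<in> S \<and> (\<forall>u\<in>S. \<forall>v\<in>S. \<forall>r. (\<lambda>c. r *\<^sub>R u c + v c) \<in> S)"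

definition bilinear_form_on :: "('i \<Rightarrow> 'e::real_vector) set \<Rightarrow> (('i \<Rightarrow> 'e) \<Rightarrow> ('i \<Rightarrow> 'e) \<Rightarrow> real) \<Rightarrow> bool" where
  "bilinear_form_on S B \<longleftrightarrow> (\<forall>u\<in>S. \<forall>v\<in>S. \<forall>w\<in>S. \<forall>r.
      B (\<lambda>c. r *\<^sub>R u c + v c) w = r * B u w + B v w \<and>
      B w (\<lambda>c. r *\<^sub>R u c + v c) = r * B w u + B w v)"

section \<open>Riemannian metrics, the Levi-Civita connection and parallel transport\<close>

definition metric_coeff ::
  "('m, 'e::euclidean_space) manifold \<Rightarrow> ('m \<Rightarrow> ('m, 'e) tvec \<Rightarrow> ('m, 'e) tvec \<Rightarrow> real)
    \<Rightarrow> ('m, 'e) chart \<Rightarrow> 'e \<Rightarrow> 'e \<Rightarrow> 'e \<Rightarrow> real" where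
  "metric_coeff N met c u a b =
     met (chart_inv c u) (coord_vector N c (chart_inv c u) a) (coord_vector N c (chart_inv c u) b)"

definition riemannian_metric ::
  "('m, 'e::euclidean_space) manifold \<Rightarrow> ('m \<Rightarrow> ('m, 'e) tvec \<Rightarrow> ('m, 'e) tvec \<Rightarrow> real) \<Rightarrow> bool" where
  "riemannian_metric N met \<longleftrightarrow>
     (\<forall>x\<in>points N. bilinear_form_on (tangent N x) (met x) \<and>
        (\<forall>u\<in>tangent N x. \<forall>v\<in>tangent N x. met x u v = met x v u) \<and>
        (\<forall>u\<in>tangent N x. u \<noteq> (\<lambda>_. 0) \<longrightarrow> met x u u > 0)) \<and>
     (\<forall>c\<in>atlas N. \<forall>a\<in>model N. \<forall>b\<in>model N.
        smooth_on (model N) (snd c ` fst c) (\<lambda>u. metric_coeff N met c u a b))"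

text \<open>
  A connection is given by its Christoffel symbols in the charts of the atlas: for constant
  coordinate fields \<open>a\<close>, \<open>b\<close> in the chart \<open>c\<close>, the covariant derivative of \<open>b\<close> along \<open>a\<close> at the
  point with coordinates \<open>u\<close> has component \<open>\<Gamma> c u a b\<close>. The Levi-Civita connection is the smooth
  connection that is torsion-free (first line) and metric (last clause); these conditions determine
  \<open>\<Gamma>\<close> in each chart, hence also its transformation law.
\<close>

type_synonym ('m, 'e) christoffel = "('m, 'e) chart \<Rightarrow> 'e \<Rightarrow> 'e \<Rightarrow> 'e \<Rightarrow> 'e"

definition levi_civita ::
  "('m, 'e::euclidean_space) manifold \<Rightarrow> ('m \<Rightarrow> ('m, 'e) tvec \<Rightarrow> ('m, 'e) tvec \<Rightarrow> real)
    \<Rightarrow> ('m, 'e) christoffel \<Rightarrow> bool" where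
  "levi_civita N met \<Gamma> \<longleftrightarrow> (\<forall>c\<in>atlas N. \<forall>a\<in>model N. \<forall>b\<in>model N.
     (\<forall>u\<in>snd c ` fst c. \<Gamma> c u a b \<in> model N \<and> \<Gamma> c u a b = \<Gamma> c u b a \<and>
        (\<forall>e\<in>model N. \<forall>r. \<Gamma> c u (r *\<^sub>R a + e) b = r *\<^sub>R \<Gamma> c u a b + \<Gamma> c u e b)) \<and>
     smooth_on (model N) (snd c ` fst c) (\<lambda>u. \<Gamma> c u a b) \<and>
     (\<forall>u\<in>snd c ` fst c. \<forall>e\<in>model N.
        dd (model N) (\<lambda>p. metric_coeff N met c p b e) u a
          = metric_coeff N met c u (\<Gamma> c u a b) e + metric_coeff N met c u b (\<Gamma> c u a e)))"

text \<open>\<open>hessian N \<Gamma> f x u v = (\<nabla>\<^sub>u df)(v)\<close>.\<close>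

definition hessian ::
  "('m, 'e::euclidean_space) manifold \<Rightarrow> ('m, 'e) christoffel \<Rightarrow> ('m \<Rightarrow> real) \<Rightarrow> 'm
    \<Rightarrow> ('m, 'e) tvec \<Rightarrow> ('m, 'e) tvec \<Rightarrow> real" where
  "hessian N \<Gamma> f x u v =
     (let c = some_chart N x; h = f \<circ> chart_inv c; p = snd c x
      in dd (model N) (\<lambda>q. dd (model N) h q (v c)) p (u c) - dd (model N) h p (\<Gamma> c p (u c) (v c)))"

text \<open>Curves are parametrised by \<open>{0..}\<close>; derivatives at time \<open>0\<close> are thus one-sided.\<close>

definition time_deriv :: "(real \<Rightarrow> real) \<Rightarrow> real \<Rightarrow> real" where
  "time_deriv g t = vector_derivative g (at t within {0..})"

definition has_velocity ::
  "('m, 'e::euclidean_space) manifold \<Rightarrow> (real \<Rightarrow> 'm) \<Rightarrow> (real \<Rightarrow> ('m, 'e) tvec) \<Rightarrow> bool" where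
  "has_velocity N x v \<longleftrightarrow> continuous_map (top_of_set {0..}) (mtop N) x \<and>
     (\<forall>t\<ge>0. v t \<in> tangent N (x t) \<and> (\<forall>c\<in>charts_at N (x t).
        ((\<lambda>s. snd c (x s)) has_vector_derivative v t c) (at t within {0..})))"

text \<open>\<open>V\<close> is a vector field along the curve \<open>x\<close>, which has velocity \<open>v\<close>, and \<open>W\<close> is its covariant
  derivative.\<close>

definition has_covariant_derivative ::
  "('m, 'e::euclidean_space) manifold \<Rightarrow> ('m, 'e) christoffel \<Rightarrow> (real \<Rightarrow> 'm) \<Rightarrow> (real \<Rightarrow> ('m, 'e) tvec)
    \<Rightarrow> (real \<Rightarrow> ('m, 'e) tvec) \<Rightarrow> (real \<Rightarrow> ('m, 'e) tvec) \<Rightarrow> bool" where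
  "has_covariant_derivative N \<Gamma> x v V W \<longleftrightarrow>
     (\<forall>t\<ge>0. V t \<in> tangent N (x t) \<and> W t \<in> tangent N (x t) \<and> (\<forall>c\<in>charts_at N (x t).
        ((\<lambda>s. V s c) has_vector_derivative (W t c - \<Gamma> c (snd c (x t)) (v t c) (V t c)))
          (at t within {0..})))"

text \<open>\<open>\<tau> t\<close> is the parallel transport from the tangent space at \<open>x 0\<close> to that at \<open>x t\<close>.\<close>

definition parallel_transport ::
  "('m, 'e::euclidean_space) manifold \<Rightarrow> ('m, 'e) christoffel \<Rightarrow> (real \<Rightarrow> 'm) \<Rightarrow> (real \<Rightarrow> ('m, 'e) tvec)
    \<Rightarrow> (real \<Rightarrow> ('m, 'e) tvec \<Rightarrow> ('m, 'e) tvec) \<Rightarrow> bool" where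
  "parallel_transport N \<Gamma> x v \<tau> \<longleftrightarrow>
     (\<forall>u\<in>tangent N (x 0). \<tau> 0 u = u \<and>
        has_covariant_derivative N \<Gamma> x v (\<lambda>t. \<tau> t u) (\<lambda>t c. 0)) \<and>
     (\<forall>t\<ge>0. \<forall>u\<in>tangent N (x 0). \<forall>u'\<in>tangent N (x 0). \<forall>r.
        \<tau> t (\<lambda>c. r *\<^sub>R u c + u' c) = (\<lambda>c. r *\<^sub>R \<tau> t u c + \<tau> t u' c))"

section \<open>Lie groups and the symmetric space\<close>

definition simply_connected_top :: "'m topology \<Rightarrow> bool" where
  "simply_connected_top T \<longleftrightarrow> path_connected_space T \<and>
     (\<forall>p. pathin T p \<and> p 0 = p 1 \<longrightarrow>
        homotopic_with (\<lambda>q. q 0 = p 0 \<and> q 1 = p 0) (top_of_set {0..1}) T p (\<lambda>_. p 0))"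

definition lie_group :: "'g monoid \<Rightarrow> ('g, 'e::euclidean_space) manifold \<Rightarrow> bool" where
  "lie_group G M \<longleftrightarrow> group G \<and> smooth_manifold M \<and> points M = carrier G \<and>
     smooth_map (prod_manifold M M) M (\<lambda>(g, h). g \<otimes>\<^bsub>G\<^esub> h) \<and>
     smooth_map M M (\<lambda>g. inv\<^bsub>G\<^esub> g)"

definition lie_algebra :: "'g monoid \<Rightarrow> ('g, 'e::euclidean_space) manifold \<Rightarrow> ('g, 'e) tvec set" where
  "lie_algebra G M = tangent M \<one>\<^bsub>G\<^esub>"

definition Ad :: "'g monoid \<Rightarrow> ('g, 'e::euclidean_space) manifold \<Rightarrow> 'g \<Rightarrow> ('g, 'e) tvec \<Rightarrow> ('g, 'e) tvec" where
  "Ad G M g = dmap M M (\<lambda>h. g \<otimes>\<^bsub>G\<^esub> h \<otimes>\<^bsub>G\<^esub> inv\<^bsub>G\<^esub> g) \<one>\<^bsub>G\<^esub>"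

definition left_invariant ::
  "'g monoid \<Rightarrow> ('g, 'e::euclidean_space) manifold \<Rightarrow> ('g, 'e) tvec \<Rightarrow> 'g \<Rightarrow> ('g, 'e) tvec" where
  "left_invariant G M u g = dmap M M (\<lambda>h. g \<otimes>\<^bsub>G\<^esub> h) \<one>\<^bsub>G\<^esub> u"

definition field_bracket ::
  "('m, 'e::euclidean_space) manifold \<Rightarrow> ('m \<Rightarrow> ('m, 'e) tvec) \<Rightarrow> ('m \<Rightarrow> ('m, 'e) tvec)
    \<Rightarrow> 'm \<Rightarrow> ('m, 'e) tvec" where
  "field_bracket M U V x = (\<lambda>c. if c \<in> charts_at M x
     then dd (model M) (\<lambda>p. V (chart_inv c p) c) (snd c x) (U x c)
        - dd (model M) (\<lambda>p. U (chart_inv c p) c) (snd c x) (V x c)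
     else 0)"

definition lie_bracket ::
  "'g monoid \<Rightarrow> ('g, 'e::euclidean_space) manifold \<Rightarrow> ('g, 'e) tvec \<Rightarrow> ('g, 'e) tvec \<Rightarrow> ('g, 'e) tvec" where
  "lie_bracket G M u v = field_bracket M (left_invariant G M u) (left_invariant G M v) \<one>\<^bsub>G\<^esub>"

definition lie_ideal :: "'g monoid \<Rightarrow> ('g, 'e::euclidean_space) manifold \<Rightarrow> ('g, 'e) tvec set \<Rightarrow> bool" where
  "lie_ideal G M I \<longleftrightarrow> I \<subseteq> lie_algebra G M \<and> tsubspace I \<and>
     (\<forall>u\<in>lie_algebra G M. \<forall>v\<in>I. lie_bracket G M u v \<in> I)"

text \<open>A Lie algebra is reductive if every ideal has a complementary ideal.\<close>

definition reductive :: "'g monoid \<Rightarrow> ('g, 'e::euclidean_space) manifold \<Rightarrow> bool" where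
  "reductive G M \<longleftrightarrow> (\<forall>I. lie_ideal G M I \<longrightarrow> (\<exists>J. lie_ideal G M J \<and> I \<inter> J = {\<lambda>_. 0} \<and>
     (\<forall>u\<in>lie_algebra G M. \<exists>v\<in>I. \<exists>w\<in>J. u = (\<lambda>c. v c + w c))))"

definition cartan_p :: "'g monoid \<Rightarrow> ('g, 'e::euclidean_space) manifold \<Rightarrow> ('g \<Rightarrow> 'g) \<Rightarrow> ('g, 'e) tvec set" where
  "cartan_p G M \<theta> = {u \<in> lie_algebra G M. dmap M M \<theta> \<one>\<^bsub>G\<^esub> u = (\<lambda>c. - u c)}"

definition cartan_k :: "'g monoid \<Rightarrow> ('g, 'e::euclidean_space) manifold \<Rightarrow> ('g \<Rightarrow> 'g) \<Rightarrow> ('g, 'e) tvec set" where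
  "cartan_k G M \<theta> = {u \<in> lie_algebra G M. dmap M M \<theta> \<one>\<^bsub>G\<^esub> u = u}"

text \<open>
  \<open>X\<close> is the space of left cosets of \<open>K\<close>, with the quotient smooth structure (the one for which the
  canonical projection is a submersion) and the metric obtained by left translating the restriction
  of \<open>B\<close> to \<open>\<pp>\<close>.
\<close>

locale symmetric_space =
  fixes G :: "'g monoid"
    and M :: "('g, 'e::euclidean_space) manifold"
    and \<theta> :: "'g \<Rightarrow> 'g"
    and K :: "'g set"
    and B :: "('g, 'e) tvec \<Rightarrow> ('g, 'e) tvec \<Rightarrow> real"
    and X :: "('g set, 'a::euclidean_space) manifold"
    and met :: "'g set \<Rightarrow> ('g set, 'a) tvec \<Rightarrow> ('g set, 'a) tvec \<Rightarrow> real"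
  assumes lie_group: "lie_group G M"
    and connected: "connected_space (mtop M)"
    and simply_connected: "simply_connected_top (mtop M)"
    and reductive: "reductive G M"
    and theta_hom: "\<theta> \<in> hom G G"
    and theta_smooth: "smooth_map M M \<theta>"
    and theta_involution: "\<And>g. g \<in> carrier G \<Longrightarrow> \<theta> (\<theta> g) = g"
    and K_fixed: "K = {g \<in> carrier G. \<theta> g = g}"
    and K_compact: "compactin (mtop M) K"
    and K_maximal: "\<And>H. subgroup H G \<Longrightarrow> compactin (mtop M) H \<Longrightarrow> K \<subseteq> H \<Longrightarrow> H = K"
    and B_bilinear: "bilinear_form_on (lie_algebra G M) B"
    and B_sym: "\<And>u v. u \<in> lie_algebra G M \<Longrightarrow> v \<in> lie_algebra G M \<Longrightarrow> B u v = B v u"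
    and B_nondegenerate:
      "\<And>u. u \<in> lie_algebra G M \<Longrightarrow> (\<And>v. v \<in> lie_algebra G M \<Longrightarrow> B u v = 0) \<Longrightarrow> u = (\<lambda>_. 0)"
    and B_G_invariant:
      "\<And>g u v. g \<in> carrier G \<Longrightarrow> u \<in> lie_algebra G M \<Longrightarrow> v \<in> lie_algebra G M \<Longrightarrow>
         B (Ad G M g u) (Ad G M g v) = B u v"
    and B_theta_invariant:
      "\<And>u v. u \<in> lie_algebra G M \<Longrightarrow> v \<in> lie_algebra G M \<Longrightarrow>
         B (dmap M M \<theta> \<one>\<^bsub>G\<^esub> u) (dmap M M \<theta> \<one>\<^bsub>G\<^esub> v) = B u v"
    and B_pos: "\<And>u. u \<in> cartan_p G M \<theta> \<Longrightarrow> u \<noteq> (\<lambda>_. 0) \<Longrightarrow> B u u > 0"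
    and B_neg: "\<And>u. u \<in> cartan_k G M \<theta> \<Longrightarrow> u \<noteq> (\<lambda>_. 0) \<Longrightarrow> B u u < 0"
    and X_manifold: "smooth_manifold X"
    and X_points: "points X = lcosets\<^bsub>G\<^esub> K"
    and proj_smooth: "smooth_map M X (\<lambda>g. g <#\<^bsub>G\<^esub> K)"
    and proj_submersion:
      "\<And>g. g \<in> carrier G \<Longrightarrow> dmap M X (\<lambda>g. g <#\<^bsub>G\<^esub> K) g ` tangent M g = tangent X (g <#\<^bsub>G\<^esub> K)"
    and met_riemannian: "riemannian_metric X met"
    and met_induced:
      "\<And>g u v. g \<in> carrier G \<Longrightarrow> u \<in> cartan_p G M \<theta> \<Longrightarrow> v \<in> cartan_p G M \<theta> \<Longrightarrow>
         met (g <#\<^bsub>G\<^esub> K) (dmap M X (\<lambda>h. (g \<otimes>\<^bsub>G\<^esub> h) <#\<^bsub>G\<^esub> K) \<one>\<^bsub>G\<^esub> u)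
                      (dmap M X (\<lambda>h. (g \<otimes>\<^bsub>G\<^esub> h) <#\<^bsub>G\<^esub> K) \<one>\<^bsub>G\<^esub> v) = B u v"

definition base_point :: "'g monoid \<Rightarrow> 'g set \<Rightarrow> 'g set" where
  "base_point G K = \<one>\<^bsub>G\<^esub> <#\<^bsub>G\<^esub> K"

text \<open>The identification of \<open>\<pp>\<close> with the tangent space of \<open>X\<close> at the base point.\<close>

definition p_to_tangent ::
  "'g monoid \<Rightarrow> ('g, 'e::euclidean_space) manifold \<Rightarrow> 'g set \<Rightarrow> ('g set, 'a::euclidean_space) manifold
    \<Rightarrow> ('g, 'e) tvec \<Rightarrow> ('g set, 'a) tvec" where
  "p_to_tangent G M K X = dmap M X (\<lambda>g. g <#\<^bsub>G\<^esub> K) \<one>\<^bsub>G\<^esub>"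

section \<open>Brownian motion and the Ito integral\<close>

definition filtered_prob_space :: "'w measure \<Rightarrow> (real \<Rightarrow> 'w measure) \<Rightarrow> bool" where
  "filtered_prob_space P F \<longleftrightarrow>
     prob_space P \<and> filtration (space P) F \<and> (\<forall>t. sets (F t) \<subseteq> sets P)"

text \<open>
  Standard Brownian motion, with respect to the filtration \<open>F\<close>, in the Euclidean space
  \<open>(tangent N z, met z)\<close>. A Gaussian vector is standard iff its inner product with each unit vector
  is a standard normal variable.
\<close>

definition brownian_motion ::
  "'w measure \<Rightarrow> (real \<Rightarrow> 'w measure) \<Rightarrow> ('m, 'e::euclidean_space) manifold
    \<Rightarrow> ('m \<Rightarrow> ('m, 'e) tvec \<Rightarrow> ('m, 'e) tvec \<Rightarrow> real) \<Rightarrow> 'm \<Rightarrow> (real \<Rightarrow> 'w \<Rightarrow> ('m, 'e) tvec) \<Rightarrow> bool" where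
  "brownian_motion P F N met z w \<longleftrightarrow>
     (\<forall>t\<ge>0. \<forall>\<omega>\<in>space P. w t \<omega> \<in> tangent N z) \<and>
     (\<forall>t\<ge>0. \<forall>c. (\<lambda>\<omega>. w t \<omega> c) \<in> borel_measurable (F t)) \<and>
     (AE \<omega> in P. w 0 \<omega> = (\<lambda>_. 0)) \<and>
     (AE \<omega> in P. \<forall>c. continuous_on {0..} (\<lambda>t. w t \<omega> c)) \<and>
     (\<forall>s t. 0 \<le> s \<and> s < t \<longrightarrow>
        (\<forall>c\<in>charts_at N z. prob_space.indep_set P (sets (F s))
           {(\<lambda>\<omega>. w t \<omega> c - w s \<omega> c) -` S \<inter> space P | S. S \<in> sets borel}) \<and>
        (\<forall>u\<in>tangent N z. met z u u = 1 \<longrightarrow>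
           distributed P lborel (\<lambda>\<omega>. met z (\<lambda>c. w t \<omega> c - w s \<omega> c) u)
             (normal_density 0 (sqrt (t - s)))))"

text \<open>
  Simple (elementary predictable) integrands: \<open>\<xi> k\<close> on the time interval \<open>{T k<..T (Suc k)}\<close>,
  for \<open>k < n\<close>.
\<close>

definition simple_integrand ::
  "'w measure \<Rightarrow> (real \<Rightarrow> 'w measure) \<Rightarrow> nat \<Rightarrow> (nat \<Rightarrow> real) \<Rightarrow> (nat \<Rightarrow> 'w \<Rightarrow> real) \<Rightarrow> bool" where
  "simple_integrand P F n T \<xi> \<longleftrightarrow> 0 \<le> T 0 \<and> (\<forall>k<n. T k \<le> T (Suc k) \<and>
     \<xi> k \<in> borel_measurable (F (T k)) \<and> (\<exists>C. \<forall>\<omega>\<in>space P. \<bar>\<xi> k \<omega>\<bar> \<le> C))"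

definition simple_process ::
  "nat \<Rightarrow> (nat \<Rightarrow> real) \<Rightarrow> (nat \<Rightarrow> 'w \<Rightarrow> real) \<Rightarrow> real \<Rightarrow> 'w \<Rightarrow> real" where
  "simple_process n T \<xi> s \<omega> = (\<Sum>k<n. \<xi> k \<omega> * indicator {T k<..T (Suc k)} s)"

definition simple_integral ::
  "nat \<Rightarrow> (nat \<Rightarrow> real) \<Rightarrow> (nat \<Rightarrow> 'w \<Rightarrow> real) \<Rightarrow> (real \<Rightarrow> 'w \<Rightarrow> real) \<Rightarrow> real \<Rightarrow> 'w \<Rightarrow> real" where
  "simple_integral n T \<xi> \<beta> t \<omega> =
     (\<Sum>k<n. \<xi> k \<omega> * (\<beta> (min (T (Suc k)) t) \<omega> - \<beta> (min (T k) t) \<omega>))"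

definition progressively_measurable ::
  "(real \<Rightarrow> 'w measure) \<Rightarrow> (real \<Rightarrow> 'w \<Rightarrow> real) \<Rightarrow> bool" where
  "progressively_measurable F H \<longleftrightarrow>
     (\<forall>t\<ge>0. (\<lambda>(s, \<omega>). H s \<omega>) \<in> borel_measurable (restrict_space borel {0..t} \<Otimes>\<^sub>M F t))"

text \<open>
  \<open>I\<close> is (a continuous version of) the Ito integral process of \<open>H\<close> against the scalar Brownian
  motion \<open>\<beta>\<close>: it is the limit in probability of the integrals of simple integrands \<open>H\<^sup>m\<close> for which
  the integrals of \<open>(H\<^sup>m - H)\<^sup>2\<close> over \<open>{0..t}\<close> tend to \<open>0\<close> in probability, for every \<open>t\<close>.
\<close>

definition has_ito_integral ::
  "'w measure \<Rightarrow> (real \<Rightarrow> 'w measure) \<Rightarrow> (real \<Rightarrow> 'w \<Rightarrow> real) \<Rightarrow> (real \<Rightarrow> 'w \<Rightarrow> real)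
    \<Rightarrow> (real \<Rightarrow> 'w \<Rightarrow> real) \<Rightarrow> bool" where
  "has_ito_integral P F \<beta> H I \<longleftrightarrow>
     progressively_measurable F H \<and>
     (\<forall>t\<ge>0. AE \<omega> in P. (\<integral>\<^sup>+s\<in>{0..t}. ennreal ((H s \<omega>)\<^sup>2) \<partial>lborel) < \<infinity>) \<and>
     (\<forall>t\<ge>0. I t \<in> borel_measurable (F t)) \<and>
     (AE \<omega> in P. continuous_on {0..} (\<lambda>t. I t \<omega>)) \<and>
     (\<exists>n T \<xi>. (\<forall>m. simple_integrand P F (n m) (T m) (\<xi> m)) \<and>
        (\<forall>t\<ge>0. \<forall>\<epsilon>>0.
           (\<lambda>m. measure P {\<omega> \<in> space P.
              (\<integral>\<^sup>+s\<in>{0..t}. ennreal ((simple_process (n m) (T m) (\<xi> m) s \<omega> - H s \<omega>)\<^sup>2) \<partial>lborel)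
                > ennreal \<epsilon>}) \<longlonglongrightarrow> 0) \<and>
        (\<forall>t\<ge>0. \<forall>\<epsilon>>0.
           (\<lambda>m. measure P {\<omega> \<in> space P.
              \<bar>simple_integral (n m) (T m) (\<xi> m) \<beta> t \<omega> - I t \<omega>\<bar> > \<epsilon>}) \<longlonglongrightarrow> 0))"

text \<open>
  Ito integral of a process \<open>\<alpha>\<close> of linear forms on the Euclidean space \<open>(V, ip)\<close> against the
  \<open>V\<close>-valued Brownian motion \<open>w\<close>, as the sum over an orthonormal basis of the scalar integrals of
  the components; it does not depend on the basis.
\<close>

definition orthonormal_basis ::
  "('i \<Rightarrow> 'e::real_vector) set \<Rightarrow> (('i \<Rightarrow> 'e) \<Rightarrow> ('i \<Rightarrow> 'e) \<Rightarrow> real) \<Rightarrow> ('i \<Rightarrow> 'e) set \<Rightarrow> bool" where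
  "orthonormal_basis V ip E \<longleftrightarrow> finite E \<and> E \<subseteq> V \<and>
     (\<forall>e\<in>E. \<forall>e'\<in>E. ip e e' = (if e = e' then 1 else 0)) \<and>
     (\<forall>v\<in>V. v = (\<lambda>c. \<Sum>e\<in>E. ip v e *\<^sub>R e c))"

definition has_vector_ito_integral ::
  "'w measure \<Rightarrow> (real \<Rightarrow> 'w measure) \<Rightarrow> ('i \<Rightarrow> 'e::real_vector) set \<Rightarrow> (('i \<Rightarrow> 'e) \<Rightarrow> ('i \<Rightarrow> 'e) \<Rightarrow> real)
    \<Rightarrow> (real \<Rightarrow> 'w \<Rightarrow> 'i \<Rightarrow> 'e) \<Rightarrow> (real \<Rightarrow> 'w \<Rightarrow> ('i \<Rightarrow> 'e) \<Rightarrow> real) \<Rightarrow> (real \<Rightarrow> 'w \<Rightarrow> real) \<Rightarrow> bool" where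
  "has_vector_ito_integral P F V ip w \<alpha> I \<longleftrightarrow>
     (\<exists>E J. orthonormal_basis V ip E \<and>
        (\<forall>e\<in>E. has_ito_integral P F (\<lambda>t \<omega>. ip (w t \<omega>) e) (\<lambda>s \<omega>. \<alpha> s \<omega> e) (J e)) \<and>
        (AE \<omega> in P. \<forall>t\<ge>0. I t \<omega> = (\<Sum>e\<in>E. J e t \<omega>)))"

section \<open>The hypoelliptic diffusion\<close>

text \<open>
  Solutions of \<open>\<dot>x = Y/b\<close>, \<open>\<dot>Y = -Y/b\<^sup>2 + \<dot>w/b\<close> with \<open>x 0 = z\<close>, \<open>Y 0 = Y0\<close>. Since Brownian paths are not
  differentiable, the second equation is read in integrated form after parallel transport back to
  the tangent space at \<open>z\<close>: if \<open>Y = \<tau> y\<close> then \<open>\<tau>\<close> maps \<open>dy/dt\<close> to the covariant derivative of \<open>Y\<close>, so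
  the equation becomes \<open>y\<^sub>t = Y0 - b\<^sup>-\<^sup>2 \<integral>\<^sub>0\<^sup>t y\<^sub>s ds + w\<^sub>t/b\<close>. The measurability clauses say that
  \<open>(x, Y)\<close> is adapted.
\<close>

definition hypoelliptic_diffusion ::
  "'w measure \<Rightarrow> (real \<Rightarrow> 'w measure) \<Rightarrow> ('m, 'e::euclidean_space) manifold \<Rightarrow> ('m, 'e) christoffel
    \<Rightarrow> real \<Rightarrow> 'm \<Rightarrow> ('m, 'e) tvec \<Rightarrow> (real \<Rightarrow> 'w \<Rightarrow> ('m, 'e) tvec)
    \<Rightarrow> (real \<Rightarrow> 'w \<Rightarrow> 'm) \<Rightarrow> (real \<Rightarrow> 'w \<Rightarrow> ('m, 'e) tvec)
    \<Rightarrow> (real \<Rightarrow> 'w \<Rightarrow> ('m, 'e) tvec \<Rightarrow> ('m, 'e) tvec) \<Rightarrow> bool" where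
  "hypoelliptic_diffusion P F N \<Gamma> b z Y0 w x Y \<tau> \<longleftrightarrow>
     (\<forall>t\<ge>0. \<forall>\<omega>\<in>space P. x t \<omega> \<in> points N \<and> Y t \<omega> \<in> tangent N (x t \<omega>)) \<and>
     (\<forall>t\<ge>0. \<forall>U. openin (mtop N) U \<longrightarrow> {\<omega> \<in> space P. x t \<omega> \<in> U} \<in> sets (F t)) \<and>
     (\<forall>t\<ge>0. \<forall>c. (\<lambda>\<omega>. Y t \<omega> c) \<in> borel_measurable (F t)) \<and>
     (AE \<omega> in P.
        x 0 \<omega> = z \<and> Y 0 \<omega> = Y0 \<and>
        has_velocity N (\<lambda>t. x t \<omega>) (\<lambda>t c. Y t \<omega> c /\<^sub>R b) \<and>
        parallel_transport N \<Gamma> (\<lambda>t. x t \<omega>) (\<lambda>t c. Y t \<omega> c /\<^sub>R b) (\<lambda>t. \<tau> t \<omega>) \<and>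
        (\<exists>y. (\<forall>c. continuous_on {0..} (\<lambda>t. y t c)) \<and>
           (\<forall>t\<ge>0. y t \<in> tangent N z \<and> Y t \<omega> = \<tau> t \<omega> (y t) \<and>
              (\<forall>c. y t c = Y0 c - integral {0..t} (\<lambda>s. y s c) /\<^sub>R b\<^sup>2 + w t \<omega> c /\<^sub>R b))))"

end

theory Submission
  imports Defs
begin

text \<open>
  The velocity of \<open>x\<close> is \<open>Y/b = \<tau> y/b\<close>, where the parallel transport \<open>\<tau>\<close> is a \<open>C\<^sup>1\<close> function of time, and
  only \<open>y\<close>, a process in the fixed tangent space at the base point, has a Brownian part. For \<open>e\<close> in an
  orthonormal basis of that space let \<open>\<alpha> e t = df(\<tau>\<^sub>t e)\<close>. Then \<open>b d/dt f(x\<^sub>t) = \<Sum>\<^sub>e \<langle>y\<^sub>t, e\<rangle> \<alpha> e t\<close>, and since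
  \<open>\<tau> e\<close> is parallel, \<open>\<alpha> e\<close> has the continuous derivative \<open>\<nabla>\<^sub>Y\<^sub>/\<^sub>b df(\<tau> e)\<close>. The Ito integral of an adapted integrand with
  \<open>C\<^sup>1\<close> paths is the pathwise integral \<open>\<alpha>\<^sub>t \<beta>\<^sub>t - \<alpha>\<^sub>0 \<beta>\<^sub>0 - \<integral> \<alpha>' \<beta> ds\<close>. The product rule for \<open>\<langle>y, e\<rangle> \<alpha> e\<close>
  therefore needs no Ito formula, and summing over \<open>e\<close> gives the first identity. It is a linear
  first-order equation for \<open>f(x\<^sub>t)\<close> on almost every path, whose solution is the second identity.
\<close>

section \<open>Martingale transforms\<close>

text \<open>The Ito integral is specified only through some sequence of simple integrands, on grids
  unrelated to each other and converging in probability without moment bounds. Inserting the grid of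
  each simple integrand into a fine partition of [0,t] writes its integral and the Riemann-Stieltjes
  sum of the true integrand against the same increments. The difference is a martingale transform
  whose quadratic variation tends to 0 in probability; stopping it supplies the second moments that
  are missing. The Riemann-Stieltjes sums converge path by path, since the derivative can be moved
  onto the integrand. The geometric obstacle is that \<open>hessian\<close> is evaluated in a chosen
  chart, which may jump along the curve, so that the continuity of \<open>\<alpha>'\<close> is not
  visible from the formula. Comparing derivatives of df along parallel fields shows that every chart
  gives the same value, and a single chart can then be kept near each time.\<close>

locale independent_increments = prob_space P
  for P :: "'w measure" +
  fixes F :: "nat \<Rightarrow> 'w measure" and d :: "nat \<Rightarrow> 'w \<Rightarrow> real" and v :: "nat \<Rightarrow> real" and n :: nat
  assumes space_F: "\<And>k. space (F k) = space P"
    and F_mono: "\<And>j k. j \<le> k \<Longrightarrow> sets (F j) \<subseteq> sets (F k)"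
    and F_sub: "\<And>k. sets (F k) \<subseteq> sets P"
    and d_meas: "\<And>k. k < n \<Longrightarrow> d k \<in> borel_measurable (F (Suc k))"
    and d_indep: "\<And>k. k < n \<Longrightarrow> indep_set (sets (F k)) {d k -` S \<inter> space P | S. S \<in> sets borel}"
    and d_int: "\<And>k. k < n \<Longrightarrow> integrable P (d k)"
    and d_mean: "\<And>k. k < n \<Longrightarrow> expectation (d k) = 0"
    and d_sq_int: "\<And>k. k < n \<Longrightarrow> integrable P (\<lambda>\<omega>. (d k \<omega>)\<^sup>2)"
    and d_var: "\<And>k. k < n \<Longrightarrow> expectation (\<lambda>\<omega>. (d k \<omega>)\<^sup>2) = v k"
    and v_pos: "\<And>k. k < n \<Longrightarrow> v k > 0"
begin

lemma F_meas_mono: "j \<le> k \<Longrightarrow> g \<in> borel_measurable (F j) \<Longrightarrow> g \<in> borel_measurable (F k)"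
  using F_mono[of j k] space_F[of j] space_F[of k] unfolding measurable_def by auto

lemma F_meas_P: "g \<in> borel_measurable (F j) \<Longrightarrow> g \<in> borel_measurable P"
  using F_sub[of j] space_F[of j] unfolding measurable_def by auto

text \<open>The independence assumption concerns two intersection-stable families, so it extends to
  the sigma-algebras they generate, and these contain the preimages under \<open>g\<close> and under
  \<open>h\<close> composed with \<open>d k\<close>.\<close>

lemma past_future_indep:
  assumes k: "k < n" and g: "g \<in> borel_measurable (F k)" and h: "(h :: real \<Rightarrow> real) \<in> borel_measurable borel"
  shows "indep_var borel g borel (\<lambda>\<omega>. h (d k \<omega>))"
proof -
  have dP: "d k \<in> borel_measurable P" using d_meas[OF k] by (rule F_meas_P)
  have A: "sigma_sets (space P) {g -` A \<inter> space P |A. A \<in> sets borel} \<subseteq> sets (F k)"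
    unfolding space_F[of k, symmetric]
    by (rule sets.sigma_sets_subset) (use measurable_sets[OF g] in auto)
  let ?D = "{d k -` S \<inter> space P | S. S \<in> sets borel}"
  have *: "{(\<lambda>\<omega>. h (d k \<omega>)) -` A \<inter> space P |A. A \<in> sets borel} \<subseteq> ?D"
  proof clarify
    fix A :: "real set" assume "A \<in> sets borel"
    then have "h -` A \<in> sets borel" using measurable_sets[OF h] by simp
    then show "\<exists>S. (\<lambda>\<omega>. h (d k \<omega>)) -` A \<inter> space P = d k -` S \<inter> space P \<and> S \<in> sets borel"
      by (intro exI[of _ "h -` A"]) auto
  qed
  have Int: "Int_stable ?D"
    unfolding Int_stable_def
  proof clarify
    fix S T :: "real set" assume "S \<in> sets borel" "T \<in> sets borel"
    then show "\<exists>U. d k -` S \<inter> space P \<inter> (d k -` T \<inter> space P) = d k -` U \<inter> space P \<and> U \<in> sets borel"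
      by (intro exI[of _ "S \<inter> T"]) auto
  qed
  have "indep_set (sigma_sets (space P) (sets (F k))) (sigma_sets (space P) ?D)"
    by (rule indep_set_sigma_sets[OF d_indep[OF k] _ Int]) (auto simp: Int_stable_def)
  then have I: "indep_set (sets (F k)) (sigma_sets (space P) ?D)"
    using sets.sigma_sets_eq[of "F k"] space_F[of k] by simp
  have "indep_set (sigma_sets (space P) {g -` A \<inter> space P |A. A \<in> sets borel})
      (sigma_sets (space P) {(\<lambda>\<omega>. h (d k \<omega>)) -` A \<inter> space P |A. A \<in> sets borel})"
    using I unfolding indep_set_def
    by (rule indep_sets_mono_sets) (use A sigma_sets_mono'[OF *] in \<open>auto split: bool.split\<close>)
  moreover have "g \<in> borel_measurable P" using g by (rule F_meas_P)
  ultimately show ?thesis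
    unfolding indep_var_eq using h dP by auto
qed

text \<open>When the square of the partial sum \<open>S\<close> plus a new term is expanded, the
  cross term has mean E(S z) E(d) = 0 and the last term has mean E(z^2) v, because \<open>S\<close>
  and \<open>z m\<close> belong to the past of \<open>d m\<close>. The bound \<open>C\<close> makes
  the past factors integrable.\<close>

lemma martingale_transform_second_moment:
  assumes z: "\<And>k. k < n \<Longrightarrow> z k \<in> borel_measurable (F k)"
    and C: "\<And>k \<omega>. k < n \<Longrightarrow> \<omega> \<in> space P \<Longrightarrow> \<bar>z k \<omega>\<bar> \<le> C"
    and "m \<le> n"
  shows "(\<lambda>\<omega>. \<Sum>k<m. z k \<omega> * d k \<omega>) \<in> borel_measurable (F m) \<and>
    integrable P (\<lambda>\<omega>. (\<Sum>k<m. z k \<omega> * d k \<omega>)\<^sup>2) \<and>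
    expectation (\<lambda>\<omega>. (\<Sum>k<m. z k \<omega> * d k \<omega>)\<^sup>2) = expectation (\<lambda>\<omega>. \<Sum>k<m. (z k \<omega>)\<^sup>2 * v k)"
  using \<open>m \<le> n\<close>
proof (induction m)
  case 0
  then show ?case by simp
next
  case (Suc m)
  then have m: "m < n" by simp
  define S where "S \<omega> = (\<Sum>k<m. z k \<omega> * d k \<omega>)" for \<omega>
  have IH: "S \<in> borel_measurable (F m)" "integrable P (\<lambda>\<omega>. (S \<omega>)\<^sup>2)"
    "expectation (\<lambda>\<omega>. (S \<omega>)\<^sup>2) = expectation (\<lambda>\<omega>. \<Sum>k<m. (z k \<omega>)\<^sup>2 * v k)"
    using Suc unfolding S_def by auto
  note zm = z[OF m]
  have zP: "z k \<in> borel_measurable P" if "k < n" for k using z[OF that] by (rule F_meas_P)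
  have z2: "integrable P (\<lambda>\<omega>. (z k \<omega>)\<^sup>2)" if "k < n" for k
  proof (rule integrable_const_bound[of _ "C\<^sup>2"])
    show "AE \<omega> in P. norm ((z k \<omega>)\<^sup>2) \<le> C\<^sup>2"
      using C[OF that] by (intro AE_I2) (auto intro!: abs_le_square_iff[THEN iffD1] order_trans[OF _ abs_ge_self])
  qed (use zP[OF that] in simp)
  have SP: "S \<in> borel_measurable P" using IH(1) by (rule F_meas_P)
  have Sint: "integrable P S"
    by (rule square_integrable_imp_integrable[OF SP]) (use IH(2) in simp)
  have Sz: "integrable P (\<lambda>\<omega>. S \<omega> * z m \<omega>)"
  proof (rule Bochner_Integration.integrable_bound[of _ "\<lambda>\<omega>. C * S \<omega>"])
    show "AE \<omega> in P. norm (S \<omega> * z m \<omega>) \<le> norm (C * S \<omega>)"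
    proof (intro AE_I2)
      fix \<omega> assume "\<omega> \<in> space P"
      from C[OF m this] have "\<bar>z m \<omega>\<bar> \<le> \<bar>C\<bar>" by simp
      then show "norm (S \<omega> * z m \<omega>) \<le> norm (C * S \<omega>)"
        using mult_right_mono[of "\<bar>z m \<omega>\<bar>" "\<bar>C\<bar>" "\<bar>S \<omega>\<bar>"] by (simp add: abs_mult mult.commute)
    qed
  qed (use Sint SP zP[OF m] in auto)
  have iv1: "indep_var borel (\<lambda>\<omega>. S \<omega> * z m \<omega>) borel (\<lambda>\<omega>. d m \<omega>)"
    by (rule past_future_indep[OF m borel_measurable_times[OF IH(1) zm], of "\<lambda>x. x"]) simp
  have iv2: "indep_var borel (\<lambda>\<omega>. (z m \<omega>)\<^sup>2) borel (\<lambda>\<omega>. (d m \<omega>)\<^sup>2)"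
    by (rule past_future_indep[OF m borel_measurable_power[OF zm], of "\<lambda>x. x\<^sup>2"]) simp
  have i1: "integrable P (\<lambda>\<omega>. S \<omega> * z m \<omega> * d m \<omega>)" "expectation (\<lambda>\<omega>. S \<omega> * z m \<omega> * d m \<omega>) = 0"
    using indep_var_integrable[OF iv1 Sz d_int[OF m]] indep_var_lebesgue_integral[OF iv1 Sz d_int[OF m]]
      d_mean[OF m] by auto
  have i2: "integrable P (\<lambda>\<omega>. (z m \<omega>)\<^sup>2 * (d m \<omega>)\<^sup>2)"
      "expectation (\<lambda>\<omega>. (z m \<omega>)\<^sup>2 * (d m \<omega>)\<^sup>2) = expectation (\<lambda>\<omega>. (z m \<omega>)\<^sup>2 * v m)"
    using indep_var_integrable[OF iv2 z2[OF m] d_sq_int[OF m]] indep_var_lebesgue_integral[OF iv2 z2[OF m] d_sq_int[OF m]]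
      d_var[OF m] by auto
  have sq: "(\<Sum>k<Suc m. z k \<omega> * d k \<omega>)\<^sup>2 = (S \<omega>)\<^sup>2 + 2 * (S \<omega> * z m \<omega> * d m \<omega>) + (z m \<omega>)\<^sup>2 * (d m \<omega>)\<^sup>2" for \<omega>
    by (simp add: S_def power2_eq_square algebra_simps)
  have sums: "integrable P (\<lambda>\<omega>. \<Sum>k<m. (z k \<omega>)\<^sup>2 * v k)"
    by (intro Bochner_Integration.integrable_sum integrable_mult_left z2) (use m in auto)
  show ?case
  proof (intro conjI)
    have "d m \<in> borel_measurable (F (Suc m))" "z m \<in> borel_measurable (F (Suc m))" "S \<in> borel_measurable (F (Suc m))"
      using d_meas[OF m] zm IH(1) F_meas_mono[of m "Suc m"] by auto
    then show "(\<lambda>\<omega>. \<Sum>k<Suc m. z k \<omega> * d k \<omega>) \<in> borel_measurable (F (Suc m))"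
      unfolding S_def[abs_def] by simp
    show "integrable P (\<lambda>\<omega>. (\<Sum>k<Suc m. z k \<omega> * d k \<omega>)\<^sup>2)"
      unfolding sq using IH(2) i1(1) i2(1) by auto
    have "expectation (\<lambda>\<omega>. (\<Sum>k<Suc m. z k \<omega> * d k \<omega>)\<^sup>2)
        = expectation (\<lambda>\<omega>. \<Sum>k<m. (z k \<omega>)\<^sup>2 * v k) + expectation (\<lambda>\<omega>. (z m \<omega>)\<^sup>2 * v m)"
      unfolding sq using IH(2,3) i1 i2 by simp
    also have "\<dots> = expectation (\<lambda>\<omega>. (\<Sum>k<m. (z k \<omega>)\<^sup>2 * v k) + (z m \<omega>)\<^sup>2 * v m)"
      by (rule Bochner_Integration.integral_add[symmetric]) (use sums z2[OF m] in auto)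
    finally show "expectation (\<lambda>\<omega>. (\<Sum>k<Suc m. z k \<omega> * d k \<omega>)\<^sup>2) = expectation (\<lambda>\<omega>. \<Sum>k<Suc m. (z k \<omega>)\<^sup>2 * v k)"
      by simp
  qed
qed

text \<open>The transform is stopped as soon as \<open>\<Sum> z\<^sup>2 v\<close> exceeds \<open>N\<close>; this also makes the integrands bounded.\<close>

lemma martingale_transform_tail:
  assumes z: "\<And>k. k < n \<Longrightarrow> z k \<in> borel_measurable (F k)"
    and \<epsilon>: "\<epsilon> > 0" and N: "N > 0"
  shows "prob {\<omega> \<in> space P. \<bar>\<Sum>k<n. z k \<omega> * d k \<omega>\<bar> > \<epsilon>}
    \<le> prob {\<omega> \<in> space P. (\<Sum>k<n. (z k \<omega>)\<^sup>2 * v k) > N} + N / \<epsilon>\<^sup>2"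
proof -
  define q where "q k \<omega> = (\<Sum>j<k. (z j \<omega>)\<^sup>2 * v j)" for k \<omega>
  \<comment> \<open>The test uses \<open>q (Suc k)\<close>, which already contains the current term
    but only \<open>z 0\<close>, ..., \<open>z k\<close>. Hence \<open>y k\<close> is still known at
    time \<open>k\<close>, and the stopped sum never exceeds \<open>N\<close>.\<close>
  define y where "y k \<omega> = (if q (Suc k) \<omega> \<le> N then z k \<omega> else 0)" for k \<omega>
  have q_mono: "q k \<omega> \<le> q m \<omega>" if "k \<le> m" "m \<le> n" for k m \<omega>
    unfolding q_def by (rule sum_mono2) (use that v_pos in \<open>auto simp: less_imp_le\<close>)
  have qF: "q (Suc k) \<in> borel_measurable (F k)" if "k < n" for k
    unfolding q_def[abs_def]
  proof (intro borel_measurable_sum borel_measurable_times borel_measurable_power borel_measurable_const)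
    fix i assume "i \<in> {..<Suc k}"
    then show "z i \<in> borel_measurable (F k)" using F_meas_mono[of i k] z[of i] that by auto
  qed
  have yF: "y k \<in> borel_measurable (F k)" if "k < n" for k
    unfolding y_def[abs_def] using qF[OF that] z[OF that] by measurable
  have sum_y: "(\<Sum>k<m. (y k \<omega>)\<^sup>2 * v k) \<le> N" if "m \<le> n" for m \<omega>
    using that
  proof (induction m)
    case 0
    then show ?case using N by simp
  next
    case (Suc m)
    show ?case
    proof (cases "q (Suc m) \<omega> \<le> N")
      case True
      have "(\<Sum>k<Suc m. (y k \<omega>)\<^sup>2 * v k) \<le> q (Suc m) \<omega>"
        unfolding q_def by (rule sum_mono) (use v_pos Suc.prems in \<open>auto simp: y_def less_imp_le\<close>)
      then show ?thesis using True by simp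
    next
      case False
      then show ?thesis using Suc by (simp add: y_def)
    qed
  qed
  have y_single: "(y k \<omega>)\<^sup>2 * v k \<le> N" if "k < n" for k \<omega>
  proof -
    have "(y k \<omega>)\<^sup>2 * v k \<le> (\<Sum>j<Suc k. (y j \<omega>)\<^sup>2 * v j)"
      using that v_pos by (auto intro!: sum_nonneg simp: less_imp_le)
    also have "\<dots> \<le> N" using sum_y[of "Suc k"] that by simp
    finally show ?thesis .
  qed
  \<comment> \<open>A single term of the stopped sum is at most \<open>N\<close>, so the
    \<open>k\<close>-th integrand is at most \<open>sqrt (N / v k)\<close>; adding these bounds
    gives one constant valid for all \<open>k\<close>.\<close>
  define C where "C = (\<Sum>k<n. sqrt (N / v k))"
  have yC: "\<bar>y k \<omega>\<bar> \<le> C" if "k < n" for k \<omega>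
  proof -
    have "(y k \<omega>)\<^sup>2 \<le> N / v k" using y_single[OF that] v_pos[OF that] by (simp add: field_simps)
    then have "\<bar>y k \<omega>\<bar> \<le> sqrt (N / v k)" by (simp add: real_le_rsqrt)
    also have "\<dots> \<le> C"
      unfolding C_def by (rule member_le_sum) (use that v_pos N in \<open>auto simp: less_imp_le\<close>)
    finally show ?thesis .
  qed
  define S where "S \<omega> = (\<Sum>k<n. y k \<omega> * d k \<omega>)" for \<omega>
  have S: "S \<in> borel_measurable (F n)" "integrable P (\<lambda>\<omega>. (S \<omega>)\<^sup>2)"
     "expectation (\<lambda>\<omega>. (S \<omega>)\<^sup>2) = expectation (\<lambda>\<omega>. \<Sum>k<n. (y k \<omega>)\<^sup>2 * v k)"
    using martingale_transform_second_moment[OF yF yC, of n] unfolding S_def[abs_def] by auto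
  have [measurable]: "S \<in> borel_measurable P" using S(1) by (rule F_meas_P)
  have "expectation (\<lambda>\<omega>. (S \<omega>)\<^sup>2) \<le> expectation (\<lambda>_. N)"
    unfolding S(3)
  proof (rule integral_mono)
    show "integrable P (\<lambda>\<omega>. \<Sum>k<n. (y k \<omega>)\<^sup>2 * v k)"
    proof (rule integrable_const_bound[of _ N])
      show "AE \<omega> in P. norm (\<Sum>k<n. (y k \<omega>)\<^sup>2 * v k) \<le> N"
      proof (intro AE_I2)
        fix \<omega>
        have "0 \<le> (\<Sum>k<n. (y k \<omega>)\<^sup>2 * v k)" by (rule sum_nonneg) (use v_pos in \<open>auto simp: less_imp_le\<close>)
        then show "norm (\<Sum>k<n. (y k \<omega>)\<^sup>2 * v k) \<le> N" using sum_y[of n \<omega>] by simp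
      qed
      have "\<And>k. k < n \<Longrightarrow> y k \<in> borel_measurable P" using yF F_meas_P by blast
      then show "(\<lambda>\<omega>. \<Sum>k<n. (y k \<omega>)\<^sup>2 * v k) \<in> borel_measurable P" by measurable
    qed
  qed (use sum_y[of n] in auto)
  then have ES: "expectation (\<lambda>\<omega>. (S \<omega>)\<^sup>2) \<le> N" by (simp add: prob_space)
  have tail: "prob {\<omega> \<in> space P. \<bar>S \<omega>\<bar> \<ge> \<epsilon>} \<le> N / \<epsilon>\<^sup>2"
  proof -
    have "prob {\<omega> \<in> space P. \<bar>S \<omega>\<bar> \<ge> \<epsilon>} \<le> expectation (\<lambda>\<omega>. (S \<omega>)\<^sup>2) / \<epsilon>\<^sup>2"
      by (rule second_moment_method) (use S \<epsilon> in auto)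
    also have "\<dots> \<le> N / \<epsilon>\<^sup>2" using ES by (simp add: divide_right_mono)
    finally show ?thesis .
  qed
  have same: "S \<omega> = (\<Sum>k<n. z k \<omega> * d k \<omega>)" if "q n \<omega> \<le> N" for \<omega>
  proof -
    have "q (Suc k) \<omega> \<le> N" if "k < n" for k
      using \<open>q n \<omega> \<le> N\<close> q_mono[of "Suc k" n \<omega>] that by simp
    then show ?thesis unfolding S_def by (intro sum.cong) (auto simp: y_def)
  qed
  have [measurable]: "z k \<in> borel_measurable P" if "k < n" for k
    using z[OF that] by (rule F_meas_P)
  have qP[measurable]: "q n \<in> borel_measurable P"
    unfolding q_def[abs_def] by measurable
  have "prob {\<omega> \<in> space P. \<bar>\<Sum>k<n. z k \<omega> * d k \<omega>\<bar> > \<epsilon>}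
      \<le> prob ({\<omega> \<in> space P. q n \<omega> > N} \<union> {\<omega> \<in> space P. \<bar>S \<omega>\<bar> \<ge> \<epsilon>})"
  proof (rule finite_measure_mono)
    show "{\<omega> \<in> space P. \<bar>\<Sum>k<n. z k \<omega> * d k \<omega>\<bar> > \<epsilon>} \<subseteq> {\<omega> \<in> space P. q n \<omega> > N} \<union> {\<omega> \<in> space P. \<bar>S \<omega>\<bar> \<ge> \<epsilon>}"
    proof
      fix \<omega> assume "\<omega> \<in> {\<omega> \<in> space P. \<bar>\<Sum>k<n. z k \<omega> * d k \<omega>\<bar> > \<epsilon>}"
      then show "\<omega> \<in> {\<omega> \<in> space P. q n \<omega> > N} \<union> {\<omega> \<in> space P. \<bar>S \<omega>\<bar> \<ge> \<epsilon>}"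
        using same[of \<omega>] by (cases "q n \<omega> \<le> N") auto
    qed
  qed auto
  also have "\<dots> \<le> prob {\<omega> \<in> space P. q n \<omega> > N} + prob {\<omega> \<in> space P. \<bar>S \<omega>\<bar> \<ge> \<epsilon>}"
    by (rule measure_Un_le) auto
  finally show ?thesis using tail by (simp add: q_def)
qed

end

section \<open>Convergence in probability and almost sure convergence\<close>

lemma (in prob_space) tends_in_prob_AE_subseq:
  fixes D :: "nat \<Rightarrow> 'a \<Rightarrow> ennreal"
  assumes [measurable]: "\<And>m. D m \<in> borel_measurable M"
    and lim: "\<And>\<epsilon>. \<epsilon> > 0 \<Longrightarrow> (\<lambda>m. prob {\<omega> \<in> space M. D m \<omega> > ennreal \<epsilon>}) \<longlonglongrightarrow> 0"
  shows "\<exists>r :: nat \<Rightarrow> nat. strict_mono r \<and> (AE \<omega> in M. (\<lambda>k. D (r k) \<omega>) \<longlonglongrightarrow> 0)"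
proof -
  \<comment> \<open>The levels (1/2)^k tend to 0 and the probabilities of exceeding them are
    summable along the subsequence, as Borel-Cantelli requires.\<close>
  have "\<exists>r. strict_mono r \<and> (\<forall>k. prob {\<omega> \<in> space M. D (r k) \<omega> > ennreal ((1/2)^k)} \<le> (1/2)^k)"
  proof -
    have ex: "\<exists>m>m0. prob {\<omega> \<in> space M. D m \<omega> > ennreal ((1/2)^k)} \<le> (1/2)^k" for m0 k
    proof -
      have "eventually (\<lambda>m. prob {\<omega> \<in> space M. D m \<omega> > ennreal ((1/2)^k)} < (1/2)^k) sequentially"
        by (rule order_tendstoD(2)[OF lim]) auto
      then have "eventually (\<lambda>m. prob {\<omega> \<in> space M. D m \<omega> > ennreal ((1/2)^k)} < (1/2)^k \<and> m > m0) sequentially"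
        using eventually_gt_at_top by (rule eventually_conj)
      then show ?thesis
        by (auto dest!: eventually_happens intro: less_imp_le)
    qed
    obtain r where r: "\<And>k. prob {\<omega> \<in> space M. D (r k) \<omega> > ennreal ((1/2)^k)} \<le> (1/2)^k" "\<And>k. r k < r (Suc k)"
      using dependent_nat_choice[of "\<lambda>k m. prob {\<omega> \<in> space M. D m \<omega> > ennreal ((1/2)^k)} \<le> (1/2)^k" "\<lambda>k m m'. m < m'"]
        ex by blast
    then show ?thesis by (auto simp: strict_mono_Suc_iff)
  qed
  then obtain r :: "nat \<Rightarrow> nat" where r: "strict_mono r"
    and pr: "\<And>k. prob {\<omega> \<in> space M. D (r k) \<omega> > ennreal ((1/2)^k)} \<le> (1/2)^k" by blast
  have "AE \<omega> in M. eventually (\<lambda>k. \<omega> \<in> space M - {\<omega> \<in> space M. D (r k) \<omega> > ennreal ((1/2)^k)}) sequentially"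
  proof (rule borel_cantelli_AE1)
    show "summable (\<lambda>k. prob {\<omega> \<in> space M. D (r k) \<omega> > ennreal ((1/2)^k)})"
      by (rule summable_comparison_test'[of "\<lambda>k. (1/2::real)^k" 0]) (use pr in \<open>auto intro: summable_geometric\<close>)
  qed (auto simp: emeasure_eq_measure)
  then have "AE \<omega> in M. (\<lambda>k. D (r k) \<omega>) \<longlonglongrightarrow> 0"
  proof (eventually_elim)
    case (elim \<omega>)
    have "(\<lambda>k. ennreal ((1/2)^k)) \<longlonglongrightarrow> ennreal 0"
      by (intro tendsto_ennrealI LIMSEQ_power_zero) auto
    then have lim0: "(\<lambda>k. ennreal ((1/2)^k)) \<longlonglongrightarrow> 0" by simp
    have "eventually (\<lambda>k. D (r k) \<omega> \<le> ennreal ((1/2)^k)) sequentially"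
      using elim by (rule eventually_mono) (auto simp: not_less)
    from tendsto_sandwich[OF _ this tendsto_const lim0] show ?case by simp
  qed
  then show ?thesis using r by blast
qed

text \<open>Almost surely the indicator of the event is eventually 0; dominated convergence with
  bound 1 carries this over to its expectation.\<close>

lemma (in prob_space) AE_tendsto_imp_in_prob:
  fixes D :: "nat \<Rightarrow> 'a \<Rightarrow> real"
  assumes [measurable]: "\<And>m. D m \<in> borel_measurable M"
    and lim: "AE \<omega> in M. (\<lambda>m. D m \<omega>) \<longlonglongrightarrow> 0" and \<epsilon>: "\<epsilon> > 0"
  shows "(\<lambda>m. prob {\<omega> \<in> space M. D m \<omega> > \<epsilon>}) \<longlonglongrightarrow> 0"
proof -
  have "(\<lambda>m. \<integral>\<omega>. indicat_real {\<omega> \<in> space M. D m \<omega> > \<epsilon>} \<omega> \<partial>M) \<longlonglongrightarrow> (\<integral>\<omega>. 0 \<partial>M)"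
  proof (rule integral_dominated_convergence[where w="\<lambda>_. 1"])
    show "AE \<omega> in M. (\<lambda>m. indicat_real {\<omega> \<in> space M. D m \<omega> > \<epsilon>} \<omega>) \<longlonglongrightarrow> 0"
      using lim
    proof eventually_elim
      case (elim \<omega>)
      have "eventually (\<lambda>m. D m \<omega> < \<epsilon>) sequentially" by (rule order_tendstoD(2)[OF elim \<epsilon>])
      then show ?case by (intro tendsto_eventually) (auto elim: eventually_mono)
    qed
  qed auto
  then show ?thesis by simp
qed

section \<open>Partitions and Riemann-Stieltjes sums\<close>

text \<open>The points of \<open>A\<close> are merged with the uniform grid of step t/(m+1) and
  sorted. Listing a set removes repetitions, whence the strict increase; the uniform grid controls
  the mesh. In the application \<open>A\<close> holds the jump times of a simple integrand.\<close>

lemma fine_partition: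
  fixes A :: "real set"
  assumes A: "finite A" "A \<subseteq> {0..t}" and t: "t > 0"
  shows "\<exists>N s. s 0 = 0 \<and> s N = t \<and> mono s \<and> (\<forall>k<N. s k < s (Suc k)) \<and>
    (\<forall>k<N. s (Suc k) - s k \<le> t / Suc m) \<and> A \<subseteq> s ` {..N}"
proof -
  define D where "D = insert 0 (insert t A) \<union> (\<lambda>i. t * real i / Suc m) ` {..Suc m}"
  define xs where "xs = sorted_list_of_set D"
  define N where "N = length xs - 1"
  \<comment> \<open>Freezing the index at \<open>N\<close> makes \<open>s\<close> a monotone
    function on all naturals, constantly \<open>t\<close> from \<open>N\<close> on.\<close>
  define s where "s k = xs ! min k N" for k
  have fin: "finite D" using A(1) by (simp add: D_def)
  have sub: "D \<subseteq> {0..t}"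
  proof -
    have "t * real i / Suc m \<in> {0..t}" if "i \<le> Suc m" for i
    proof -
      have "t * real i \<le> t * real (Suc m)" using t that by (intro mult_left_mono) auto
      then show ?thesis using t by (simp add: divide_le_eq)
    qed
    then show ?thesis using A(2) t by (auto simp: D_def)
  qed
  have set_xs: "set xs = D" using fin by (simp add: xs_def)
  have "D \<noteq> {}" by (auto simp: D_def)
  then have len: "length xs = Suc N" using set_xs by (cases xs) (auto simp: N_def)
  have srt: "sorted_wrt (<) xs" unfolding xs_def by (rule strict_sorted_list_of_set)
  have lt: "xs ! i < xs ! j" if "i < j" "j < length xs" for i j
    using sorted_wrt_nth_less[OF srt that] .
  have le: "xs ! i \<le> xs ! j" if "i \<le> j" "j < length xs" for i j
    using lt[of i j] that by (cases "i = j") auto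
  have mono: "mono s"
    by (rule monoI) (use len in \<open>auto simp: s_def intro!: le\<close>)
  have img: "s ` {..N} = D"
  proof -
    have "s ` {..N} = (\<lambda>k. xs ! k) ` {..<length xs}"
      using len by (intro image_cong) (auto simp: s_def)
    then show ?thesis using set_xs by (auto simp: in_set_conv_nth)
  qed
  have s_step: "s k < s (Suc k)" if "k < N" for k
    using lt[of k "Suc k"] that len by (simp add: s_def)
  have D0: "0 \<in> D" "t \<in> D" by (auto simp: D_def)
  obtain i0 where "i0 \<le> N" "s i0 = 0" using D0(1) img by (metis atMost_iff image_iff)
  moreover have "s 0 \<in> D" using img by auto
  ultimately have s0: "s 0 = 0" using monoD[OF mono, of 0 i0] sub by auto
  obtain i1 where "i1 \<le> N" "s i1 = t" using D0(2) img by (metis atMost_iff image_iff)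
  moreover have "s N \<in> D" using img by auto
  ultimately have sN: "s N = t" using monoD[OF mono, of i1 N] sub by auto
  have gap: "a \<le> s k \<or> s (Suc k) \<le> a" if "a \<in> D" "k < N" for a k
  proof -
    obtain i where i: "a = s i" using \<open>a \<in> D\<close> img by blast
    show ?thesis using monoD[OF mono, of i k] monoD[OF mono, of "Suc k" i] i by (cases "i \<le> k") auto
  qed
  have mesh: "s (Suc k) - s k \<le> t / Suc m" if k: "k < N" for k
  proof -
    have sk: "0 \<le> s k" "s k < t"
      using img sub s_step[OF k] k monoD[OF mono, of "Suc k" N] sN by (auto simp: image_subset_iff)
    \<comment> \<open>\<open>i\<close> numbers the last uniform grid point at or below
      \<open>s k\<close>. The next one, \<open>?a\<close>, lies beyond \<open>s k\<close> and
      belongs to \<open>D\<close>, so by \<open>gap\<close> it cannot lie before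
      \<open>s (Suc k)\<close>.\<close>
    define i where "i = nat \<lfloor>s k * Suc m / t\<rfloor>"
    have i1: "real i \<le> s k * Suc m / t" using sk t by (simp add: i_def)
    have i2: "s k * Suc m / t < real i + 1" using sk t by (simp add: i_def)
    have "s k * Suc m < t * Suc m" using sk by (intro mult_strict_right_mono) auto
    then have "s k * Suc m / t < Suc m" using t by (simp add: divide_less_eq mult.commute)
    then have "real i < real (Suc m)" using i1 by linarith
    then have iM: "Suc i \<le> Suc m" by simp
    let ?a = "t * real (Suc i) / Suc m"
    have "?a \<in> D" unfolding D_def by (intro UnI2 image_eqI[of _ _ "Suc i"]) (use iM in auto)
    moreover have "s k < ?a" using i2 t by (simp add: field_simps)
    ultimately have "s (Suc k) \<le> ?a" using gap[OF _ k] by force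
    also have "?a \<le> s k + t / Suc m"
    proof -
      have "t * real i / Suc m \<le> s k" using i1 t by (simp add: divide_le_eq le_divide_eq mult.commute)
      moreover have "?a = t * real i / Suc m + t / Suc m" by (simp add: add_divide_distrib[symmetric] algebra_simps)
      ultimately show ?thesis by simp
    qed
    finally show ?thesis by simp
  qed
  have "A \<subseteq> s ` {..N}" using img by (auto simp: D_def)
  then show ?thesis using s0 sN mono s_step mesh by blast
qed

lemma partition_strict:
  fixes s :: "nat \<Rightarrow> real"
  assumes "\<forall>k<N. s k < s (Suc k)" "i < j" "j \<le> N"
  shows "s i < s j"
  using assms(2,3)
proof (induction j)
  case (Suc j)
  then have "s j < s (Suc j)" using assms(1) by simp
  then show ?case using Suc by (cases "i = j") auto
qed simp

text \<open>Each interval of the simple integrand, cut off at \<open>t\<close>, is a union of cells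
  of the partition, over which the increments of \<open>\<beta>\<close> telescope. The value on a
  cell is read at its right end because the intervals are open on the left and closed on the
  right.\<close>

lemma simple_integral_refine:
  assumes s: "s N = t" "\<forall>k<N. s k < s (Suc k)"
    and T: "\<And>k. k < n \<Longrightarrow> T k \<le> T (Suc k)"
    and img: "(\<lambda>k. min (T k) t) ` {..n} \<subseteq> s ` {..N}"
  shows "simple_integral n T \<xi> \<beta> t \<omega>
    = (\<Sum>j<N. simple_process n T \<xi> (s (Suc j)) \<omega> * (\<beta> (s (Suc j)) \<omega> - \<beta> (s j) \<omega>))"
proof -
  have lt: "s i < s j \<longleftrightarrow> i < j" if "i \<le> N" "j \<le> N" for i j
    using partition_strict[OF s(2), of i j] partition_strict[OF s(2), of j i] that
    by (metis less_asym less_irrefl nat_neq_iff)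
  have inner: "(\<Sum>j<N. indicator {T k<..T (Suc k)} (s (Suc j)) * (\<beta> (s (Suc j)) \<omega> - \<beta> (s j) \<omega>))
      = \<beta> (min (T (Suc k)) t) \<omega> - \<beta> (min (T k) t) \<omega>" if k: "k < n" for k
  proof -
    have "min (T k) t \<in> s ` {..N}" "min (T (Suc k)) t \<in> s ` {..N}"
      using img k by (auto simp: image_subset_iff)
    then obtain p q where p: "p \<le> N" "min (T k) t = s p" and q: "q \<le> N" "min (T (Suc k)) t = s q" by auto
    have "s p \<le> s q" using T[OF k] p q by (metis min.mono order_refl)
    then have pq: "p \<le> q" using lt[of q p] p q by (meson not_le)
    \<comment> \<open>A cell lies in the \<open>k\<close>-th interval exactly when its index is in
      \<open>{p..<q}\<close>. Cutting \<open>T\<close> off at \<open>t\<close> does not disturb the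
      comparison with \<open>s (Suc j)\<close>, as no cell reaches beyond \<open>t\<close>.\<close>
    have *: "(indicator {T k<..T (Suc k)} (s (Suc j)) :: real) = indicator {p..<q} j" if j: "j < N" for j
    proof -
      have st: "s (Suc j) \<le> t" using lt[of N "Suc j"] j s(1) by (metis Suc_leI not_le order_refl)
      have "T k < s (Suc j) \<longleftrightarrow> s p < s (Suc j)" using p(2) st by (auto simp: min_def split: if_splits)
      also have "\<dots> \<longleftrightarrow> p \<le> j" using lt[of p "Suc j"] p j by auto
      finally have 1: "T k < s (Suc j) \<longleftrightarrow> p \<le> j" .
      have "s (Suc j) \<le> T (Suc k) \<longleftrightarrow> s (Suc j) \<le> s q" using q(2) st by (auto simp: min_def split: if_splits)
      also have "\<dots> \<longleftrightarrow> j < q" using lt[of q "Suc j"] q j by (auto simp: not_less[symmetric])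
      finally show ?thesis using 1 by (auto simp: indicator_def)
    qed
    have "(\<Sum>j<N. indicator {T k<..T (Suc k)} (s (Suc j)) * (\<beta> (s (Suc j)) \<omega> - \<beta> (s j) \<omega>))
        = (\<Sum>j<N. indicator {p..<q} j * (\<beta> (s (Suc j)) \<omega> - \<beta> (s j) \<omega>))"
      using * by (intro sum.cong) auto
    also have "\<dots> = (\<Sum>j\<in>{p..<q}. \<beta> (s (Suc j)) \<omega> - \<beta> (s j) \<omega>)"
      using q(1) by (intro sum.mono_neutral_cong_right) (auto simp: indicator_def)
    also have "\<dots> = \<beta> (s q) \<omega> - \<beta> (s p) \<omega>"
      using sum_Suc_diff'[OF pq, of "\<lambda>j. \<beta> (s j) \<omega>"] by simp
    finally show ?thesis using p q by simp
  qed
  have "(\<Sum>j<N. simple_process n T \<xi> (s (Suc j)) \<omega> * (\<beta> (s (Suc j)) \<omega> - \<beta> (s j) \<omega>))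
     = (\<Sum>k<n. \<xi> k \<omega> * (\<Sum>j<N. indicator {T k<..T (Suc k)} (s (Suc j)) * (\<beta> (s (Suc j)) \<omega> - \<beta> (s j) \<omega>)))"
    unfolding simple_process_def sum_distrib_left sum_distrib_right
    by (subst sum.swap) (simp add: mult.assoc)
  also have "\<dots> = simple_integral n T \<xi> \<beta> t \<omega>"
    unfolding simple_integral_def using inner by (intro sum.cong) auto
  finally show ?thesis by simp
qed

text \<open>No jump time falls strictly inside a cell. The second claim serves adaptedness: an
  interval that has begun before the right end of a cell has begun by its left end.\<close>

lemma simple_process_const:
  assumes s: "s N = t" "\<forall>k<N. s k < s (Suc k)"
    and img: "(\<lambda>k. min (T k) t) ` {..n} \<subseteq> s ` {..N}"
    and j: "j < N" and r: "s j < r" "r \<le> s (Suc j)"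
  shows "simple_process n T \<xi> r \<omega> = simple_process n T \<xi> (s (Suc j)) \<omega>"
    and "k \<le> n \<Longrightarrow> T k < s (Suc j) \<Longrightarrow> T k \<le> s j"
proof -
  have st: "s i \<le> t" if "i \<le> N" for i
    using partition_strict[OF s(2), of i N] that s(1) by (cases "i = N") auto
  have gap: "T k \<le> s j \<or> s (Suc j) \<le> T k" if k: "k \<le> n" for k
  proof -
    have "min (T k) t \<in> s ` {..N}" using img k by auto
    then obtain p where p: "p \<le> N" "min (T k) t = s p" by auto
    consider "p \<le> j" | "Suc j \<le> p" by linarith
    then show ?thesis
    proof cases
      case 1
      then have "s p \<le> s j" using partition_strict[OF s(2), of p j] j by (cases "p = j") auto
      moreover have "s j < t" using st[of "Suc j"] s(2) j by (metis Suc_leI less_le_trans)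
      ultimately show ?thesis using p by (auto simp: min_def split: if_splits)
    next
      case 2
      then have "s (Suc j) \<le> s p" using partition_strict[OF s(2), of "Suc j" p] p by (cases "p = Suc j") auto
      then show ?thesis using p by (auto simp: min_def split: if_splits)
    qed
  qed
  show "k \<le> n \<Longrightarrow> T k < s (Suc j) \<Longrightarrow> T k \<le> s j" using gap[of k] by linarith
  have "(indicator {T k<..T (Suc k)} r :: real) = indicator {T k<..T (Suc k)} (s (Suc j))" if "k < n" for k
    using gap[of k] gap[of "Suc k"] that r by (auto simp: indicator_def)
  then show "simple_process n T \<xi> r \<omega> = simple_process n T \<xi> (s (Suc j)) \<omega>"
    unfolding simple_process_def by (intro sum.cong) auto
qed

text \<open>On a cell [a,b] the term h(a)(\<beta>(b) - \<beta>(a)) differs from the increment of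
  \<Phi> by minus the integral of h'(r)(\<beta>(b) - \<beta>(r)) over [a,b]. This is at most B
  \<epsilon> (b - a), and the increments of \<Phi> telescope. Differentiation falls on
  \<open>h\<close>, so continuity of \<open>\<beta>\<close> is enough.\<close>

lemma Riemann_Stieltjes_error:
  fixes h h' \<beta> :: "real \<Rightarrow> real"
  assumes s: "s 0 = 0" "s N = t" "mono s"
    and h: "\<And>r. r \<in> {0..t} \<Longrightarrow> (h has_vector_derivative h' r) (at r within {0..t})"
    and h': "continuous_on {0..t} h'" and \<beta>: "continuous_on {0..t} \<beta>"
    and B: "\<And>r. r \<in> {0..t} \<Longrightarrow> \<bar>h' r\<bar> \<le> B"
    and \<epsilon>: "\<And>k r. k < N \<Longrightarrow> r \<in> {s k..s (Suc k)} \<Longrightarrow> \<bar>\<beta> (s (Suc k)) - \<beta> r\<bar> \<le> \<epsilon>"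
  shows "\<bar>(\<Sum>k<N. h (s k) * (\<beta> (s (Suc k)) - \<beta> (s k)))
    - (h t * \<beta> t - h 0 * \<beta> 0 - integral {0..t} (\<lambda>r. h' r * \<beta> r))\<bar> \<le> B * \<epsilon> * t"
proof -
  define \<Phi> where "\<Phi> r = h r * \<beta> r - integral {0..r} (\<lambda>r. h' r * \<beta> r)" for r
  have s_in: "s k \<in> {0..t}" if "k \<le> N" for k
    using monoD[OF s(3), of 0 k] monoD[OF s(3), of k N] s that by auto
  have step: "\<bar>h (s k) * (\<beta> (s (Suc k)) - \<beta> (s k)) - (\<Phi> (s (Suc k)) - \<Phi> (s k))\<bar> \<le> B * \<epsilon> * (s (Suc k) - s k)"
    if k: "k < N" for k
  proof -
    let ?a = "s k" and ?b = "s (Suc k)"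
    have ab: "?a \<le> ?b" using monoD[OF s(3), of k "Suc k"] by simp
    have a0: "0 \<le> ?a" and bt: "?b \<le> t" using s_in[of k] s_in[of "Suc k"] k by auto
    have sub: "{?a..?b} \<subseteq> {0..t}" using a0 bt by auto
    have ch: "continuous_on {?a..?b} (\<lambda>r. h' r * \<beta> r)"
      using continuous_on_subset[OF h' sub] continuous_on_subset[OF \<beta> sub] by (intro continuous_intros)
    have ch0: "continuous_on {0..?b} (\<lambda>r. h' r * \<beta> r)"
      using continuous_on_subset[OF h', of "{0..?b}"] continuous_on_subset[OF \<beta>, of "{0..?b}"] bt by (intro continuous_intros) auto
    have FTC: "(h' has_integral (h ?b - h ?a)) {?a..?b}"
      by (rule fundamental_theorem_of_calculus[OF ab])
        (use h sub has_vector_derivative_within_subset in blast)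
    have "((\<lambda>r. h' r * \<beta> ?b) has_integral (h ?b - h ?a) * \<beta> ?b) {?a..?b}"
      by (rule has_integral_mult_left[OF FTC])
    moreover have "((\<lambda>r. h' r * \<beta> r) has_integral integral {?a..?b} (\<lambda>r. h' r * \<beta> r)) {?a..?b}"
      by (rule integrable_integral[OF integrable_continuous_real[OF ch]])
    ultimately have D: "((\<lambda>r. h' r * \<beta> ?b - h' r * \<beta> r) has_integral
        ((h ?b - h ?a) * \<beta> ?b - integral {?a..?b} (\<lambda>r. h' r * \<beta> r))) {?a..?b}"
      by (rule has_integral_diff)
    have B0: "0 \<le> B" using B[of ?a] sub ab by force
    have \<epsilon>0: "0 \<le> \<epsilon>" using \<epsilon>[OF k, of ?b] ab by auto
    have "norm ((h ?b - h ?a) * \<beta> ?b - integral {?a..?b} (\<lambda>r. h' r * \<beta> r)) \<le> B * \<epsilon> * Henstock_Kurzweil_Integration.content (cbox ?a ?b)"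
    proof (rule has_integral_bound)
      show "((\<lambda>r. h' r * \<beta> ?b - h' r * \<beta> r) has_integral
        ((h ?b - h ?a) * \<beta> ?b - integral {?a..?b} (\<lambda>r. h' r * \<beta> r))) (cbox ?a ?b)" using D by simp
      show "0 \<le> B * \<epsilon>" using B0 \<epsilon>0 by simp
      fix r assume r: "r \<in> cbox ?a ?b"
      have "norm (h' r * \<beta> ?b - h' r * \<beta> r) = \<bar>h' r\<bar> * \<bar>\<beta> ?b - \<beta> r\<bar>"
        by (simp add: right_diff_distrib[symmetric] abs_mult)
      also have "\<dots> \<le> B * \<epsilon>" by (rule mult_mono) (use r sub B[of r] \<epsilon>[OF k, of r] B0 in auto)
      finally show "norm (h' r * \<beta> ?b - h' r * \<beta> r) \<le> B * \<epsilon>" .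
    qed
    moreover have "integral {0..?a} (\<lambda>r. h' r * \<beta> r) + integral {?a..?b} (\<lambda>r. h' r * \<beta> r) = integral {0..?b} (\<lambda>r. h' r * \<beta> r)"
      by (rule Henstock_Kurzweil_Integration.integral_combine[OF a0 ab integrable_continuous_real[OF ch0]])
    ultimately show ?thesis using ab by (simp add: \<Phi>_def algebra_simps abs_le_iff)
  qed
  have "(\<Sum>k<N. h (s k) * (\<beta> (s (Suc k)) - \<beta> (s k))) - (\<Phi> t - \<Phi> 0)
     = (\<Sum>k<N. h (s k) * (\<beta> (s (Suc k)) - \<beta> (s k)) - (\<Phi> (s (Suc k)) - \<Phi> (s k)))"
    using sum_lessThan_telescope[of "\<lambda>k. \<Phi> (s k)" N] s by (simp add: sum_subtractf)
  also have "\<bar>\<dots>\<bar> \<le> (\<Sum>k<N. B * \<epsilon> * (s (Suc k) - s k))"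
    by (rule order_trans[OF sum_abs sum_mono]) (use step in auto)
  also have "\<dots> = B * \<epsilon> * t"
    using sum_lessThan_telescope[of s N] s by (simp add: sum_distrib_left[symmetric])
  finally show ?thesis by (simp add: \<Phi>_def algebra_simps)
qed

text \<open>On a cell \<open>g\<close> equals \<open>z k\<close> and \<open>h\<close> stays within
  \<open>\<delta>\<close> of its left value, so (z - h(s k))^2 \<le> 2 (g - h)^2 + 2 \<delta>^2
  there. Integrating over the disjoint cells gives the claim, which is stated in
  \<open>ennreal\<close> because the integral on the right may be infinite.\<close>

lemma step_square_error:
  fixes g h :: "real \<Rightarrow> real"
  assumes s: "s 0 = 0" "s N = t" "mono s"
    and g: "\<And>k r. k < N \<Longrightarrow> s k < r \<Longrightarrow> r \<le> s (Suc k) \<Longrightarrow> g r = z k"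
    and h: "continuous_on {0..t} h" and gm: "g \<in> borel_measurable borel"
    and \<delta>: "\<And>k r. k < N \<Longrightarrow> r \<in> {s k..s (Suc k)} \<Longrightarrow> \<bar>h r - h (s k)\<bar> \<le> \<delta>" "\<delta> \<ge> 0"
  shows "ennreal (\<Sum>k<N. (z k - h (s k))\<^sup>2 * (s (Suc k) - s k))
    \<le> 2 * (\<integral>\<^sup>+r\<in>{0..t}. ennreal ((g r - h r)\<^sup>2) \<partial>lborel) + ennreal (2 * \<delta>\<^sup>2 * t)"
proof -
  define \<phi> where "\<phi> r = ennreal ((g r - h r)\<^sup>2) * indicator {0..t} r" for r
  \<comment> \<open>\<open>h\<close> is controlled on \<open>{0..t}\<close> only, so measurability
    is obtained for its product with the indicator; inside \<open>\<phi>\<close> this product can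
    replace \<open>h\<close>.\<close>
  have [measurable]: "(\<lambda>r. indicator {0..t} r * h r) \<in> borel_measurable borel"
    using borel_measurable_continuous_on_indicator[OF _ h] by simp
  note [measurable] = gm
  have "\<phi> = (\<lambda>r. ennreal ((g r - indicator {0..t} r * h r)\<^sup>2) * indicator {0..t} r)"
    by (auto simp: \<phi>_def indicator_def)
  then have [measurable]: "\<phi> \<in> borel_measurable borel" by simp
  have ss: "s k \<le> s (Suc k)" for k using monoD[OF s(3), of k "Suc k"] by simp
  have s_in: "s k \<in> {0..t}" if "k \<le> N" for k
    using monoD[OF s(3), of 0 k] monoD[OF s(3), of k N] s that by auto
  have one: "ennreal ((z k - h (s k))\<^sup>2 * (s (Suc k) - s k))
      \<le> 2 * (\<integral>\<^sup>+r. \<phi> r * indicator {s k<..s (Suc k)} r \<partial>lborel) + ennreal (2 * \<delta>\<^sup>2 * (s (Suc k) - s k))"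
    if k: "k < N" for k
  proof -
    let ?I = "{s k<..s (Suc k)}"
    have "ennreal ((z k - h (s k))\<^sup>2 * (s (Suc k) - s k)) = (\<integral>\<^sup>+r. ennreal ((z k - h (s k))\<^sup>2) * indicator ?I r \<partial>lborel)"
      using ss[of k] by (simp add: nn_integral_cmult_indicator ennreal_mult)
    also have "\<dots> \<le> (\<integral>\<^sup>+r. 2 * (\<phi> r * indicator ?I r) + ennreal (2 * \<delta>\<^sup>2) * indicator ?I r \<partial>lborel)"
    proof (rule nn_integral_mono)
      fix r
      show "ennreal ((z k - h (s k))\<^sup>2) * indicator ?I r \<le> 2 * (\<phi> r * indicator ?I r) + ennreal (2 * \<delta>\<^sup>2) * indicator ?I r"
      proof (cases "r \<in> ?I")
        case True
        then have rt: "r \<in> {0..t}" using s_in[of k] s_in[of "Suc k"] k by auto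
        have "\<bar>h r - h (s k)\<bar> \<le> \<delta>" using \<delta>(1)[OF k, of r] True by auto
        then have d2: "(h r - h (s k))\<^sup>2 \<le> \<delta>\<^sup>2" using abs_le_square_iff[of "h r - h (s k)" \<delta>] \<delta>(2) by simp
        have sq: "(a + c)\<^sup>2 \<le> 2 * a\<^sup>2 + 2 * c\<^sup>2" for a c :: real
          using sum_squares_bound[of a c] by (simp add: power2_sum)
        have "(z k - h (s k))\<^sup>2 = ((z k - h r) + (h r - h (s k)))\<^sup>2" by simp
        also have "\<dots> \<le> 2 * (z k - h r)\<^sup>2 + 2 * (h r - h (s k))\<^sup>2" by (rule sq)
        finally have "(z k - h (s k))\<^sup>2 \<le> 2 * (g r - h r)\<^sup>2 + 2 * \<delta>\<^sup>2"
          using d2 g[OF k, of r] True by simp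
        then have "ennreal ((z k - h (s k))\<^sup>2) \<le> ennreal (2 * (g r - h r)\<^sup>2 + 2 * \<delta>\<^sup>2)" by (rule ennreal_leI)
        also have "\<dots> = 2 * \<phi> r + ennreal (2 * \<delta>\<^sup>2)"
          using rt by (simp add: \<phi>_def ennreal_plus ennreal_mult)
        finally show ?thesis using True by simp
      qed simp
    qed
    also have "\<dots> = 2 * (\<integral>\<^sup>+r. \<phi> r * indicator ?I r \<partial>lborel) + ennreal (2 * \<delta>\<^sup>2 * (s (Suc k) - s k))"
      using ss[of k] by (simp add: nn_integral_add nn_integral_cmult nn_integral_cmult_indicator ennreal_mult)
    finally show ?thesis .
  qed
  have "ennreal (\<Sum>k<N. (z k - h (s k))\<^sup>2 * (s (Suc k) - s k))
      = (\<Sum>k<N. ennreal ((z k - h (s k))\<^sup>2 * (s (Suc k) - s k)))"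
    using ss by (intro sum_ennreal[symmetric]) simp
  also have "\<dots> \<le> (\<Sum>k<N. 2 * (\<integral>\<^sup>+r. \<phi> r * indicator {s k<..s (Suc k)} r \<partial>lborel) + ennreal (2 * \<delta>\<^sup>2 * (s (Suc k) - s k)))"
    by (rule sum_mono) (use one in auto)
  also have "\<dots> = 2 * (\<integral>\<^sup>+r. (\<Sum>k<N. \<phi> r * indicator {s k<..s (Suc k)} r) \<partial>lborel) + ennreal (\<Sum>k<N. 2 * \<delta>\<^sup>2 * (s (Suc k) - s k))"
  proof -
    have "(\<integral>\<^sup>+r. (\<Sum>k<N. \<phi> r * indicator {s k<..s (Suc k)} r) \<partial>lborel) = (\<Sum>k<N. \<integral>\<^sup>+r. \<phi> r * indicator {s k<..s (Suc k)} r \<partial>lborel)"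
      by (rule nn_integral_sum) simp
    moreover have "(\<Sum>k<N. ennreal (2 * \<delta>\<^sup>2 * (s (Suc k) - s k))) = ennreal (\<Sum>k<N. 2 * \<delta>\<^sup>2 * (s (Suc k) - s k))"
      using ss by (intro sum_ennreal) simp
    ultimately show ?thesis by (simp only: sum.distrib sum_distrib_left)
  qed
  also have "(\<Sum>k<N. 2 * \<delta>\<^sup>2 * (s (Suc k) - s k)) = 2 * \<delta>\<^sup>2 * t"
    using sum_lessThan_telescope[of s N] s by (simp add: sum_distrib_left[symmetric])
  also have "(\<integral>\<^sup>+r. (\<Sum>k<N. \<phi> r * indicator {s k<..s (Suc k)} r) \<partial>lborel) \<le> (\<integral>\<^sup>+r. \<phi> r \<partial>lborel)"
  proof (rule nn_integral_mono)
    fix r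
    have "(\<Sum>k<N. indicator {s k<..s (Suc k)} r :: ennreal) = indicator (\<Union>k<N. {s k<..s (Suc k)}) r"
    proof (rule indicator_UN_disjoint[symmetric])
      show "disjoint_family_on (\<lambda>k. {s k<..s (Suc k)}) {..<N}"
      proof (unfold disjoint_family_on_def, intro ballI impI)
        fix i j :: nat assume "i \<noteq> j"
        then consider "Suc i \<le> j" | "Suc j \<le> i" by linarith
        then show "{s i<..s (Suc i)} \<inter> {s j<..s (Suc j)} = {}"
          by cases (use monoD[OF s(3), of "Suc i" j] monoD[OF s(3), of "Suc j" i] in auto)
      qed
    qed simp
    then have "(\<Sum>k<N. \<phi> r * indicator {s k<..s (Suc k)} r) = \<phi> r * indicator (\<Union>k<N. {s k<..s (Suc k)}) r"
      by (simp add: sum_distrib_left[symmetric])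
    also have "\<dots> \<le> \<phi> r" by (auto simp: indicator_def)
    finally show "(\<Sum>k<N. \<phi> r * indicator {s k<..s (Suc k)} r) \<le> \<phi> r" .
  qed
  finally show ?thesis by (simp add: \<phi>_def mult_left_mono add_right_mono)
qed

section \<open>The Ito integral of an integrand with continuously differentiable paths\<close>

locale scalar_brownian_motion =
  fixes P :: "'w measure" and F :: "real \<Rightarrow> 'w measure" and \<beta> :: "real \<Rightarrow> 'w \<Rightarrow> real"
  assumes filtered: "filtered_prob_space P F"
    and adapted: "\<And>t. t \<ge> 0 \<Longrightarrow> \<beta> t \<in> borel_measurable (F t)"
    and cont: "AE \<omega> in P. continuous_on {0..} (\<lambda>t. \<beta> t \<omega>)"
    and indep: "\<And>s t. 0 \<le> s \<Longrightarrow> s < t \<Longrightarrow> prob_space.indep_set P (sets (F s))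
           {(\<lambda>\<omega>. \<beta> t \<omega> - \<beta> s \<omega>) -` S \<inter> space P | S. S \<in> sets borel}"
    and normal: "\<And>s t. 0 \<le> s \<Longrightarrow> s < t \<Longrightarrow>
       distributed P lborel (\<lambda>\<omega>. \<beta> t \<omega> - \<beta> s \<omega>) (normal_density 0 (sqrt (t - s)))"

sublocale scalar_brownian_motion \<subseteq> prob_space P
  using filtered by (simp add: filtered_prob_space_def)

context scalar_brownian_motion
begin

lemma F_props: "space (F t) = space P" "sets (F t) \<subseteq> sets P" "s \<le> t \<Longrightarrow> sets (F s) \<subseteq> sets (F t)"
  using filtered by (auto simp: filtered_prob_space_def filtration_def)

lemma measurable_F_P: "g \<in> borel_measurable (F t) \<Longrightarrow> g \<in> borel_measurable P"
  using F_props(2)[of t] F_props(1)[of t] unfolding measurable_def by auto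

lemma measurable_F_mono: "s \<le> t \<Longrightarrow> g \<in> borel_measurable (F s) \<Longrightarrow> g \<in> borel_measurable (F t)"
  using F_props(3)[of s t] F_props(1)[of t] F_props(1)[of s] unfolding measurable_def by auto

lemma increment_moments:
  assumes "0 \<le> s" "s < t"
  shows "integrable P (\<lambda>\<omega>. \<beta> t \<omega> - \<beta> s \<omega>)" "expectation (\<lambda>\<omega>. \<beta> t \<omega> - \<beta> s \<omega>) = 0"
    and "integrable P (\<lambda>\<omega>. (\<beta> t \<omega> - \<beta> s \<omega>)\<^sup>2)" "expectation (\<lambda>\<omega>. (\<beta> t \<omega> - \<beta> s \<omega>)\<^sup>2) = t - s"
proof -
  note D = normal[OF assms]
  have \<sigma>: "0 < sqrt (t - s)" using assms by simp
  show E: "expectation (\<lambda>\<omega>. \<beta> t \<omega> - \<beta> s \<omega>) = 0"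
    by (rule normal_distributed_expectation[OF \<sigma> D])
  have "variance (\<lambda>\<omega>. \<beta> t \<omega> - \<beta> s \<omega>) = (sqrt (t - s))\<^sup>2"
    by (rule normal_distributed_variance[OF \<sigma> D])
  then show "expectation (\<lambda>\<omega>. (\<beta> t \<omega> - \<beta> s \<omega>)\<^sup>2) = t - s"
    using assms E by simp
  have "integrable lborel (\<lambda>x. normal_density 0 (sqrt (t - s)) x * x)"
    using integrable_normal_moment[OF \<sigma>, of 0 1] by simp
  then show "integrable P (\<lambda>\<omega>. \<beta> t \<omega> - \<beta> s \<omega>)"
    using distributed_integrable[OF D, of "\<lambda>x. x"] by simp
  have "integrable lborel (\<lambda>x. normal_density 0 (sqrt (t - s)) x * x\<^sup>2)"
    using integrable_normal_moment[OF \<sigma>, of 0 2] by simp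
  then show "integrable P (\<lambda>\<omega>. (\<beta> t \<omega> - \<beta> s \<omega>)\<^sup>2)"
    using distributed_integrable[OF D, of "\<lambda>x. x\<^sup>2"] by simp
qed

lemma independent_increments_partition:
  assumes s: "s 0 = 0" "mono s" "\<And>k. k < N \<Longrightarrow> s k < s (Suc k)"
  shows "independent_increments P (\<lambda>k. F (s k)) (\<lambda>k \<omega>. \<beta> (s (Suc k)) \<omega> - \<beta> (s k) \<omega>) (\<lambda>k. s (Suc k) - s k) N"
proof -
  have s0: "0 \<le> s k" for k using monoD[OF s(2), of 0 k] s(1) by simp
  show ?thesis
  proof
    fix j k :: nat assume "j \<le> k"
    then show "sets (F (s j)) \<subseteq> sets (F (s k))" by (intro F_props(3) monoD[OF s(2)])
  next
    fix k assume k: "k < N"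
    show "(\<lambda>\<omega>. \<beta> (s (Suc k)) \<omega> - \<beta> (s k) \<omega>) \<in> borel_measurable (F (s (Suc k)))"
      using adapted[OF s0[of "Suc k"]] measurable_F_mono[OF _ adapted[OF s0[of k]], of "s (Suc k)"] monoD[OF s(2), of k "Suc k"]
      by simp
    show "indep_set (sets (F (s k))) {(\<lambda>\<omega>. \<beta> (s (Suc k)) \<omega> - \<beta> (s k) \<omega>) -` S \<inter> space P |S. S \<in> sets borel}"
      by (rule indep[OF s0 s(3)[OF k]])
  qed (use F_props increment_moments[OF s0 s(3)] s(3) in auto)
qed

text \<open>Progressive measurability is joint measurability on [0,t] times \<open>F t\<close>.
  After swapping the factors and enlarging \<open>F t\<close> to \<open>P\<close>, the inner
  integral of a jointly measurable function against a sigma-finite measure is measurable in the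
  parameter.\<close>

lemma simple_error_measurable:
  assumes H: "progressively_measurable F H" and S: "simple_integrand P F n T \<xi>" and t: "t \<ge> 0"
  shows "(\<lambda>\<omega>. \<integral>\<^sup>+s\<in>{0..t}. ennreal ((simple_process n T \<xi> s \<omega> - H s \<omega>)\<^sup>2) \<partial>lborel) \<in> borel_measurable P"
proof -
  let ?L = "restrict_space lborel {0..t}"
  interpret L: sigma_finite_measure ?L
    by (rule sigma_finite_measure_restrict_space[OF lborel.sigma_finite_measure_axioms]) simp
  have [measurable]: "\<xi> k \<in> borel_measurable P" if "k < n" for k
    using S that measurable_F_P by (auto simp: simple_integrand_def)
  have *: "(\<lambda>z. H (fst z) (snd z)) \<in> borel_measurable (restrict_space borel {0..t} \<Otimes>\<^sub>M F t)"
    using H t by (simp add: progressively_measurable_def case_prod_beta')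
  have swap: "(\<lambda>z. (snd z, fst z)) \<in> measurable (P \<Otimes>\<^sub>M ?L) (restrict_space borel {0..t} \<Otimes>\<^sub>M F t)"
  proof (rule measurable_Pair)
    have "(\<lambda>x. x) \<in> measurable ?L (restrict_space borel {0..t})"
      by (rule measurable_ident_sets) (simp add: sets_restrict_space)
    then show "snd \<in> measurable (P \<Otimes>\<^sub>M ?L) (restrict_space borel {0..t})"
      using measurable_compose[OF measurable_snd, of "\<lambda>x. x" ?L] by simp
    have "(\<lambda>x. x) \<in> measurable P (F t)"
      using F_props(1,2)[of t] by (auto simp: measurable_def)
    then show "fst \<in> measurable (P \<Otimes>\<^sub>M ?L) (F t)"
      using measurable_compose[OF measurable_fst, of "\<lambda>x. x" P] by simp
  qed
  have [measurable]: "(\<lambda>z. H (snd z) (fst z)) \<in> borel_measurable (P \<Otimes>\<^sub>M ?L)"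
    using measurable_compose[OF swap *] by simp
  have sndm[measurable]: "snd \<in> borel_measurable (P \<Otimes>\<^sub>M ?L)"
  proof -
    have "(\<lambda>x. x) \<in> borel_measurable ?L" by (rule measurable_restrict_space1) simp
    then show ?thesis using measurable_compose[OF measurable_snd, of "\<lambda>x. x" ?L] by simp
  qed
  have [measurable]: "(\<lambda>z. simple_process n T \<xi> (snd z) (fst z)) \<in> borel_measurable (P \<Otimes>\<^sub>M ?L)"
    unfolding simple_process_def
    by measurable
  have "(\<lambda>\<omega>. \<integral>\<^sup>+s. ennreal ((simple_process n T \<xi> s \<omega> - H s \<omega>)\<^sup>2) \<partial>?L) \<in> borel_measurable P"
    by (rule L.borel_measurable_nn_integral) (simp add: case_prod_beta')
  moreover have "(\<integral>\<^sup>+s. g s \<partial>?L) = (\<integral>\<^sup>+s\<in>{0..t}. g s \<partial>lborel)" for g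
    by (rule nn_integral_restrict_space) simp
  ultimately show ?thesis by simp
qed

lemma simple_integral_measurable:
  assumes S: "simple_integrand P F n T \<xi>" and t: "t \<ge> 0"
  shows "simple_integral n T \<xi> \<beta> t \<in> borel_measurable P"
proof -
  have T0: "0 \<le> T k" if "k \<le> n" for k
    using that
  proof (induction k)
    case (Suc k)
    have "T k \<le> T (Suc k)" using S Suc.prems by (simp add: simple_integrand_def)
    then show ?case using Suc by simp
  qed (use S in \<open>simp add: simple_integrand_def\<close>)
  have [measurable]: "\<beta> r \<in> borel_measurable P" if "r \<ge> 0" for r
    using measurable_F_P[OF adapted[OF that]] .
  have [measurable]: "\<xi> k \<in> borel_measurable P" if "k < n" for k
    using S that measurable_F_P by (auto simp: simple_integrand_def)
  show ?thesis
    unfolding simple_integral_def[abs_def]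
    by (intro borel_measurable_sum borel_measurable_times borel_measurable_diff)
      (use T0 t in auto)
qed

end

section \<open>Limits along partitions of vanishing mesh\<close>

locale partition_sequence =
  fixes t :: real and N :: "nat \<Rightarrow> nat" and s :: "nat \<Rightarrow> nat \<Rightarrow> real" and \<mu> :: "nat \<Rightarrow> real"
  assumes start: "\<And>m. s m 0 = 0" and finish: "\<And>m. s m (N m) = t" and mono: "\<And>m. mono (s m)"
    and mesh: "\<And>m k. k < N m \<Longrightarrow> s m (Suc k) - s m k \<le> \<mu> m" and mesh_lim: "\<mu> \<longlonglongrightarrow> 0"
    and t_pos: "t > 0"
begin

lemma in_range:
  assumes "k \<le> N m" shows "s m k \<in> {0..t}"
proof -
  have "s m 0 \<le> s m k" by (rule monoD[OF mono]) simp
  moreover have "s m k \<le> s m (N m)" by (rule monoD[OF mono assms])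
  ultimately show ?thesis unfolding start finish by simp
qed

lemma oscillation:
  fixes h :: "real \<Rightarrow> real"
  assumes h: "continuous_on {0..t} h" and e: "e > 0"
  shows "eventually (\<lambda>m. \<forall>k<N m. \<forall>r\<in>{s m k..s m (Suc k)}. \<forall>r'\<in>{s m k..s m (Suc k)}. \<bar>h r - h r'\<bar> \<le> e) sequentially"
proof -
  have "uniformly_continuous_on {0..t} h"
    by (rule compact_uniformly_continuous[OF h]) simp
  then obtain d where d: "d > 0" "\<And>r r'. r \<in> {0..t} \<Longrightarrow> r' \<in> {0..t} \<Longrightarrow> dist r' r < d \<Longrightarrow> dist (h r') (h r) < e"
    using e unfolding uniformly_continuous_on_def by metis
  have "eventually (\<lambda>m. \<mu> m < d) sequentially" by (rule order_tendstoD(2)[OF mesh_lim d(1)])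
  then show ?thesis
  proof eventually_elim
    case (elim m)
    show ?case
    proof (intro allI impI ballI)
      fix k r r' assume k: "k < N m" and r: "r \<in> {s m k..s m (Suc k)}" "r' \<in> {s m k..s m (Suc k)}"
      have "r \<in> {0..t}" "r' \<in> {0..t}" using r in_range[of k m] in_range[of "Suc k" m] k by auto
      moreover have "dist r r' < d" using r mesh[OF k] elim by (auto simp: dist_real_def)
      ultimately show "\<bar>h r - h r'\<bar> \<le> e" using d(2)[of r' r] by (simp add: dist_real_def)
    qed
  qed
qed

lemma Riemann_Stieltjes_convergence:
  fixes h h' \<beta> :: "real \<Rightarrow> real"
  assumes h: "\<And>r. r \<in> {0..t} \<Longrightarrow> (h has_vector_derivative h' r) (at r within {0..t})"
    and h': "continuous_on {0..t} h'" and \<beta>: "continuous_on {0..t} \<beta>"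
  shows "(\<lambda>m. \<Sum>k<N m. h (s m k) * (\<beta> (s m (Suc k)) - \<beta> (s m k)))
    \<longlonglongrightarrow> h t * \<beta> t - h 0 * \<beta> 0 - integral {0..t} (\<lambda>r. h' r * \<beta> r)"
proof (rule LIMSEQ_I)
  fix e :: real assume e: "e > 0"
  have "bounded (h' ` {0..t})" by (rule compact_imp_bounded[OF compact_continuous_image[OF h']]) simp
  then obtain B0 where B0: "\<And>r. r \<in> {0..t} \<Longrightarrow> \<bar>h' r\<bar> \<le> B0" unfolding bounded_iff by fastforce
  define B where "B = max B0 1"
  have B: "\<And>r. r \<in> {0..t} \<Longrightarrow> \<bar>h' r\<bar> \<le> B" "B > 0" using B0 by (auto simp: B_def le_max_iff_disj)
  define \<epsilon> where "\<epsilon> = e / (2 * B * t)"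
  have \<epsilon>: "\<epsilon> > 0" using e B t_pos by (simp add: \<epsilon>_def)
  have "eventually (\<lambda>m. norm ((\<Sum>k<N m. h (s m k) * (\<beta> (s m (Suc k)) - \<beta> (s m k)))
      - (h t * \<beta> t - h 0 * \<beta> 0 - integral {0..t} (\<lambda>r. h' r * \<beta> r))) < e) sequentially"
    using oscillation[OF \<beta> \<epsilon>]
  proof eventually_elim
    case (elim m)
    have "\<bar>(\<Sum>k<N m. h (s m k) * (\<beta> (s m (Suc k)) - \<beta> (s m k)))
      - (h t * \<beta> t - h 0 * \<beta> 0 - integral {0..t} (\<lambda>r. h' r * \<beta> r))\<bar> \<le> B * \<epsilon> * t"
      by (rule Riemann_Stieltjes_error[OF start finish mono h h' \<beta> B(1)]) (use elim in auto)
    also have "\<dots> = e / 2" using B t_pos by (simp add: \<epsilon>_def)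
    finally show ?case using e by simp
  qed
  then show "\<exists>no. \<forall>m\<ge>no. norm ((\<Sum>k<N m. h (s m k) * (\<beta> (s m (Suc k)) - \<beta> (s m k)))
      - (h t * \<beta> t - h 0 * \<beta> 0 - integral {0..t} (\<lambda>r. h' r * \<beta> r))) < e"
    by (simp add: eventually_sequentially)
qed

lemma step_square_convergence:
  fixes g :: "nat \<Rightarrow> real \<Rightarrow> real" and h :: "real \<Rightarrow> real"
  assumes g: "\<And>m k r. k < N m \<Longrightarrow> s m k < r \<Longrightarrow> r \<le> s m (Suc k) \<Longrightarrow> g m r = z m k"
    and h: "continuous_on {0..t} h" and gm: "\<And>m. g m \<in> borel_measurable borel"
    and lim: "(\<lambda>m. \<integral>\<^sup>+r\<in>{0..t}. ennreal ((g m r - h r)\<^sup>2) \<partial>lborel) \<longlonglongrightarrow> 0"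
  shows "(\<lambda>m. \<Sum>k<N m. (z m k - h (s m k))\<^sup>2 * (s m (Suc k) - s m k)) \<longlonglongrightarrow> 0"
proof (rule LIMSEQ_I)
  fix e :: real assume e: "e > 0"
  define \<delta> where "\<delta> = sqrt (e / (4 * t))"
  have \<delta>: "\<delta> > 0" "2 * \<delta>\<^sup>2 * t = e / 2" using e t_pos by (auto simp: \<delta>_def)
  have "eventually (\<lambda>m. (\<integral>\<^sup>+r\<in>{0..t}. ennreal ((g m r - h r)\<^sup>2) \<partial>lborel) < ennreal (e / 4)) sequentially"
    by (rule order_tendstoD(2)[OF lim]) (use e in simp)
  with oscillation[OF h \<delta>(1)]
  have "eventually (\<lambda>m. norm ((\<Sum>k<N m. (z m k - h (s m k))\<^sup>2 * (s m (Suc k) - s m k)) - 0) < e) sequentially"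
  proof eventually_elim
    case (elim m)
    let ?Q = "\<Sum>k<N m. (z m k - h (s m k))\<^sup>2 * (s m (Suc k) - s m k)"
    let ?Z = "\<integral>\<^sup>+r\<in>{0..t}. ennreal ((g m r - h r)\<^sup>2) \<partial>lborel"
    have ss: "s m k \<le> s m (Suc k)" for k using monoD[OF mono, of k "Suc k" m] by simp
    have Q0: "?Q \<ge> 0" using ss by (intro sum_nonneg) simp
    obtain x where x: "x \<ge> 0" "?Z = ennreal x" "x < e / 4"
      using elim(2) e by (cases ?Z) (auto simp: ennreal_less_iff)
    have "ennreal ?Q \<le> 2 * ?Z + ennreal (2 * \<delta>\<^sup>2 * t)"
    proof (rule step_square_error[where g = "g m" and z = "z m" and h = h, OF start finish mono g h gm])
      show "\<bar>h r - h (s m k)\<bar> \<le> \<delta>" if "k < N m" "r \<in> {s m k..s m (Suc k)}" for k r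
        using elim(1) that ss[of k] by auto
    qed (use \<delta> in auto)
    also have "\<dots> = ennreal (2 * x + e / 2)"
      using x e by (simp add: \<delta>(2) ennreal_plus ennreal_mult)
    finally have "?Q \<le> 2 * x + e / 2" using x(1) e by (subst (asm) ennreal_le_iff) auto
    then show ?case using x Q0 by simp
  qed
  then show "\<exists>no. \<forall>m\<ge>no. norm ((\<Sum>k<N m. (z m k - h (s m k))\<^sup>2 * (s m (Suc k) - s m k)) - 0) < e"
    by (simp add: eventually_sequentially)
qed

end

section \<open>Identification of the Ito integral with a pathwise integral\<close>

context scalar_brownian_motion
begin

text \<open>
  The approximating simple integrals and the Riemann-Stieltjes sums of \<open>H\<close> are written over common
  partitions, so that their difference is a single martingale transform. The pathwise limit need not
  be measurable with respect to \<open>P\<close>, so almost sure convergence along subsequences is used throughout.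
\<close>

lemma ito_integral_C1_fixed_time:
  assumes ito: "has_ito_integral P F \<beta> H J"
    and C1: "AE \<omega> in P. (\<forall>r\<ge>0. ((\<lambda>s. H s \<omega>) has_vector_derivative H' r \<omega>) (at r within {0..})) \<and>
       continuous_on {0..} (\<lambda>s. H' s \<omega>)"
    and t: "t > 0"
  shows "AE \<omega> in P. J t \<omega> = H t \<omega> * \<beta> t \<omega> - H 0 \<omega> * \<beta> 0 \<omega> - integral {0..t} (\<lambda>s. H' s \<omega> * \<beta> s \<omega>)"
proof -
  note ito' = ito[unfolded has_ito_integral_def]
  note prog = ito'[THEN conjunct1]
  have J: "J t \<in> borel_measurable (F t)" using ito' t by simp
  note lims = ito'[THEN conjunct2, THEN conjunct2, THEN conjunct2, THEN conjunct2]
  obtain n T \<xi> where simple: "\<forall>m. simple_integrand P F (n m) (T m) (\<xi> m)"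
    and Hlim: "\<forall>t\<ge>0. \<forall>\<epsilon>>0. (\<lambda>m. prob {\<omega> \<in> space P.
              (\<integral>\<^sup>+s\<in>{0..t}. ennreal ((simple_process (n m) (T m) (\<xi> m) s \<omega> - H s \<omega>)\<^sup>2) \<partial>lborel)
                > ennreal \<epsilon>}) \<longlonglongrightarrow> 0"
    and Jlim: "\<forall>t\<ge>0. \<forall>\<epsilon>>0. (\<lambda>m. prob {\<omega> \<in> space P.
              \<bar>simple_integral (n m) (T m) (\<xi> m) \<beta> t \<omega> - J t \<omega>\<bar> > \<epsilon>}) \<longlonglongrightarrow> 0"
    using lims by (elim exE conjE) (rule that)
  note simple = simple[rule_format]
  note Hlim = Hlim[rule_format, OF less_imp_le[OF t]] and Jlim = Jlim[rule_format, OF less_imp_le[OF t]]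
  define Z where "Z m \<omega> = (\<integral>\<^sup>+s\<in>{0..t}. ennreal ((simple_process (n m) (T m) (\<xi> m) s \<omega> - H s \<omega>)\<^sup>2) \<partial>lborel)" for m \<omega>
  define S where "S m = simple_integral (n m) (T m) (\<xi> m) \<beta> t" for m
  have [measurable]: "Z m \<in> borel_measurable P" for m
    unfolding Z_def using simple_error_measurable[OF prog simple] t by simp
  have [measurable]: "S m \<in> borel_measurable P" for m
    unfolding S_def using simple_integral_measurable[OF simple] t by simp
  have [measurable]: "J t \<in> borel_measurable P" using J by (rule measurable_F_P)
  \<comment> \<open>Adaptedness of \<open>H\<close> is recovered from progressive measurability up
    to time \<open>r\<close> by taking the section at \<open>r\<close> itself.\<close>
  have Hm: "H r \<in> borel_measurable (F r)" if "r \<ge> 0" for r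
  proof -
    have *: "(\<lambda>z. H (fst z) (snd z)) \<in> borel_measurable (restrict_space borel {0..r} \<Otimes>\<^sub>M F r)"
      using prog that by (simp add: progressively_measurable_def case_prod_beta')
    have "(\<lambda>\<omega>. (r, \<omega>)) \<in> measurable (F r) (restrict_space borel {0..r} \<Otimes>\<^sub>M F r)"
      by (rule measurable_Pair1') (use that in \<open>simp add: space_restrict_space\<close>)
    from measurable_compose[OF this *] show ?thesis by simp
  qed
  have "\<exists>r :: nat \<Rightarrow> nat. strict_mono r \<and> (AE \<omega> in P. (\<lambda>k. Z (r k) \<omega>) \<longlonglongrightarrow> 0)"
    by (rule tends_in_prob_AE_subseq) (use Hlim in \<open>auto simp: Z_def[symmetric]\<close>)
  then obtain r1 :: "nat \<Rightarrow> nat" where r1: "strict_mono r1" "AE \<omega> in P. (\<lambda>k. Z (r1 k) \<omega>) \<longlonglongrightarrow> 0" by blast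
  \<comment> \<open>The second subsequence is extracted from the first, so that along
    \<open>r\<close> both the integrands and the integrals converge almost surely.\<close>
  have "\<exists>r :: nat \<Rightarrow> nat. strict_mono r \<and> (AE \<omega> in P. (\<lambda>k. ennreal \<bar>S (r1 (r k)) \<omega> - J t \<omega>\<bar>) \<longlonglongrightarrow> 0)"
  proof (rule tends_in_prob_AE_subseq)
    fix \<epsilon> :: real assume \<epsilon>: "\<epsilon> > 0"
    show "(\<lambda>m. prob {\<omega> \<in> space P. ennreal \<epsilon> < ennreal \<bar>S (r1 m) \<omega> - J t \<omega>\<bar>}) \<longlonglongrightarrow> 0"
      using LIMSEQ_subseq_LIMSEQ[OF Jlim[OF \<epsilon>] r1(1)] \<epsilon> by (simp add: o_def S_def ennreal_less_iff)
  qed simp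
  then obtain r2 :: "nat \<Rightarrow> nat" where r2: "strict_mono r2"
    "AE \<omega> in P. (\<lambda>k. ennreal \<bar>S (r1 (r2 k)) \<omega> - J t \<omega>\<bar>) \<longlonglongrightarrow> 0" by blast
  define r where "r k = r1 (r2 k)" for k
  have SJ: "AE \<omega> in P. (\<lambda>k. S (r k) \<omega>) \<longlonglongrightarrow> J t \<omega>"
    using r2(2)
  proof eventually_elim
    case (elim \<omega>)
    then have "(\<lambda>k. ennreal \<bar>S (r k) \<omega> - J t \<omega>\<bar>) \<longlonglongrightarrow> ennreal 0" by (simp add: r_def)
    then have "(\<lambda>k. \<bar>S (r k) \<omega> - J t \<omega>\<bar>) \<longlonglongrightarrow> 0" by (subst (asm) tendsto_ennreal_iff) auto
    from LIM_zero_cancel[OF tendsto_rabs_zero_cancel[OF this]] show ?case .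
  qed
  have Z0: "AE \<omega> in P. (\<lambda>k. Z (r k) \<omega>) \<longlonglongrightarrow> 0"
    using r1(2)
  proof eventually_elim
    case (elim \<omega>)
    from LIMSEQ_subseq_LIMSEQ[OF this r2(1)] show ?case by (simp add: r_def o_def)
  qed
  have Tmono: "T m k \<le> T m (Suc k)" if "k < n m" for m k
    using simple[of m] that by (simp add: simple_integrand_def)
  have T0: "0 \<le> T m k" if "k \<le> n m" for m k
    using that
  proof (induction k)
    case (Suc k)
    then show ?case using Tmono[of k m] by simp
  qed (use simple[of m] in \<open>simp add: simple_integrand_def\<close>)
  \<comment> \<open>Partition number \<open>m\<close> contains the jump times, cut off at
    \<open>t\<close>, of the simple integrand number \<open>r m\<close>.\<close>
  have "\<exists>N s. s 0 = 0 \<and> s N = t \<and> mono s \<and> (\<forall>k<N. s k < s (Suc k)) \<and>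
    (\<forall>k<N. s (Suc k) - s k \<le> t / Suc m) \<and> (\<lambda>j. min (T (r m) j) t) ` {..n (r m)} \<subseteq> s ` {..N}" for m
    by (rule fine_partition) (use T0 t in auto)
  then obtain N s where s0: "\<And>m. s m 0 = 0" and sN: "\<And>m. s m (N m) = t" and smono: "\<And>m. mono (s m)"
    and sless: "\<And>m. \<forall>k<N m. s m k < s m (Suc k)"
    and smesh: "\<And>m k. k < N m \<Longrightarrow> s m (Suc k) - s m k \<le> t / Suc m"
    and simg: "\<And>m. (\<lambda>j. min (T (r m) j) t) ` {..n (r m)} \<subseteq> s m ` {..N m}"
    by metis
  have "(\<lambda>m. t * inverse (real (Suc m))) \<longlonglongrightarrow> t * 0"
    by (intro tendsto_mult_left LIMSEQ_inverse_real_of_nat)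
  then have mesh0: "(\<lambda>m. t / real (Suc m)) \<longlonglongrightarrow> 0" by (simp add: divide_inverse)
  interpret part: partition_sequence t N s "\<lambda>m. t / Suc m"
    by unfold_locales (use s0 sN smono smesh t mesh0 in auto)
  define z where "z m k \<omega> = simple_process (n (r m)) (T (r m)) (\<xi> (r m)) (s m (Suc k)) \<omega>" for m k \<omega>
  define R where "R m \<omega> = (\<Sum>k<N m. H (s m k) \<omega> * (\<beta> (s m (Suc k)) \<omega> - \<beta> (s m k) \<omega>))" for m \<omega>
  define Q where "Q m \<omega> = (\<Sum>k<N m. (z m k \<omega> - H (s m k) \<omega>)\<^sup>2 * (s m (Suc k) - s m k))" for m \<omega>
  have s_nonneg: "0 \<le> s m k" for m k using monoD[OF smono, of 0 k m] s0 by simp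
  have S_eq: "S (r m) \<omega> = (\<Sum>k<N m. z m k \<omega> * (\<beta> (s m (Suc k)) \<omega> - \<beta> (s m k) \<omega>))" for m \<omega>
    unfolding S_def z_def by (rule simple_integral_refine[OF sN sless Tmono simg])
  \<comment> \<open>The value is read at the right end of a cell but is known at its left end: a
    \<open>\<xi>\<close> whose interval has not begun before the right end contributes 0, and any
    other one has begun by the left end.\<close>
  have zF: "z m k \<in> borel_measurable (F (s m k))" if k: "k < N m" for m k
    unfolding z_def[abs_def] simple_process_def
  proof (rule borel_measurable_sum)
    fix i assume "i \<in> {..<n (r m)}"
    then have i: "i < n (r m)" by simp
    show "(\<lambda>\<omega>. \<xi> (r m) i \<omega> * indicator {T (r m) i<..T (r m) (Suc i)} (s m (Suc k))) \<in> borel_measurable (F (s m k))"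
    proof (cases "T (r m) i < s m (Suc k)")
      case True
      have "T (r m) i \<le> s m k"
        by (rule simple_process_const(2)[OF sN sless simg k, of "s m (Suc k)"]) (use True i sless k in auto)
      then have "\<xi> (r m) i \<in> borel_measurable (F (s m k))"
        using measurable_F_mono simple[of "r m"] i by (auto simp: simple_integrand_def)
      then show ?thesis by simp
    qed simp
  qed
  have HF: "H (s m k) \<in> borel_measurable (F (s m k))" for m k by (rule Hm[OF s_nonneg])
  have \<beta>P: "\<beta> (s m k) \<in> borel_measurable P" for m k by (rule measurable_F_P[OF adapted[OF s_nonneg]])
  have [measurable]: "R m \<in> borel_measurable P" for m
    unfolding R_def[abs_def] using \<beta>P measurable_F_P[OF HF] by simp
  have [measurable]: "Q m \<in> borel_measurable P" for m
    unfolding Q_def[abs_def]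
    by (intro borel_measurable_sum borel_measurable_times borel_measurable_power borel_measurable_diff borel_measurable_const)
      (use measurable_F_P[OF HF] measurable_F_P[OF zF] in auto)
  have H_cont: "AE \<omega> in P. continuous_on {0..t} (\<lambda>r. H r \<omega>)"
    using C1
  proof eventually_elim
    case (elim \<omega>)
    then have "continuous_on {0..} (\<lambda>r. H r \<omega>)"
      by (intro continuous_on_vector_derivative) auto
    then show ?case by (rule continuous_on_subset) auto
  qed
  have Q0: "AE \<omega> in P. (\<lambda>m. Q m \<omega>) \<longlonglongrightarrow> 0"
    using Z0 H_cont
  proof eventually_elim
    case (elim \<omega>)
    show ?case
      unfolding Q_def
    proof (rule part.step_square_convergence[where g = "\<lambda>m s. simple_process (n (r m)) (T (r m)) (\<xi> (r m)) s \<omega>"])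
      fix m k \<rho> assume *: "k < N m" "s m k < \<rho>" "\<rho> \<le> s m (Suc k)"
      show "simple_process (n (r m)) (T (r m)) (\<xi> (r m)) \<rho> \<omega> = z m k \<omega>"
        unfolding z_def by (rule simple_process_const(1)[OF sN sless simg *])
    next
      show "(\<lambda>s. simple_process (n (r m)) (T (r m)) (\<xi> (r m)) s \<omega>) \<in> borel_measurable borel" for m
        unfolding simple_process_def by measurable
    qed (use elim in \<open>simp_all add: Z_def\<close>)
  qed
  \<comment> \<open>\<open>S - R\<close> is the transform of \<open>z - H\<close> by the increments
    of \<open>\<beta>\<close>, and \<open>Q\<close> is its sum of squares weighted by the variances
    of the increments.\<close>
  have tail: "prob {\<omega> \<in> space P. \<bar>S (r m) \<omega> - R m \<omega>\<bar> > \<epsilon>} \<le> prob {\<omega> \<in> space P. Q m \<omega> > \<eta>} + \<eta> / \<epsilon>\<^sup>2"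
    if "\<epsilon> > 0" "\<eta> > 0" for m \<epsilon> \<eta>
  proof -
    interpret independent_increments P "\<lambda>k. F (s m k)" "\<lambda>k \<omega>. \<beta> (s m (Suc k)) \<omega> - \<beta> (s m k) \<omega>" "\<lambda>k. s m (Suc k) - s m k" "N m"
      by (rule independent_increments_partition) (use s0 smono sless in auto)
    have "S (r m) \<omega> - R m \<omega> = (\<Sum>k<N m. (z m k \<omega> - H (s m k) \<omega>) * (\<beta> (s m (Suc k)) \<omega> - \<beta> (s m k) \<omega>))" for \<omega>
      unfolding S_eq R_def by (simp add: sum_subtractf[symmetric] algebra_simps)
    then show ?thesis
      using martingale_transform_tail[of "\<lambda>k \<omega>. z m k \<omega> - H (s m k) \<omega>" \<epsilon> \<eta>] zF HF that
      by (simp add: Q_def)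
  qed
  have "\<exists>\<rho> :: nat \<Rightarrow> nat. strict_mono \<rho> \<and> (AE \<omega> in P. (\<lambda>k. ennreal \<bar>S (r (\<rho> k)) \<omega> - R (\<rho> k) \<omega>\<bar>) \<longlonglongrightarrow> 0)"
  proof (rule tends_in_prob_AE_subseq)
    fix \<epsilon> :: real assume \<epsilon>: "\<epsilon> > 0"
    have "(\<lambda>m. prob {\<omega> \<in> space P. \<epsilon> < \<bar>S (r m) \<omega> - R m \<omega>\<bar>}) \<longlonglongrightarrow> 0"
    proof (rule order_tendstoI)
      fix a :: real assume "0 < a"
      \<comment> \<open>With this \<open>\<eta>\<close> the second summand of \<open>tail\<close> is
        a/2; the first falls below a/2 because \<open>Q\<close> tends to 0 in probability.\<close>
      define \<eta> where "\<eta> = a * \<epsilon>\<^sup>2 / 2"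
      have \<eta>: "\<eta> > 0" "\<eta> / \<epsilon>\<^sup>2 = a / 2" using \<open>0 < a\<close> \<epsilon> by (auto simp: \<eta>_def)
      have "(\<lambda>m. prob {\<omega> \<in> space P. Q m \<omega> > \<eta>}) \<longlonglongrightarrow> 0"
        by (rule AE_tendsto_imp_in_prob[OF _ Q0 \<eta>(1)]) simp
      then have "eventually (\<lambda>m. prob {\<omega> \<in> space P. Q m \<omega> > \<eta>} < a / 2) sequentially"
        by (rule order_tendstoD(2)) (use \<open>0 < a\<close> in simp)
      then show "eventually (\<lambda>m. prob {\<omega> \<in> space P. \<epsilon> < \<bar>S (r m) \<omega> - R m \<omega>\<bar>} < a) sequentially"
      proof eventually_elim
        case (elim m)
        then show ?case using tail[OF \<epsilon> \<eta>(1), of m] \<eta>(2) by linarith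
      qed
    qed (auto intro!: always_eventually less_le_trans[OF _ measure_nonneg])
    then show "(\<lambda>m. prob {\<omega> \<in> space P. ennreal \<epsilon> < ennreal \<bar>S (r m) \<omega> - R m \<omega>\<bar>}) \<longlonglongrightarrow> 0"
      using \<epsilon> by (simp add: ennreal_less_iff)
  qed simp
  then obtain \<rho> :: "nat \<Rightarrow> nat" where \<rho>: "strict_mono \<rho>"
    "AE \<omega> in P. (\<lambda>k. ennreal \<bar>S (r (\<rho> k)) \<omega> - R (\<rho> k) \<omega>\<bar>) \<longlonglongrightarrow> 0" by blast
  \<comment> \<open>Along \<open>\<rho>\<close> the sums \<open>R\<close> have the same limit as the
    simple integrals, namely \<open>J t\<close>; the whole sequence \<open>R\<close> converges to
    the pathwise expression, so the two limits agree.\<close>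
  from \<rho>(2) SJ C1 cont show ?thesis
  proof eventually_elim
    case (elim \<omega>)
    have "(\<lambda>k. ennreal \<bar>S (r (\<rho> k)) \<omega> - R (\<rho> k) \<omega>\<bar>) \<longlonglongrightarrow> ennreal 0" using elim(1) by simp
    then have "(\<lambda>k. \<bar>S (r (\<rho> k)) \<omega> - R (\<rho> k) \<omega>\<bar>) \<longlonglongrightarrow> 0" by (subst (asm) tendsto_ennreal_iff) auto
    then have SR: "(\<lambda>k. S (r (\<rho> k)) \<omega> - R (\<rho> k) \<omega>) \<longlonglongrightarrow> 0" by (rule tendsto_rabs_zero_cancel)
    have "(\<lambda>k. S (r (\<rho> k)) \<omega>) \<longlonglongrightarrow> J t \<omega>"
      using LIMSEQ_subseq_LIMSEQ[OF elim(2) \<rho>(1)] by (simp add: o_def)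
    from tendsto_diff[OF this SR] have 1: "(\<lambda>k. R (\<rho> k) \<omega>) \<longlonglongrightarrow> J t \<omega>" by simp
    have "(\<lambda>m. R m \<omega>) \<longlonglongrightarrow> H t \<omega> * \<beta> t \<omega> - H 0 \<omega> * \<beta> 0 \<omega> - integral {0..t} (\<lambda>s. H' s \<omega> * \<beta> s \<omega>)"
      unfolding R_def
    proof (rule part.Riemann_Stieltjes_convergence)
      fix u assume "u \<in> {0..t}"
      then have "((\<lambda>s. H s \<omega>) has_vector_derivative H' u \<omega>) (at u within {0..})" using elim(3) by auto
      then show "((\<lambda>s. H s \<omega>) has_vector_derivative H' u \<omega>) (at u within {0..t})"
        by (rule has_vector_derivative_within_subset) auto
    qed (use elim(3,4) in \<open>auto intro: continuous_on_subset\<close>)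
    from LIMSEQ_subseq_LIMSEQ[OF this \<rho>(1)]
    have 2: "(\<lambda>k. R (\<rho> k) \<omega>) \<longlonglongrightarrow> H t \<omega> * \<beta> t \<omega> - H 0 \<omega> * \<beta> 0 \<omega> - integral {0..t} (\<lambda>s. H' s \<omega> * \<beta> s \<omega>)"
      by (simp add: o_def)
    show ?case by (rule LIMSEQ_unique[OF 1 2])
  qed
qed

text \<open>The exceptional set at a fixed time depends on that time, so only those of the positive
  rationals are discarded. Both sides are continuous in time, and agreement passes to the closure of
  the rationals in (0,t+1), an interval chosen so that \<open>t\<close> lies in this closure even
  when it is 0.\<close>

theorem ito_integral_C1:
  assumes ito: "has_ito_integral P F \<beta> H J"
    and C1: "AE \<omega> in P. (\<forall>r\<ge>0. ((\<lambda>s. H s \<omega>) has_vector_derivative H' r \<omega>) (at r within {0..})) \<and>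
       continuous_on {0..} (\<lambda>s. H' s \<omega>)"
  shows "AE \<omega> in P. \<forall>t\<ge>0. J t \<omega> = H t \<omega> * \<beta> t \<omega> - H 0 \<omega> * \<beta> 0 \<omega> - integral {0..t} (\<lambda>s. H' s \<omega> * \<beta> s \<omega>)"
proof -
  have "AE \<omega> in P. \<forall>q\<in>\<rat> \<inter> {0<..}. J q \<omega> = H q \<omega> * \<beta> q \<omega> - H 0 \<omega> * \<beta> 0 \<omega> - integral {0..q} (\<lambda>s. H' s \<omega> * \<beta> s \<omega>)"
    by (rule AE_ball_countable')
      (use ito_integral_C1_fixed_time[OF ito C1] countable_rat in \<open>auto intro: countable_Int1\<close>)
  moreover have "AE \<omega> in P. continuous_on {0..} (\<lambda>t. J t \<omega>)"
    using ito by (simp add: has_ito_integral_def)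
  ultimately show ?thesis
    using C1 cont
  proof eventually_elim
    case (elim \<omega>)
    define \<Psi> where "\<Psi> t = H t \<omega> * \<beta> t \<omega> - H 0 \<omega> * \<beta> 0 \<omega> - integral {0..t} (\<lambda>s. H' s \<omega> * \<beta> s \<omega>)" for t
    have Hc: "continuous_on {0..} (\<lambda>t. H t \<omega>)"
      using elim(3) by (intro continuous_on_vector_derivative) auto
    have hb: "continuous_on {0..} (\<lambda>s. H' s \<omega> * \<beta> s \<omega>)"
      using elim by (intro continuous_intros) auto
    have ic: "continuous_on {0..T} (\<lambda>t. integral {0..t} (\<lambda>s. H' s \<omega> * \<beta> s \<omega>))" for T
      by (rule indefinite_integral_continuous_1[OF integrable_continuous_real])
        (rule continuous_on_subset[OF hb], auto)
    show ?case
    proof (intro allI impI)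
      fix t :: real assume t: "t \<ge> 0"
      have "J t \<omega> - \<Psi> t = 0"
      proof (rule continuous_constant_on_closure[where S = "\<rat> \<inter> {0<..<t+1}" and f = "\<lambda>t. J t \<omega> - \<Psi> t"])
        have cl: "closure (\<rat> \<inter> {0<..<t+1}) = {0..t+1}"
        proof -
          have "closure ({0<..<t+1} \<inter> \<rat>) = closure {0<..<t+1}"
            by (rule closure_open_Int_superset) (auto simp: Rats_closure_real)
          then show ?thesis using t by (simp add: Int_commute)
        qed
        have "continuous_on {0..t+1} \<Psi>"
          unfolding \<Psi>_def[abs_def]
          by (intro continuous_intros ic) (use elim Hc in \<open>auto intro: continuous_on_subset\<close>)
        then show "continuous_on (closure (\<rat> \<inter> {0<..<t+1})) (\<lambda>t. J t \<omega> - \<Psi> t)"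
          unfolding cl by (intro continuous_intros) (use elim(2) in \<open>auto intro: continuous_on_subset\<close>)
        show "t \<in> closure (\<rat> \<inter> {0<..<t+1})" unfolding cl using t by simp
      qed (use elim(1) in \<open>auto simp: \<Psi>_def\<close>)
      then show "J t \<omega> = H t \<omega> * \<beta> t \<omega> - H 0 \<omega> * \<beta> 0 \<omega> - integral {0..t} (\<lambda>s. H' s \<omega> * \<beta> s \<omega>)"
        by (simp add: \<Psi>_def)
    qed
  qed
qed

end

section \<open>Derivatives in charts\<close>

lemma at_within_openin_eq:
  assumes "openin (top_of_set E) W" "u \<in> W"
  shows "at u within W = at u within E"
proof -
  obtain V where V: "open V" "W = E \<inter> V" using assms(1) by (auto simp: openin_open)
  show ?thesis by (rule at_within_nhd[of u V]) (use V assms(2) in auto)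
qed

lemma has_derivative_dd:
  assumes "h differentiable (at u within E)"
  shows "(h has_derivative dd E h u) (at u within E)"
  using assms unfolding dd_def[abs_def] by (simp add: frechet_derivative_works)

lemma linear_dd: "h differentiable (at u within E) \<Longrightarrow> linear (dd E h u)"
  using has_derivative_dd has_derivative_linear by blast

text \<open>A derivative within the subspace \<open>E\<close> is determined only on directions in
  \<open>E\<close>. There it is unique because the line through \<open>u\<close> in the direction
  \<open>a\<close> stays in \<open>E\<close>, and the derivative of a curve is unique.\<close>

lemma dd_eqI:
  assumes E: "subspace E" "u \<in> E" "a \<in> E" and D: "(h has_derivative D) (at u within E)"
  shows "dd E h u a = D a"
proof -
  let ?\<gamma> = "\<lambda>s::real. u + s *\<^sub>R a"
  have \<gamma>: "(?\<gamma> has_vector_derivative a) (at 0)" by (auto intro!: derivative_eq_intros)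
  have sub: "range ?\<gamma> \<subseteq> E" using E by (auto intro: subspace_add subspace_scale)
  have *: "((h \<circ> ?\<gamma>) has_vector_derivative D' a) (at 0)" if "(h has_derivative D') (at u within E)" for D'
    by (rule vector_derivative_diff_chain_within[OF \<gamma>]) (use has_derivative_subset[OF that sub] in simp)
  have "h differentiable (at u within E)" using D by (auto simp: differentiable_def)
  from *[OF has_derivative_dd[OF this]] *[OF D] show ?thesis by (rule vector_derivative_unique_at)
qed

lemma has_derivative_openin_cong:
  assumes "(h has_derivative D) (at u within E)" "openin (top_of_set E) W" "u \<in> W"
    and "\<And>q. q \<in> W \<Longrightarrow> g q = h q"
  shows "(g has_derivative D) (at u within E)"
proof -
  have "(h has_derivative D) (at u within W)" using assms by (simp add: at_within_openin_eq)
  then have "(g has_derivative D) (at u within W)"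
    by (rule has_derivative_transform[where f = h and g = g, rotated 2]) (use assms(3,4) in blast)+
  then show ?thesis by (simp only: at_within_openin_eq[OF assms(2,3)])
qed

lemma has_derivative_dd_chain:
  assumes \<phi>: "\<phi> differentiable (at u within E)" and W: "openin (top_of_set E) W" "u \<in> W" "\<phi> ` W \<subseteq> E"
    and g: "g differentiable (at (\<phi> u) within E)"
  shows "((\<lambda>q. g (\<phi> q)) has_derivative (\<lambda>a. dd E g (\<phi> u) (dd E \<phi> u a))) (at u within E)"
proof -
  have "(\<phi> has_derivative dd E \<phi> u) (at u within W)"
    using has_derivative_dd[OF \<phi>] W by (simp add: at_within_openin_eq)
  moreover have "(g has_derivative dd E g (\<phi> u)) (at (\<phi> u) within \<phi> ` W)"
    by (rule has_derivative_subset[OF has_derivative_dd[OF g] W(3)])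
  ultimately have "(g \<circ> \<phi> has_derivative dd E g (\<phi> u) \<circ> dd E \<phi> u) (at u within W)"
    by (rule diff_chain_within)
  then show ?thesis using W by (simp add: at_within_openin_eq o_def)
qed

lemma smooth_on_differentiable: "smooth_on E S h \<Longrightarrow> u \<in> S \<Longrightarrow> h differentiable (at u within E)"
  unfolding smooth_on_def by (metis Ck_on.simps(2))

lemma smooth_on_dd: "smooth_on E S h \<Longrightarrow> a \<in> E \<Longrightarrow> smooth_on E S (\<lambda>u. dd E h u a)"
  unfolding smooth_on_def by (metis Ck_on.simps(2))

lemma smooth_on_continuous: "smooth_on E S h \<Longrightarrow> continuous_on S h"
  unfolding smooth_on_def by (metis Ck_on.simps(1))

text \<open>Smoothness is encoded one fixed direction at a time. Expanding a varying vector over a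
  finite family of directions in \<open>E\<close> reduces everything to such fixed
  directions.\<close>

lemma subspace_expansion:
  fixes E :: "'e::euclidean_space set"
  assumes "subspace E"
  obtains B where "finite B" "B \<subseteq> E" "\<And>a. a \<in> E \<Longrightarrow> a = (\<Sum>b\<in>B. (a \<bullet> b) *\<^sub>R b)"
proof -
  obtain B where B: "B \<subseteq> E" "pairwise orthogonal B" "\<And>x. x \<in> B \<Longrightarrow> norm x = 1" "independent B" "span B = E"
    using orthonormal_basis_subspace[OF assms] by metis
  have fin: "finite B" using B(4) by (rule independent_imp_finite)
  have "a = (\<Sum>b\<in>B. (a \<bullet> b) *\<^sub>R b)" if "a \<in> E" for a
  proof -
    have "a \<in> span B" using that B by simp
    then obtain r where r: "a = (\<Sum>b\<in>B. r b *\<^sub>R b)" using fin by (auto simp: span_finite)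
    have "a \<bullet> b = r b" if "b \<in> B" for b
    proof -
      have "a \<bullet> b = (\<Sum>b'\<in>B. r b' * (b' \<bullet> b))" by (simp add: r inner_sum_left)
      also have "\<dots> = (\<Sum>b'\<in>B. if b' = b then r b else 0)"
        using B(2,3) that
        by (intro sum.cong) (auto simp: pairwise_def orthogonal_def dot_square_norm)
      finally show ?thesis using that fin by simp
    qed
    then show ?thesis using r by simp
  qed
  then show thesis using that B fin by blast
qed

lemma linear_on_subspace_sum:
  fixes L :: "'e::real_vector \<Rightarrow> 'b::real_vector"
  assumes E: "subspace E" and L: "\<And>a e r. a \<in> E \<Longrightarrow> e \<in> E \<Longrightarrow> L (r *\<^sub>R a + e) = r *\<^sub>R L a + L e"
    and A: "finite A" "\<And>i. i \<in> A \<Longrightarrow> u i \<in> E"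
  shows "L (\<Sum>i\<in>A. r i *\<^sub>R u i) = (\<Sum>i\<in>A. r i *\<^sub>R L (u i))"
  using A
proof (induction A rule: finite_induct)
  case empty
  show ?case using L[of 0 0 1] subspace_0[OF E] by simp
next
  case (insert i A)
  have "(\<Sum>i\<in>A. r i *\<^sub>R u i) \<in> E" using insert by (intro subspace_sum subspace_scale E) auto
  then show ?case using insert L by simp
qed

section \<open>Charts, tangent vectors and differentials of functions\<close>

lemma smooth_manifoldD:
  assumes "smooth_manifold N"
  shows "subspace (model N)"
    and "c \<in> atlas N \<Longrightarrow> inj_on (snd c) (fst c)"
    and "c \<in> atlas N \<Longrightarrow> openin (top_of_set (model N)) (snd c ` fst c)"
    and "c \<in> atlas N \<Longrightarrow> d \<in> atlas N \<Longrightarrow> openin (top_of_set (model N)) (snd c ` (fst c \<inter> fst d))"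
    and "c \<in> atlas N \<Longrightarrow> d \<in> atlas N \<Longrightarrow> smooth_on (model N) (snd c ` (fst c \<inter> fst d)) (snd d \<circ> chart_inv c)"
  using assms unfolding smooth_manifold_def by blast+

lemma chart_inv_chart: "smooth_manifold N \<Longrightarrow> c \<in> atlas N \<Longrightarrow> y \<in> fst c \<Longrightarrow> chart_inv c (snd c y) = y"
  unfolding chart_inv_def by (rule inv_into_f_f[OF smooth_manifoldD(2)])

lemma chart_range: "smooth_manifold N \<Longrightarrow> c \<in> atlas N \<Longrightarrow> y \<in> fst c \<Longrightarrow> snd c y \<in> model N"
  using smooth_manifoldD(3)[of N c] openin_imp_subset by fastforce

text \<open>\<open>mtop\<close> is given through \<open>topology\<close>, so its open sets can be
  read off only once the defining family is known to be a topology. The case of intersections rests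
  on the injectivity of charts.\<close>

lemma openin_mtop_chart:
  assumes N: "smooth_manifold N" and c: "c \<in> atlas N"
  shows "openin (mtop N) (fst c)"
proof -
  let ?open = "\<lambda>W. W \<subseteq> points N \<and> (\<forall>c\<in>atlas N. openin (top_of_set (model N)) (snd c ` (W \<inter> fst c)))"
  have "istopology ?open"
    unfolding istopology_def
  proof (intro conjI allI impI)
    fix S T assume *: "?open S" "?open T"
    show "S \<inter> T \<subseteq> points N" using * by blast
    show "\<forall>c\<in>atlas N. openin (top_of_set (model N)) (snd c ` (S \<inter> T \<inter> fst c))"
    proof
      fix d assume d: "d \<in> atlas N"
      have "snd d ` (S \<inter> T \<inter> fst d) = snd d ` (S \<inter> fst d) \<inter> snd d ` (T \<inter> fst d)"
        using smooth_manifoldD(2)[OF N d] by (auto simp: inj_on_def)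
      then show "openin (top_of_set (model N)) (snd d ` (S \<inter> T \<inter> fst d))" using * d by auto
    qed
  next
    fix \<K> assume *: "\<forall>S\<in>\<K>. ?open S"
    show "\<Union>\<K> \<subseteq> points N" using * by blast
    show "\<forall>c\<in>atlas N. openin (top_of_set (model N)) (snd c ` (\<Union>\<K> \<inter> fst c))"
    proof
      fix d assume d: "d \<in> atlas N"
      have "snd d ` (\<Union>\<K> \<inter> fst d) = (\<Union>S\<in>\<K>. snd d ` (S \<inter> fst d))" by blast
      then show "openin (top_of_set (model N)) (snd d ` (\<Union>\<K> \<inter> fst d))" using * d by auto
    qed
  qed
  then have "openin (mtop N) = ?open" unfolding mtop_def by (simp add: topology_inverse')
  moreover have "fst c \<subseteq> points N" using c by (auto simp: points_def)
  ultimately show ?thesis using smooth_manifoldD(4)[OF N _ c] by (auto simp: Int_commute)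
qed

lemma charts_atD: "c \<in> charts_at N y \<Longrightarrow> c \<in> atlas N" "c \<in> charts_at N y \<Longrightarrow> y \<in> fst c"
  by (auto simp: charts_at_def)

lemma tangentD:
  assumes "v \<in> tangent N y"
  shows "c \<in> charts_at N y \<Longrightarrow> v c \<in> model N" "c \<notin> charts_at N y \<Longrightarrow> v c = 0"
    and "c \<in> charts_at N y \<Longrightarrow> d \<in> charts_at N y \<Longrightarrow> v d = dd (model N) (snd d \<circ> chart_inv c) (snd c y) (v c)"
  using assms unfolding tangent_def by blast+

lemma some_chart_in: "c \<in> charts_at N y \<Longrightarrow> some_chart N y \<in> charts_at N y"
  unfolding some_chart_def by (rule someI)

lemma smooth_fun_chart: "smooth_fun N f \<Longrightarrow> c \<in> atlas N \<Longrightarrow> smooth_on (model N) (snd c ` fst c) (f \<circ> chart_inv c)"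
  by (simp add: smooth_fun_def)

lemma transition_differentiable:
  assumes N: "smooth_manifold N" and c: "c \<in> charts_at N y" and d: "d \<in> charts_at N y"
  shows "(snd d \<circ> chart_inv c) differentiable (at (snd c y) within model N)"
  by (rule smooth_on_differentiable[OF smooth_manifoldD(5)[OF N charts_atD(1)[OF c] charts_atD(1)[OF d]]])
    (simp add: charts_atD(2)[OF c] charts_atD(2)[OF d])

text \<open>In the chosen chart \<open>d\<close>, the function is its expression in \<open>c\<close>
  composed with the transition map; the chain rule then meets the transformation law of tangent
  vectors.\<close>

lemma dfun_chart:
  assumes N: "smooth_manifold N" and f: "smooth_fun N f" and c: "c \<in> charts_at N y" and v: "v \<in> tangent N y"
  shows "dfun N f y v = dd (model N) (f \<circ> chart_inv c) (snd c y) (v c)"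
proof -
  let ?E = "model N"
  define d where "d = some_chart N y"
  have d: "d \<in> charts_at N y" using some_chart_in[OF c] by (simp add: d_def)
  note c' = charts_atD[OF c] and d' = charts_atD[OF d]
  let ?\<phi> = "snd c \<circ> chart_inv d" and ?g = "f \<circ> chart_inv c" and ?W = "snd d ` (fst d \<inter> fst c)"
  have W: "openin (top_of_set ?E) ?W" "snd d y \<in> ?W" using smooth_manifoldD(4)[OF N d'(1) c'(1)] c'(2) d'(2) by auto
  have \<phi>_val: "?\<phi> (snd d z) = snd c z" if "z \<in> fst d" for z using chart_inv_chart[OF N d'(1) that] by simp
  have "((\<lambda>q. ?g (?\<phi> q)) has_derivative (\<lambda>a. dd ?E ?g (?\<phi> (snd d y)) (dd ?E ?\<phi> (snd d y) a))) (at (snd d y) within ?E)"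
  proof (rule has_derivative_dd_chain[OF transition_differentiable[OF N d c] W])
    show "?\<phi> ` ?W \<subseteq> ?E" using \<phi>_val chart_range[OF N c'(1)] by auto
    show "?g differentiable at (?\<phi> (snd d y)) within ?E"
      unfolding \<phi>_val[OF d'(2)]
      by (rule smooth_on_differentiable[OF smooth_fun_chart[OF f c'(1)]]) (use c'(2) in auto)
  qed
  then have "(f \<circ> chart_inv d has_derivative (\<lambda>a. dd ?E ?g (?\<phi> (snd d y)) (dd ?E ?\<phi> (snd d y) a))) (at (snd d y) within ?E)"
  proof (rule has_derivative_openin_cong[OF _ W])
    fix q assume "q \<in> ?W"
    then show "(f \<circ> chart_inv d) q = ?g (?\<phi> q)"
      using chart_inv_chart[OF N d'(1)] chart_inv_chart[OF N c'(1)] by auto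
  qed
  then have "dd ?E (f \<circ> chart_inv d) (snd d y) (v d) = dd ?E ?g (?\<phi> (snd d y)) (dd ?E ?\<phi> (snd d y) (v d))"
    by (rule dd_eqI[OF smooth_manifoldD(1)[OF N] chart_range[OF N d'] tangentD(1)[OF v d]])
  also have "dd ?E ?\<phi> (snd d y) (v d) = v c" using tangentD(3)[OF v d c] by simp
  finally show ?thesis unfolding \<phi>_val[OF d'(2)] by (simp only: dfun_def d_def[symmetric])
qed

lemma dfun_linear:
  assumes "smooth_manifold N" "smooth_fun N f" "y \<in> points N"
  shows "dfun N f y (\<lambda>c. r *\<^sub>R u c + u' c) = r * dfun N f y u + dfun N f y u'"
proof -
  obtain c where c: "c \<in> charts_at N y" using assms(3) by (auto simp: points_def charts_at_def)
  define d where "d = some_chart N y"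
  have d: "d \<in> atlas N" "y \<in> fst d" using charts_atD[OF some_chart_in[OF c]] by (auto simp: d_def)
  have "linear (dd (model N) (f \<circ> chart_inv d) (snd d y))"
    by (rule linear_dd[OF smooth_on_differentiable[OF smooth_fun_chart[OF assms(2) d(1)]]]) (use d in auto)
  then show ?thesis by (simp add: dfun_def d_def[symmetric] linear_add linear_scale)
qed

lemma tsubspace_tangent:
  assumes N: "smooth_manifold N"
  shows "tsubspace (tangent N y)"
proof -
  have lin: "linear (dd (model N) (snd d \<circ> chart_inv c) (snd c y))"
    if "c \<in> charts_at N y" "d \<in> charts_at N y" for c d
    by (rule linear_dd[OF transition_differentiable[OF N that]])
  have zero: "(\<lambda>_. 0) \<in> tangent N y"
    unfolding tangent_def using linear_0[OF lin] subspace_0[OF smooth_manifoldD(1)[OF N]] by simp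
  have comb: "(\<lambda>c. r *\<^sub>R u c + v c) \<in> tangent N y" if u: "u \<in> tangent N y" and v: "v \<in> tangent N y" for u v r
    unfolding tangent_def
  proof (intro CollectI conjI allI impI ballI)
    fix c assume c: "c \<in> charts_at N y"
    show "r *\<^sub>R u c + v c \<in> model N"
      using tangentD(1)[OF u c] tangentD(1)[OF v c] smooth_manifoldD(1)[OF N]
      by (intro subspace_add subspace_scale)
    fix d assume d: "d \<in> charts_at N y"
    show "r *\<^sub>R u d + v d = dd (model N) (snd d \<circ> chart_inv c) (snd c y) (r *\<^sub>R u c + v c)"
      using tangentD(3)[OF u c d] tangentD(3)[OF v c d] by (simp add: linear_add[OF lin[OF c d]] linear_scale[OF lin[OF c d]])
  qed (simp add: tangentD(2)[OF u] tangentD(2)[OF v])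
  show ?thesis unfolding tsubspace_def using zero comb by blast
qed

lemma tsubspace_sum:
  assumes S: "tsubspace S" and A: "finite A" "\<And>i. i \<in> A \<Longrightarrow> u i \<in> S"
  shows "(\<lambda>c. \<Sum>i\<in>A. r i *\<^sub>R u i c) \<in> S"
  using A
proof (induction A rule: finite_induct)
  case empty
  then show ?case using S by (simp add: tsubspace_def)
next
  case (insert i A)
  then have "(\<lambda>c. r i *\<^sub>R u i c + (\<Sum>i\<in>A. r i *\<^sub>R u i c)) \<in> S" using S by (simp add: tsubspace_def)
  then show ?case using insert by simp
qed

lemma tlinear_sum:
  fixes L :: "('i \<Rightarrow> 'e::real_vector) \<Rightarrow> 'b::real_vector"
  assumes S: "tsubspace S" and L: "\<And>u v r. u \<in> S \<Longrightarrow> v \<in> S \<Longrightarrow> L (\<lambda>c. r *\<^sub>R u c + v c) = r *\<^sub>R L u + L v"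
    and A: "finite A" "\<And>i. i \<in> A \<Longrightarrow> u i \<in> S"
  shows "L (\<lambda>c. \<Sum>i\<in>A. r i *\<^sub>R u i c) = (\<Sum>i\<in>A. r i *\<^sub>R L (u i))"
  using A
proof (induction A rule: finite_induct)
  case empty
  have "(\<lambda>_. 0) \<in> S" using S by (simp add: tsubspace_def)
  then have "L (\<lambda>_. 0) = L (\<lambda>_. 0) + L (\<lambda>_. 0)" using L[of "\<lambda>_. 0" "\<lambda>_. 0" 1] by simp
  then show ?case by simp
next
  case (insert i A)
  then have "L (\<lambda>c. r i *\<^sub>R u i c + (\<Sum>i\<in>A. r i *\<^sub>R u i c)) = r i *\<^sub>R L (u i) + (\<Sum>i\<in>A. r i *\<^sub>R L (u i))"
    using L[of "u i" "\<lambda>c. \<Sum>i\<in>A. r i *\<^sub>R u i c"] tsubspace_sum[OF S insert(1)] by simp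
  then show ?case using insert by simp
qed

lemma tangent_eqI:
  assumes "u \<in> tangent N y" "v \<in> tangent N y" "c \<in> charts_at N y" "u c = v c"
  shows "u = v"
proof
  fix d
  show "u d = v d"
  proof (cases "d \<in> charts_at N y")
    case True
    show ?thesis
      unfolding tangentD(3)[OF assms(1,3) True] tangentD(3)[OF assms(2,3) True] assms(4) ..
  next
    case False
    show ?thesis unfolding tangentD(2)[OF assms(1) False] tangentD(2)[OF assms(2) False] ..
  qed
qed

text \<open>The component in one chart determines a tangent vector, so a linear form on the tangent
  space is a linear function of that component. Such an \<open>L\<close> is continuous and commutes
  with integrals, which transfers chartwise properties of \<open>w\<close> and \<open>y\<close> to
  their inner products. It is built by lifting an orthonormal basis of the space of components back
  to tangent vectors.\<close>

lemma tangent_form_in_chart: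
  fixes N :: "('m, 'e::euclidean_space) manifold"
  assumes N: "smooth_manifold N" and c: "c \<in> charts_at N y"
    and \<phi>: "\<And>u v r. u \<in> tangent N y \<Longrightarrow> v \<in> tangent N y \<Longrightarrow> \<phi> (\<lambda>c. r *\<^sub>R u c + v c) = r * \<phi> u + \<phi> v"
  obtains L :: "'e \<Rightarrow> real" where "linear L" "\<And>v. v \<in> tangent N y \<Longrightarrow> \<phi> v = L (v c)"
proof -
  let ?T = "tangent N y"
  note T = tsubspace_tangent[OF N, of y]
  have zero: "(\<lambda>_. 0) \<in> ?T" and comb: "\<And>u v r. u \<in> ?T \<Longrightarrow> v \<in> ?T \<Longrightarrow> (\<lambda>c. r *\<^sub>R u c + v c) \<in> ?T"
    using T unfolding tsubspace_def by blast+
  let ?W = "(\<lambda>v. v c) ` ?T"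
  have "subspace ?W"
    unfolding subspace_def
  proof (intro conjI ballI allI)
    show "0 \<in> ?W" using zero by force
    fix p q assume "p \<in> ?W" "q \<in> ?W"
    then obtain u v where u: "u \<in> ?T" "p = u c" and v: "v \<in> ?T" "q = v c" by auto
    have "(\<lambda>c. 1 *\<^sub>R u c + v c) \<in> ?T" by (rule comb[OF u(1) v(1)])
    then show "p + q \<in> ?W" using u v by (intro image_eqI[of _ _ "\<lambda>c. 1 *\<^sub>R u c + v c"]) auto
  next
    fix p r assume "p \<in> ?W"
    then obtain u where u: "u \<in> ?T" "p = u c" by auto
    have "(\<lambda>c. r *\<^sub>R u c + 0) \<in> ?T" by (rule comb[OF u(1) zero])
    then show "r *\<^sub>R p \<in> ?W" using u by (intro image_eqI[of _ _ "\<lambda>c. r *\<^sub>R u c + 0"]) auto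
  qed
  then obtain B where B: "finite B" "B \<subseteq> ?W" "\<And>a. a \<in> ?W \<Longrightarrow> a = (\<Sum>b\<in>B. (a \<bullet> b) *\<^sub>R b)"
    using subspace_expansion by blast
  define lift where "lift b = (SOME v. v \<in> ?T \<and> v c = b)" for b
  have lift: "lift b \<in> ?T" "lift b c = b" if "b \<in> B" for b
    using someI_ex[of "\<lambda>v. v \<in> ?T \<and> v c = b"] that B(2) unfolding lift_def by auto
  define L where "L a = (\<Sum>b\<in>B. (a \<bullet> b) * \<phi> (lift b))" for a
  have "linear L"
    unfolding L_def by (rule linearI) (simp_all add: inner_add_left sum.distrib algebra_simps sum_distrib_left)
  moreover have "\<phi> v = L (v c)" if v: "v \<in> ?T" for v
  proof -
    have "v = (\<lambda>d. \<Sum>b\<in>B. (v c \<bullet> b) *\<^sub>R lift b d)"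
    proof (rule tangent_eqI[OF v _ c])
      show "(\<lambda>d. \<Sum>b\<in>B. (v c \<bullet> b) *\<^sub>R lift b d) \<in> ?T" by (rule tsubspace_sum[OF T B(1) lift(1)])
      show "v c = (\<Sum>b\<in>B. (v c \<bullet> b) *\<^sub>R lift b c)" using B(3)[of "v c"] v lift(2) by simp
    qed
    then have "\<phi> v = \<phi> (\<lambda>d. \<Sum>b\<in>B. (v c \<bullet> b) *\<^sub>R lift b d)" by simp
    also have "\<dots> = (\<Sum>b\<in>B. (v c \<bullet> b) *\<^sub>R \<phi> (lift b))"
      by (rule tlinear_sum[OF T _ B(1) lift(1)]) (simp add: \<phi>)
    finally show ?thesis by (simp add: L_def)
  qed
  ultimately show thesis using that by blast
qed

section \<open>The Hessian along a curve\<close>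

lemma at_within_nonneg_nontrivial:
  fixes t :: real assumes "t \<ge> 0" shows "at t within {0..} \<noteq> bot"
proof -
  have "t islimpt {t<..<t+1}" by (rule islimpt_greaterThanLessThan1) simp
  then have "t islimpt {0..}" by (rule islimpt_subset) (use assms in auto)
  then show ?thesis by (simp add: trivial_limit_within)
qed

lemma levi_civitaD:
  assumes lc: "levi_civita N met \<Gamma>" and c: "c \<in> atlas N" and p: "p \<in> snd c ` fst c"
    and a: "a \<in> model N" and b: "b \<in> model N"
  shows "\<Gamma> c p a b \<in> model N" "\<Gamma> c p a b = \<Gamma> c p b a"
    and "e \<in> model N \<Longrightarrow> \<Gamma> c p (r *\<^sub>R a + e) b = r *\<^sub>R \<Gamma> c p a b + \<Gamma> c p e b"
    and "smooth_on (model N) (snd c ` fst c) (\<lambda>u. \<Gamma> c u a b)"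
proof -
  note L = bspec[OF bspec[OF bspec[OF lc[unfolded levi_civita_def] c] a] b]
  note L1 = bspec[OF conjunct1[OF L] p]
  show "\<Gamma> c p a b \<in> model N" by (rule conjunct1[OF L1])
  show "\<Gamma> c p a b = \<Gamma> c p b a" by (rule conjunct1[OF conjunct2[OF L1]])
  show "\<Gamma> c p (r *\<^sub>R a + e) b = r *\<^sub>R \<Gamma> c p a b + \<Gamma> c p e b" if "e \<in> model N"
    by (rule spec[OF bspec[OF conjunct2[OF conjunct2[OF L1]] that]])
  show "smooth_on (model N) (snd c ` fst c) (\<lambda>u. \<Gamma> c u a b)" by (rule conjunct1[OF conjunct2[OF L]])
qed

locale manifold_curve =
  fixes N :: "('m, 'e::euclidean_space) manifold" and met and \<Gamma> :: "('m, 'e) christoffel"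
    and f :: "'m \<Rightarrow> real" and x :: "real \<Rightarrow> 'm" and v :: "real \<Rightarrow> ('m, 'e) tvec"
  assumes N: "smooth_manifold N" and lc: "levi_civita N met \<Gamma>" and f: "smooth_fun N f"
    and vel: "has_velocity N x v"
begin

abbreviation "E \<equiv> model N"
abbreviation "fc c \<equiv> f \<circ> chart_inv c"

lemmas E = smooth_manifoldD(1)[OF N]

lemma v_tangent: "t \<ge> 0 \<Longrightarrow> v t \<in> tangent N (x t)"
  using vel by (simp add: has_velocity_def)

text \<open>Chart domains are open and the curve is continuous, so near each time one chart serves
  for all computations.\<close>

lemma chart_neighbourhood:
  assumes t: "t \<ge> 0" and c: "c \<in> charts_at N (x t)"
  obtains S where "t \<in> S" "S \<subseteq> {0..}" "openin (top_of_set {0..}) S" "\<And>s. s \<in> S \<Longrightarrow> c \<in> charts_at N (x s)"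
proof -
  let ?S = "{s \<in> {0..}. x s \<in> fst c}"
  have "openin (top_of_set {0..}) ?S"
    using openin_continuous_map_preimage[of "top_of_set {0..}" "mtop N" x "fst c"]
      vel openin_mtop_chart[OF N charts_atD(1)[OF c]] by (simp add: has_velocity_def)
  moreover have "c \<in> charts_at N (x s)" if "s \<in> ?S" for s
    using that charts_atD(1)[OF c] by (simp add: charts_at_def)
  ultimately show thesis using t charts_atD(2)[OF c] by (intro that[of ?S]) auto
qed

lemma chart_curve_derivative:
  assumes "t \<ge> 0" "c \<in> charts_at N (x t)"
  shows "((\<lambda>s. snd c (x s)) has_vector_derivative v t c) (at t within {0..})"
  using vel assms by (simp add: has_velocity_def)

lemma chart_function_derivative:
  assumes t: "t \<ge> 0" and c: "c \<in> charts_at N (x t)"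
    and g: "g differentiable (at (snd c (x t)) within E)"
  shows "((\<lambda>s. g (snd c (x s))) has_vector_derivative dd E g (snd c (x t)) (v t c)) (at t within {0..})"
proof -
  obtain S where S: "t \<in> S" "S \<subseteq> {0..}" "openin (top_of_set {0..}) S" "\<And>s. s \<in> S \<Longrightarrow> c \<in> charts_at N (x s)"
    using chart_neighbourhood[OF t c] by blast
  note W = at_within_openin_eq[OF S(3,1)]
  have "((\<lambda>s. snd c (x s)) has_vector_derivative v t c) (at t within S)"
    unfolding W by (rule chart_curve_derivative[OF t c])
  moreover have "(\<lambda>s. snd c (x s)) ` S \<subseteq> E"
    using chart_range[OF N] charts_atD[OF S(4)] by blast
  then have "(g has_derivative dd E g (snd c (x t))) (at (snd c (x t)) within (\<lambda>s. snd c (x s)) ` S)"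
    by (rule has_derivative_subset[OF has_derivative_dd[OF g]])
  ultimately have "(g \<circ> (\<lambda>s. snd c (x s)) has_vector_derivative dd E g (snd c (x t)) (v t c)) (at t within S)"
    by (rule vector_derivative_diff_chain_within)
  then show ?thesis unfolding W by (simp add: o_def)
qed

lemma has_vector_derivative_local:
  assumes "(g has_vector_derivative D) (at t within {0..})" "openin (top_of_set {0..}) S" "t \<in> S"
    and "\<And>s. s \<in> S \<Longrightarrow> h s = g s"
  shows "(h has_vector_derivative D) (at t within {0..})"
proof -
  have "(g has_vector_derivative D) (at t within S)" by (simp only: at_within_openin_eq[OF assms(2,3)] assms(1))
  then have "(h has_vector_derivative D) (at t within S)"
    by (rule has_vector_derivative_transform[where f = g and g = h, rotated 2]) (use assms(3,4) in auto)
  then show ?thesis by (simp only: at_within_openin_eq[OF assms(2,3)])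
qed

lemma fc_smooth: "c \<in> charts_at N y \<Longrightarrow> smooth_on E (snd c ` fst c) (fc c)"
  by (rule smooth_fun_chart[OF f charts_atD(1)])

lemma coord_in: "c \<in> charts_at N y \<Longrightarrow> snd c y \<in> snd c ` fst c"
  by (rule imageI[OF charts_atD(2)])

lemma function_derivative:
  assumes t: "t \<ge> 0" and ne: "c \<in> charts_at N (x t)"
  shows "((\<lambda>s. f (x s)) has_vector_derivative dfun N f (x t) (v t)) (at t within {0..})"
proof -
  obtain S where S: "t \<in> S" "S \<subseteq> {0..}" "openin (top_of_set {0..}) S" "\<And>s. s \<in> S \<Longrightarrow> c \<in> charts_at N (x s)"
    using chart_neighbourhood[OF t ne] by blast
  have "((\<lambda>s. fc c (snd c (x s))) has_vector_derivative dd E (fc c) (snd c (x t)) (v t c)) (at t within {0..})"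
    by (rule chart_function_derivative[OF t ne smooth_on_differentiable[OF fc_smooth[OF ne] coord_in[OF ne]]])
  then have "((\<lambda>s. f (x s)) has_vector_derivative dd E (fc c) (snd c (x t)) (v t c)) (at t within {0..})"
    by (rule has_vector_derivative_local[OF _ S(3,1)]) (simp add: chart_inv_chart[OF N charts_atD[OF S(4)]])
  then show ?thesis by (simp only: dfun_chart[OF N f ne v_tangent[OF t]])
qed

text \<open>The formula of \<open>hessian\<close> with the chart as a parameter, so that it can be
  held fixed while the point moves.\<close>

definition chart_hessian :: "('m, 'e) chart \<Rightarrow> 'e \<Rightarrow> 'e \<Rightarrow> 'e \<Rightarrow> real" where
  "chart_hessian c p a b = dd E (\<lambda>q. dd E (fc c) q b) p a - dd E (fc c) p (\<Gamma> c p a b)"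

lemma hessian_eq_chart_hessian:
  "hessian N \<Gamma> f y u w = chart_hessian (some_chart N y) (snd (some_chart N y) y) (u (some_chart N y)) (w (some_chart N y))"
  by (simp add: hessian_def chart_hessian_def Let_def)

lemmas christoffel = levi_civitaD[OF lc]

text \<open>In the chart, df(V) is the sum of the components of \<open>V\<close> times partial
  derivatives of \<open>f\<close>. By the product rule, the partial derivatives contribute the
  second derivative of \<open>f\<close>, and the components contribute df(V') with V' = -
  \<Gamma>(v,V) by parallelism; together these are the Hessian in the chart.\<close>

lemma parallel_field_derivative_chart:
  assumes V: "has_covariant_derivative N \<Gamma> x v V (\<lambda>t c. 0)" and t: "t \<ge> 0" and c: "c \<in> charts_at N (x t)"
  shows "((\<lambda>s. dfun N f (x s) (V s)) has_vector_derivative chart_hessian c (snd c (x t)) (v t c) (V t c)) (at t within {0..})"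
proof -
  let ?p = "\<lambda>s. snd c (x s)"
  let ?U = "snd c ` fst c"
  have V_tan: "V s \<in> tangent N (x s)" if "s \<ge> 0" for s using V that by (simp add: has_covariant_derivative_def)
  obtain S where S: "t \<in> S" "S \<subseteq> {0..}" "openin (top_of_set {0..}) S" "\<And>s. s \<in> S \<Longrightarrow> c \<in> charts_at N (x s)"
    using chart_neighbourhood[OF t c] by blast
  obtain B where B: "finite B" "B \<subseteq> E" "\<And>a. a \<in> E \<Longrightarrow> a = (\<Sum>b\<in>B. (a \<bullet> b) *\<^sub>R b)"
    using subspace_expansion[OF E] by blast
  note U_open = smooth_manifoldD(3)[OF N charts_atD(1)[OF c]]
  note diff = smooth_on_differentiable[OF fc_smooth[OF c]]
  have expand: "dd E (fc c) q a = (\<Sum>b\<in>B. (a \<bullet> b) * dd E (fc c) q b)" if "q \<in> ?U" "a \<in> E" for q a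
  proof -
    have "dd E (fc c) q a = dd E (fc c) q (\<Sum>b\<in>B. (a \<bullet> b) *\<^sub>R b)" using B(3)[OF that(2)] by simp
    also have "\<dots> = (\<Sum>b\<in>B. (a \<bullet> b) * dd E (fc c) q b)"
      using linear_dd[OF diff[OF that(1)]] by (simp add: linear_sum linear_scale)
    finally show ?thesis .
  qed
  define V' where "V' = 0 - \<Gamma> c (?p t) (v t c) (V t c)"
  have V_der: "((\<lambda>s. V s c) has_vector_derivative V') (at t within {0..})"
    using V t c by (simp add: has_covariant_derivative_def V'_def)
  have vE: "v t c \<in> E" and VE: "V t c \<in> E" using tangentD(1)[OF v_tangent[OF t] c] tangentD(1)[OF V_tan[OF t] c] by auto
  have pU: "?p t \<in> ?U" by (rule coord_in[OF c])
  have pE: "?p t \<in> E" by (rule chart_range[OF N charts_atD[OF c]])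
  have \<Gamma>E: "\<Gamma> c (?p t) (v t c) (V t c) \<in> E" by (rule christoffel(1)[OF charts_atD(1)[OF c] pU vE VE])
  then have V'E: "V' \<in> E" unfolding V'_def by (intro subspace_diff E subspace_0)
  have db: "(\<lambda>q. dd E (fc c) q b) differentiable (at (?p t) within E)" if "b \<in> B" for b
    by (rule smooth_on_differentiable[OF smooth_on_dd[OF fc_smooth[OF c]] pU]) (use that B(2) in blast)
  have "((\<lambda>s. \<Sum>b\<in>B. (V s c \<bullet> b) * dd E (fc c) (?p s) b) has_vector_derivative
      (\<Sum>b\<in>B. (V t c \<bullet> b) * dd E (\<lambda>q. dd E (fc c) q b) (?p t) (v t c) + (V' \<bullet> b) * dd E (fc c) (?p t) b)) (at t within {0..})"
  proof (rule has_vector_derivative_sum)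
    fix b assume b: "b \<in> B"
    have "((\<lambda>s. V s c \<bullet> b) has_vector_derivative V' \<bullet> b) (at t within {0..})"
      by (rule bounded_linear.has_vector_derivative[OF bounded_linear_inner_left V_der])
    then show "((\<lambda>s. (V s c \<bullet> b) * dd E (fc c) (?p s) b) has_vector_derivative
        (V t c \<bullet> b) * dd E (\<lambda>q. dd E (fc c) q b) (?p t) (v t c) + (V' \<bullet> b) * dd E (fc c) (?p t) b) (at t within {0..})"
      by (rule has_vector_derivative_mult[OF _ chart_function_derivative[OF t c db[OF b]]])
  qed
  then have "((\<lambda>s. dfun N f (x s) (V s)) has_vector_derivative
      (\<Sum>b\<in>B. (V t c \<bullet> b) * dd E (\<lambda>q. dd E (fc c) q b) (?p t) (v t c) + (V' \<bullet> b) * dd E (fc c) (?p t) b)) (at t within {0..})"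
  proof (rule has_vector_derivative_local[OF _ S(3,1)])
    fix s assume s: "s \<in> S"
    then have s0: "s \<ge> 0" using S(2) by auto
    have "dfun N f (x s) (V s) = dd E (fc c) (?p s) (V s c)"
      by (rule dfun_chart[OF N f S(4)[OF s] V_tan[OF s0]])
    then show "dfun N f (x s) (V s) = (\<Sum>b\<in>B. (V s c \<bullet> b) * dd E (fc c) (?p s) b)"
      using expand[OF coord_in[OF S(4)[OF s]] tangentD(1)[OF V_tan[OF s0] S(4)[OF s]]] by simp
  qed
  \<comment> \<open>On the right the vector is frozen at its value at time \<open>t\<close> and only
    the base point \<open>q\<close> varies, as in \<open>chart_hessian\<close>.\<close>
  moreover have "(\<Sum>b\<in>B. (V t c \<bullet> b) * dd E (\<lambda>q. dd E (fc c) q b) (?p t) (v t c)) = dd E (\<lambda>q. dd E (fc c) q (V t c)) (?p t) (v t c)"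
  proof -
    have "((\<lambda>q. \<Sum>b\<in>B. (V t c \<bullet> b) * dd E (fc c) q b) has_derivative
        (\<lambda>a. \<Sum>b\<in>B. (V t c \<bullet> b) * dd E (\<lambda>q. dd E (fc c) q b) (?p t) a)) (at (?p t) within E)"
      by (intro has_derivative_sum has_derivative_mult_right has_derivative_dd db)
    then have "((\<lambda>q. dd E (fc c) q (V t c)) has_derivative
        (\<lambda>a. \<Sum>b\<in>B. (V t c \<bullet> b) * dd E (\<lambda>q. dd E (fc c) q b) (?p t) a)) (at (?p t) within E)"
      by (rule has_derivative_openin_cong[OF _ U_open pU]) (use expand VE in blast)
    from dd_eqI[OF E pE vE this] show ?thesis by simp
  qed
  moreover have "(\<Sum>b\<in>B. (V' \<bullet> b) * dd E (fc c) (?p t) b) = - dd E (fc c) (?p t) (\<Gamma> c (?p t) (v t c) (V t c))"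
    using expand[OF pU V'E] linear_dd[OF diff[OF pU]] by (simp add: V'_def linear_neg)
  ultimately show ?thesis by (simp add: chart_hessian_def sum.distrib)
qed

lemma parallel_field_derivative:
  assumes V: "has_covariant_derivative N \<Gamma> x v V (\<lambda>t c. 0)" and t: "t \<ge> 0" and c: "c \<in> charts_at N (x t)"
  shows "((\<lambda>s. dfun N f (x s) (V s)) has_vector_derivative hessian N \<Gamma> f (x t) (v t) (V t)) (at t within {0..})"
  unfolding hessian_eq_chart_hessian
  by (rule parallel_field_derivative_chart[OF V t some_chart_in[OF c]])

text \<open>Both sides are derivatives of the same function, so the transformation law of the Christoffel
  symbols is not needed.\<close>

lemma hessian_chart_independent:
  assumes V: "has_covariant_derivative N \<Gamma> x v V (\<lambda>t c. 0)" and t: "t \<ge> 0" and c: "c \<in> charts_at N (x t)"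
  shows "hessian N \<Gamma> f (x t) (v t) (V t) = chart_hessian c (snd c (x t)) (v t c) (V t c)"
  by (rule vector_derivative_unique_within[OF at_within_nonneg_nontrivial[OF t]
        parallel_field_derivative[OF assms] parallel_field_derivative_chart[OF assms]])

text \<open>Near \<open>t\<close> the Hessian is rewritten in one chart \<open>c\<close>, and all
  arguments are expanded over the finite family \<open>B\<close>. What remains (\<open>rhs\<close>)
  combines the continuous components of \<open>v\<close> and \<open>V\<close> with smooth functions
  of the point in fixed directions.\<close>

lemma hessian_continuous:
  assumes V: "has_covariant_derivative N \<Gamma> x v V (\<lambda>t c. 0)" and ne: "\<And>t. t \<ge> 0 \<Longrightarrow> x t \<in> points N"
    and v_cont: "\<And>t c. t \<ge> 0 \<Longrightarrow> c \<in> charts_at N (x t) \<Longrightarrow> continuous (at t within {0..}) (\<lambda>s. v s c)"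
  shows "continuous_on {0..} (\<lambda>t. hessian N \<Gamma> f (x t) (v t) (V t))"
  unfolding continuous_on_eq_continuous_within
proof
  fix t :: real assume "t \<in> {0..}"
  then have t: "t \<ge> 0" by simp
  obtain c where c: "c \<in> charts_at N (x t)" using ne[OF t] by (auto simp: points_def charts_at_def)
  let ?p = "\<lambda>s. snd c (x s)"
  let ?U = "snd c ` fst c"
  have V_tan: "V s \<in> tangent N (x s)" if "s \<ge> 0" for s using V that by (simp add: has_covariant_derivative_def)
  obtain S where S: "t \<in> S" "S \<subseteq> {0..}" "openin (top_of_set {0..}) S" "\<And>s. s \<in> S \<Longrightarrow> c \<in> charts_at N (x s)"
    using chart_neighbourhood[OF t c] by blast
  have S0: "s \<ge> 0" if "s \<in> S" for s using S(2) that by auto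
  obtain B where B: "finite B" "B \<subseteq> E" "\<And>a. a \<in> E \<Longrightarrow> a = (\<Sum>b\<in>B. (a \<bullet> b) *\<^sub>R b)"
    using subspace_expansion[OF E] by blast
  have cont_S: "continuous_on S g" if "\<And>s. s \<in> S \<Longrightarrow> continuous (at s within {0..}) g" for g :: "real \<Rightarrow> 'z::topological_space"
    unfolding continuous_on_eq_continuous_within using that at_within_openin_eq[OF S(3)] by simp
  have p_cont: "continuous_on S ?p"
    by (rule cont_S) (use chart_curve_derivative[OF S0 S(4)] has_vector_derivative_continuous in blast)
  have V_cont: "continuous_on S (\<lambda>s. V s c)"
  proof (rule cont_S)
    fix s assume s: "s \<in> S"
    have "((\<lambda>s. V s c) has_vector_derivative (0 - \<Gamma> c (snd c (x s)) (v s c) (V s c))) (at s within {0..})"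
      using V S0[OF s] S(4)[OF s] unfolding has_covariant_derivative_def by blast
    then show "continuous (at s within {0..}) (\<lambda>s. V s c)" by (rule has_vector_derivative_continuous)
  qed
  have vS_cont: "continuous_on S (\<lambda>s. v s c)"
    by (rule cont_S) (rule v_cont[OF S0 S(4)])
  have pS: "?p ` S \<subseteq> ?U" using coord_in[OF S(4)] by blast
  have comp: "continuous_on S (\<lambda>s. g (?p s))" if "smooth_on E ?U g" for g :: "'e \<Rightarrow> 'z::real_normed_vector"
    by (rule continuous_on_compose2[OF smooth_on_continuous[OF that] p_cont pS])
  have BE: "b \<in> E" if "b \<in> B" for b using that B(2) by blast
  note ca = charts_atD(1)[OF c]
  define rhs where "rhs s = (\<Sum>b\<in>B. (V s c \<bullet> b) * (\<Sum>b'\<in>B. (v s c \<bullet> b') *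
      (dd E (\<lambda>q. dd E (fc c) q b) (?p s) b' - (\<Sum>e\<in>B. (\<Gamma> c (?p s) b' b \<bullet> e) * dd E (fc c) (?p s) e))))" for s
  have "hessian N \<Gamma> f (x s) (v s) (V s) = rhs s" if s: "s \<in> S" for s
  proof -
    note cs = S(4)[OF s]
    have pU: "?p s \<in> ?U" by (rule coord_in[OF cs])
    have pE: "?p s \<in> E" by (rule chart_range[OF N charts_atD[OF cs]])
    have vE: "v s c \<in> E" and VE: "V s c \<in> E"
      using tangentD(1)[OF v_tangent[OF S0[OF s]] cs] tangentD(1)[OF V_tan[OF S0[OF s]] cs] by auto
    have lin: "linear (dd E (fc c) q)" if "q \<in> ?U" for q
      by (rule linear_dd[OF smooth_on_differentiable[OF fc_smooth[OF c] that]])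
    have db: "(\<lambda>q. dd E (fc c) q b) differentiable (at (?p s) within E)" if "b \<in> B" for b
      by (rule smooth_on_differentiable[OF smooth_on_dd[OF fc_smooth[OF c] BE[OF that]] pU])
    have lin2: "linear (dd E (\<lambda>q. dd E (fc c) q b) (?p s))" if "b \<in> B" for b
      by (rule linear_dd[OF db[OF that]])
    have exp: "L a = (\<Sum>b\<in>B. (a \<bullet> b) * L b)" if "linear L" "a \<in> E" for L :: "'e \<Rightarrow> real" and a
    proof -
      have "L a = L (\<Sum>b\<in>B. (a \<bullet> b) *\<^sub>R b)" using B(3)[OF that(2)] by simp
      then show ?thesis using that(1) by (simp add: linear_sum linear_scale)
    qed
    have "((\<lambda>q. \<Sum>b\<in>B. (V s c \<bullet> b) * dd E (fc c) q b) has_derivative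
        (\<lambda>a. \<Sum>b\<in>B. (V s c \<bullet> b) * dd E (\<lambda>q. dd E (fc c) q b) (?p s) a)) (at (?p s) within E)"
      by (intro has_derivative_sum has_derivative_mult_right has_derivative_dd db)
    then have "((\<lambda>q. dd E (fc c) q (V s c)) has_derivative
        (\<lambda>a. \<Sum>b\<in>B. (V s c \<bullet> b) * dd E (\<lambda>q. dd E (fc c) q b) (?p s) a)) (at (?p s) within E)"
      by (rule has_derivative_openin_cong[OF _ smooth_manifoldD(3)[OF N ca] pU]) (use exp lin VE in blast)
    then have "dd E (\<lambda>q. dd E (fc c) q (V s c)) (?p s) (v s c) = (\<Sum>b\<in>B. (V s c \<bullet> b) * dd E (\<lambda>q. dd E (fc c) q b) (?p s) (v s c))"
      by (rule dd_eqI[OF E pE vE])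
    also have "\<dots> = (\<Sum>b\<in>B. (V s c \<bullet> b) * (\<Sum>b'\<in>B. (v s c \<bullet> b') * dd E (\<lambda>q. dd E (fc c) q b) (?p s) b'))"
      by (intro sum.cong refl arg_cong2[where f = times] exp lin2 vE)
    finally have 1: "dd E (\<lambda>q. dd E (fc c) q (V s c)) (?p s) (v s c)
      = (\<Sum>b\<in>B. (V s c \<bullet> b) * (\<Sum>b'\<in>B. (v s c \<bullet> b') * dd E (\<lambda>q. dd E (fc c) q b) (?p s) b'))" .
    let ?\<Gamma> = "\<Gamma> c (?p s)"
    have lin\<Gamma>: "?\<Gamma> a b = (\<Sum>b'\<in>B. (a \<bullet> b') *\<^sub>R ?\<Gamma> b' b)" if "a \<in> E" "b \<in> E" for a b
    proof -
      have "?\<Gamma> (\<Sum>b'\<in>B. (a \<bullet> b') *\<^sub>R b') b = (\<Sum>b'\<in>B. (a \<bullet> b') *\<^sub>R ?\<Gamma> b' b)"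
        by (rule linear_on_subspace_sum[OF E, of "\<lambda>a. ?\<Gamma> a b"])
          (use christoffel(3)[OF ca pU] that(2) B(1) BE in auto)
      then show ?thesis using B(3)[OF that(1)] by simp
    qed
    \<comment> \<open>Linearity of the Christoffel symbols is given in the first argument; symmetry
      carries it to the second.\<close>
    have "?\<Gamma> (v s c) (V s c) = ?\<Gamma> (V s c) (v s c)" by (rule christoffel(2)[OF ca pU vE VE])
    also have "\<dots> = (\<Sum>b\<in>B. (V s c \<bullet> b) *\<^sub>R ?\<Gamma> b (v s c))" by (rule lin\<Gamma>[OF VE vE])
    also have "\<dots> = (\<Sum>b\<in>B. (V s c \<bullet> b) *\<^sub>R (\<Sum>b'\<in>B. (v s c \<bullet> b') *\<^sub>R ?\<Gamma> b' b))"
      using christoffel(2)[OF ca pU BE vE] lin\<Gamma>[OF vE BE] by simp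
    finally have "dd E (fc c) (?p s) (?\<Gamma> (v s c) (V s c))
       = (\<Sum>b\<in>B. (V s c \<bullet> b) * (\<Sum>b'\<in>B. (v s c \<bullet> b') * dd E (fc c) (?p s) (?\<Gamma> b' b)))"
      by (simp add: linear_sum[OF lin[OF pU]] linear_scale[OF lin[OF pU]])
    also have "\<dots> = (\<Sum>b\<in>B. (V s c \<bullet> b) * (\<Sum>b'\<in>B. (v s c \<bullet> b') * (\<Sum>e\<in>B. (?\<Gamma> b' b \<bullet> e) * dd E (fc c) (?p s) e)))"
      by (intro sum.cong refl arg_cong2[where f = times] exp lin pU christoffel(1)[OF ca pU] BE)
    finally show ?thesis
      unfolding hessian_chart_independent[OF V S0[OF s] cs] chart_hessian_def 1 rhs_def
      by (simp add: sum_subtractf right_diff_distrib)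
  qed
  moreover have "continuous_on S rhs"
    unfolding rhs_def
    by (intro continuous_intros V_cont vS_cont comp)
      (assumption | rule smooth_on_dd fc_smooth[OF c] BE christoffel(4)[OF ca coord_in[OF c]])+
  ultimately have "continuous_on S (\<lambda>t. hessian N \<Gamma> f (x t) (v t) (V t))" by simp
  then have "continuous (at t within S) (\<lambda>t. hessian N \<Gamma> f (x t) (v t) (V t))"
    using S(1) by (simp add: continuous_on_eq_continuous_within)
  then show "continuous (at t within {0..}) (\<lambda>t. hessian N \<Gamma> f (x t) (v t) (V t))"
    by (simp only: at_within_openin_eq[OF S(3,1)])
qed

lemma hessian_scale:
  assumes y: "y \<in> points N" and u: "u \<in> tangent N y" and w: "w \<in> tangent N y"
  shows "hessian N \<Gamma> f y (\<lambda>c. r *\<^sub>R u c) w = r * hessian N \<Gamma> f y u w"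
proof -
  obtain c0 where "c0 \<in> charts_at N y" using y by (auto simp: points_def charts_at_def)
  then have c: "some_chart N y \<in> charts_at N y" by (rule some_chart_in)
  define c where "c = some_chart N y"
  note c = c[folded c_def]
  note ca = charts_atD(1)[OF c] and pU = coord_in[OF c]
  have uE: "u c \<in> E" and wE: "w c \<in> E" using tangentD(1)[OF u c] tangentD(1)[OF w c] by auto
  have zE: "0 \<in> E" by (rule subspace_0[OF E])
  have "\<Gamma> c (snd c y) 0 (w c) = 0" using christoffel(3)[OF ca pU zE wE zE, of 1] by simp
  then have \<Gamma>: "\<Gamma> c (snd c y) (r *\<^sub>R u c) (w c) = r *\<^sub>R \<Gamma> c (snd c y) (u c) (w c)"
    using christoffel(3)[OF ca pU uE wE zE, of r] by simp
  have l1: "linear (dd E (fc c) (snd c y))"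
    by (rule linear_dd[OF smooth_on_differentiable[OF fc_smooth[OF c] pU]])
  have l2: "linear (dd E (\<lambda>q. dd E (fc c) q (w c)) (snd c y))"
    by (rule linear_dd[OF smooth_on_differentiable[OF smooth_on_dd[OF fc_smooth[OF c] wE] pU]])
  show ?thesis
    unfolding hessian_eq_chart_hessian c_def[symmetric] chart_hessian_def \<Gamma>
    by (simp add: linear_scale[OF l1] linear_scale[OF l2] right_diff_distrib)
qed

end

section \<open>The hypoelliptic diffusion\<close>

text \<open>The integrating factor is applied to \<open>g - C\<close>, where \<open>C\<close> is the
  constant part of the right-hand side; the derivative of \<open>k\<close> is then exactly the
  kernel times \<open>A\<close>. The fundamental theorem of calculus yields the integrability of
  this product along with its integral, and g(0) - C = - \<kappa> g'(0) gives the boundary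
  term.\<close>

lemma first_order_ode_solution:
  fixes g g' A :: "real \<Rightarrow> real"
  assumes g: "\<And>s. s \<ge> 0 \<Longrightarrow> (g has_vector_derivative g' s) (at s within {0..})" and \<kappa>: "\<kappa> > 0"
    and ode: "\<And>s. s \<ge> 0 \<Longrightarrow> \<kappa> * g' s + g s = \<kappa> * g' 0 + g 0 + A s" and t: "t \<ge> 0"
  shows "g t = g 0 + \<kappa> * g' 0 * (1 - exp (- t / \<kappa>)) + integral {0..t} (\<lambda>s. exp (- (t - s) / \<kappa>) / \<kappa> * A s)"
proof -
  define C where "C = \<kappa> * g' 0 + g 0"
  define k where "k s = exp (- (t - s) / \<kappa>) * (g s - C)" for s
  have "((\<lambda>s. exp (- (t - s) / \<kappa>) / \<kappa> * A s) has_integral (k t - k 0)) {0..t}"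
  proof (rule fundamental_theorem_of_calculus[OF t])
    fix s assume s: "s \<in> {0..t}"
    have "(g has_vector_derivative g' s) (at s within {0..t})"
      by (rule has_vector_derivative_within_subset[OF g]) (use s in auto)
    then have g_der: "(g has_real_derivative g' s) (at s within {0..t})"
      by (simp add: has_real_derivative_iff_has_vector_derivative)
    have A: "A s = \<kappa> * g' s + (g s - C)" using ode[of s] s by (simp add: C_def)
    have "(k has_real_derivative exp (- (t - s) / \<kappa>) / \<kappa> * A s) (at s within {0..t})"
      unfolding k_def[abs_def] A using \<kappa>
      by (auto intro!: derivative_eq_intros g_der simp: field_simps)
    then show "(k has_vector_derivative exp (- (t - s) / \<kappa>) / \<kappa> * A s) (at s within {0..t})"
      by (simp add: has_real_derivative_iff_has_vector_derivative)
  qed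
  from integral_unique[OF this] show ?thesis by (simp add: k_def C_def algebra_simps)
qed

text \<open>Measurability, continuity and independence of \<open>w\<close> are stated for chart
  components. The inner product with \<open>e\<close> is a linear, hence Borel, function of one such
  component, so its increments generate no events beyond those of the increments of the component.
  The normal law is given for the inner product directly.\<close>

lemma brownian_motion_component:
  fixes N :: "('m, 'e::euclidean_space) manifold"
  assumes N: "smooth_manifold N" and z: "z \<in> points N" and met: "bilinear_form_on (tangent N z) (met z)"
    and P: "filtered_prob_space P F" and w: "brownian_motion P F N met z w"
    and e: "e \<in> tangent N z" "met z e e = 1"
  shows "scalar_brownian_motion P F (\<lambda>t \<omega>. met z (w t \<omega>) e)"
proof -
  obtain c where c: "c \<in> charts_at N z" using z by (auto simp: points_def charts_at_def)
  have bil: "met z (\<lambda>c. r *\<^sub>R u c + v c) e = r * met z u e + met z v e" if "u \<in> tangent N z" "v \<in> tangent N z" for u v r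
    using met that e(1) unfolding bilinear_form_on_def by blast
  obtain L where L: "linear L" "\<And>v. v \<in> tangent N z \<Longrightarrow> met z v e = L (v c)"
    using tangent_form_in_chart[where \<phi> = "\<lambda>v. met z v e", OF N c bil] by blast
  have L_cont: "continuous_on UNIV L" by (rule linear_continuous_on[OF linear_conv_bounded_linear[THEN iffD1, OF L(1)]])
  have L_meas: "L \<in> borel_measurable borel" by (rule borel_measurable_continuous_onI[OF L_cont])
  interpret prob_space P using P by (simp add: filtered_prob_space_def)
  have sp: "space (F t) = space P" for t using P by (auto simp: filtered_prob_space_def filtration_def)
  have w_tan: "w t \<omega> \<in> tangent N z" if "t \<ge> 0" "\<omega> \<in> space P" for t \<omega>
    using w that by (simp add: brownian_motion_def)
  note w' = w[unfolded brownian_motion_def]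
  have w_meas: "(\<lambda>\<omega>. w t \<omega> c) \<in> borel_measurable (F t)" if "t \<ge> 0" for t
    by (rule w'[THEN conjunct2, THEN conjunct1, rule_format, OF that])
  have w_cont: "AE \<omega> in P. \<forall>c. continuous_on {0..} (\<lambda>t. w t \<omega> c)"
    by (rule w'[THEN conjunct2, THEN conjunct2, THEN conjunct2, THEN conjunct1])
  have w_inc: "indep_set (sets (F s)) {(\<lambda>\<omega>. w t \<omega> c - w s \<omega> c) -` S \<inter> space P | S. S \<in> sets borel}"
    "distributed P lborel (\<lambda>\<omega>. met z (\<lambda>c. w t \<omega> c - w s \<omega> c) e) (normal_density 0 (sqrt (t - s)))"
    if "0 \<le> s" "s < t" for s t
    using w that c e unfolding brownian_motion_def by blast+
  have diff: "met z (w t \<omega>) e - met z (w s \<omega>) e = L (w t \<omega> c - w s \<omega> c)" if "0 \<le> s" "0 \<le> t" "\<omega> \<in> space P" for s t \<omega>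
    using L(2)[OF w_tan[OF that(1,3)]] L(2)[OF w_tan[OF that(2,3)]] by (simp add: linear_diff[OF L(1)])
  show ?thesis
  proof
    show "filtered_prob_space P F" by (rule P)
    fix t :: real assume t: "t \<ge> 0"
    have "(\<lambda>\<omega>. L (w t \<omega> c)) \<in> borel_measurable (F t)" by (rule measurable_compose[OF w_meas[OF t] L_meas])
    then show "(\<lambda>\<omega>. met z (w t \<omega>) e) \<in> borel_measurable (F t)"
      by (rule measurable_cong[THEN iffD1, rotated]) (use L(2)[OF w_tan[OF t]] sp in simp)
  next
    show "AE \<omega> in P. continuous_on {0..} (\<lambda>t. met z (w t \<omega>) e)"
      using w_cont AE_space
    proof eventually_elim
      case (elim \<omega>)
      have "continuous_on {0..} (\<lambda>t. L (w t \<omega> c))"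
        by (rule continuous_on_compose2[OF L_cont elim(1)[THEN spec[of _ c]]]) simp
      then show ?case
        by (rule continuous_on_cong[THEN iffD1, rotated 2]) (use L(2)[OF w_tan] elim(2) in auto)
    qed
  next
    fix s t :: real assume st: "0 \<le> s" "s < t"
    have sub: "{(\<lambda>\<omega>. met z (w t \<omega>) e - met z (w s \<omega>) e) -` S \<inter> space P | S. S \<in> sets borel}
      \<subseteq> {(\<lambda>\<omega>. w t \<omega> c - w s \<omega> c) -` S \<inter> space P | S. S \<in> sets borel}"
    proof clarify
      fix S :: "real set" assume "S \<in> sets borel"
      then have "L -` S \<in> sets borel" using measurable_sets[OF L_meas] by simp
      moreover have "(\<lambda>\<omega>. met z (w t \<omega>) e - met z (w s \<omega>) e) -` S \<inter> space P = (\<lambda>\<omega>. w t \<omega> c - w s \<omega> c) -` (L -` S) \<inter> space P"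
        using diff[of s t] st by auto
      ultimately show "\<exists>S'. (\<lambda>\<omega>. met z (w t \<omega>) e - met z (w s \<omega>) e) -` S \<inter> space P
          = (\<lambda>\<omega>. w t \<omega> c - w s \<omega> c) -` S' \<inter> space P \<and> S' \<in> sets borel" by blast
    qed
    show "indep_set (sets (F s)) {(\<lambda>\<omega>. met z (w t \<omega>) e - met z (w s \<omega>) e) -` S \<inter> space P | S. S \<in> sets borel}"
      using w_inc(1)[OF st] unfolding indep_set_def
      by (rule indep_sets_mono_sets) (use sub in \<open>auto split: bool.split\<close>)
    have inc: "met z (\<lambda>c. w t \<omega> c - w s \<omega> c) e = met z (w t \<omega>) e - met z (w s \<omega>) e" if "\<omega> \<in> space P" for \<omega>
      using bil[OF w_tan[OF st(1) that] w_tan[of t, OF _ that], of "-1"] st by simp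
    show "distributed P lborel (\<lambda>\<omega>. met z (w t \<omega>) e - met z (w s \<omega>) e) (normal_density 0 (sqrt (t - s)))"
      using w_inc(2)[OF st] unfolding distributed_def
      by (simp add: inc cong: distr_cong measurable_cong)
  qed
qed

text \<open>One trajectory, with the sample point fixed and no probability left. \<open>y\<close> is
  \<open>Y\<close> transported back to the starting point, and \<open>ip\<close> will be the metric
  there.\<close>

locale diffusion_path =
  fixes N :: "('m, 'e::euclidean_space) manifold" and met and \<Gamma> :: "('m, 'e) christoffel"
    and f :: "'m \<Rightarrow> real" and x :: "real \<Rightarrow> 'm" and Y :: "real \<Rightarrow> ('m, 'e) tvec" and b :: real
    and \<tau> :: "real \<Rightarrow> ('m, 'e) tvec \<Rightarrow> ('m, 'e) tvec" and y :: "real \<Rightarrow> ('m, 'e) tvec"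
    and ip :: "('m, 'e) tvec \<Rightarrow> ('m, 'e) tvec \<Rightarrow> real" and U :: "('m, 'e) tvec set"
  assumes smooth: "smooth_manifold N" and levi_civita: "levi_civita N met \<Gamma>" and smooth_f: "smooth_fun N f"
    and velocity: "has_velocity N x (\<lambda>t c. Y t c /\<^sub>R b)"
    and transport: "parallel_transport N \<Gamma> x (\<lambda>t c. Y t c /\<^sub>R b) \<tau>"
    and x_points: "\<And>t. t \<ge> 0 \<Longrightarrow> x t \<in> points N"
    and Y_tangent: "\<And>t. t \<ge> 0 \<Longrightarrow> Y t \<in> tangent N (x t)"
    and y_tangent: "\<And>t. t \<ge> 0 \<Longrightarrow> y t \<in> tangent N (x 0)"
    and Y_eq: "\<And>t. t \<ge> 0 \<Longrightarrow> Y t = \<tau> t (y t)"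
    and b_pos: "b > 0"
    and basis: "orthonormal_basis (tangent N (x 0)) ip U"
    and y_cont: "\<And>e. e \<in> U \<Longrightarrow> continuous_on {0..} (\<lambda>t. ip (y t) e)"

sublocale diffusion_path \<subseteq> manifold_curve N met \<Gamma> f x "\<lambda>t c. Y t c /\<^sub>R b"
  by unfold_locales (rule smooth levi_civita smooth_f velocity)+

context diffusion_path
begin

definition \<alpha> :: "('m, 'e) tvec \<Rightarrow> real \<Rightarrow> real" where
  "\<alpha> u t = dfun N f (x t) (\<tau> t u)"

definition \<alpha>' :: "('m, 'e) tvec \<Rightarrow> real \<Rightarrow> real" where
  "\<alpha>' u t = hessian N \<Gamma> f (x t) (\<lambda>c. Y t c /\<^sub>R b) (\<tau> t u)"

definition g' :: "real \<Rightarrow> real" where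
  "g' t = dfun N f (x t) (\<lambda>c. Y t c /\<^sub>R b)"

lemma U: "finite U" "e \<in> U \<Longrightarrow> e \<in> tangent N (x 0)"
  "u \<in> tangent N (x 0) \<Longrightarrow> u = (\<lambda>c. \<Sum>e\<in>U. ip u e *\<^sub>R e c)"
  using basis unfolding orthonormal_basis_def by blast+

lemma chart_ex: "t \<ge> 0 \<Longrightarrow> \<exists>c. c \<in> charts_at N (x t)"
  using x_points[of t] by (auto simp: points_def charts_at_def)

lemma parallel: "u \<in> tangent N (x 0) \<Longrightarrow> has_covariant_derivative N \<Gamma> x (\<lambda>t c. Y t c /\<^sub>R b) (\<lambda>t. \<tau> t u) (\<lambda>t c. 0)"
  using transport by (simp add: parallel_transport_def)

lemma \<tau>_tangent: "u \<in> tangent N (x 0) \<Longrightarrow> t \<ge> 0 \<Longrightarrow> \<tau> t u \<in> tangent N (x t)"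
  using parallel by (simp add: has_covariant_derivative_def)

lemma \<tau>_expansion:
  assumes t: "t \<ge> 0" and u: "u \<in> tangent N (x 0)"
  shows "\<tau> t u = (\<lambda>c. \<Sum>e\<in>U. ip u e *\<^sub>R \<tau> t e c)"
proof
  fix c
  have "\<tau> t u c = \<tau> t (\<lambda>c. \<Sum>e\<in>U. ip u e *\<^sub>R e c) c" using U(3)[OF u] by simp
  also have "\<dots> = (\<Sum>e\<in>U. ip u e *\<^sub>R \<tau> t e c)"
  proof (rule tlinear_sum[OF tsubspace_tangent[OF smooth] _ U(1), of "x 0" "\<lambda>u. \<tau> t u c" "\<lambda>e. e"])
    show "\<tau> t (\<lambda>c. r *\<^sub>R u c + v c) c = r *\<^sub>R \<tau> t u c + \<tau> t v c" if "u \<in> tangent N (x 0)" "v \<in> tangent N (x 0)" for u v r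
      using transport t that by (simp add: parallel_transport_def)
  qed (rule U(2))
  finally show "\<tau> t u c = (\<Sum>e\<in>U. ip u e *\<^sub>R \<tau> t e c)" .
qed

lemma \<alpha>_expansion:
  assumes t: "t \<ge> 0" and u: "u \<in> tangent N (x 0)"
  shows "\<alpha> u t = (\<Sum>e\<in>U. ip u e * \<alpha> e t)"
proof -
  have "dfun N f (x t) (\<lambda>c. \<Sum>e\<in>U. ip u e *\<^sub>R \<tau> t e c) = (\<Sum>e\<in>U. ip u e *\<^sub>R dfun N f (x t) (\<tau> t e))"
    by (rule tlinear_sum[OF tsubspace_tangent[OF smooth] _ U(1) \<tau>_tangent[OF U(2) t]])
      (simp add: dfun_linear[OF smooth smooth_f x_points[OF t]])
  then show ?thesis unfolding \<alpha>_def \<tau>_expansion[OF t u] by simp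
qed

text \<open>\<open>has_velocity\<close> does not say that the velocity is continuous. Continuity
  comes from Y = \<tau> y: expanded in the basis, \<open>Y\<close> has continuous coefficients in
  front of parallel, hence differentiable, fields.\<close>

lemma Y_continuous:
  assumes t: "t \<ge> 0" and c: "c \<in> charts_at N (x t)"
  shows "continuous (at t within {0..}) (\<lambda>s. Y s c)"
proof -
  have "continuous (at t within {0..}) (\<lambda>s. \<Sum>e\<in>U. ip (y s) e *\<^sub>R \<tau> s e c)"
  proof (intro continuous_sum continuous_scaleR)
    fix e assume e: "e \<in> U"
    show "continuous (at t within {0..}) (\<lambda>s. ip (y s) e)"
      using y_cont[OF e] t by (simp add: continuous_on_eq_continuous_within)
    have "((\<lambda>s. \<tau> s e c) has_vector_derivative 0 - \<Gamma> c (snd c (x t)) (Y t c /\<^sub>R b) (\<tau> t e c)) (at t within {0..})"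
      using parallel[OF U(2)[OF e]] t c unfolding has_covariant_derivative_def by blast
    then show "continuous (at t within {0..}) (\<lambda>s. \<tau> s e c)" by (rule has_vector_derivative_continuous)
  qed
  then show ?thesis
    by (rule continuous_transform_within[where \<delta> = 1]) (use t in \<open>simp_all add: Y_eq \<tau>_expansion[OF _ y_tangent]\<close>)
qed

lemma \<alpha>_C1:
  assumes u: "u \<in> tangent N (x 0)"
  shows "t \<ge> 0 \<Longrightarrow> (\<alpha> u has_vector_derivative \<alpha>' u t) (at t within {0..})"
    and "continuous_on {0..} (\<alpha>' u)"
proof -
  assume t: "t \<ge> 0"
  then obtain c where "c \<in> charts_at N (x t)" using chart_ex by blast
  from parallel_field_derivative[OF parallel[OF u] t this]
  show "(\<alpha> u has_vector_derivative \<alpha>' u t) (at t within {0..})"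
    unfolding \<alpha>_def[abs_def] \<alpha>'_def .
next
  show "continuous_on {0..} (\<alpha>' u)"
    unfolding \<alpha>'_def[abs_def]
  proof (rule hessian_continuous[OF parallel[OF u] x_points])
    fix t c assume "t \<ge> 0" "c \<in> charts_at N (x t)"
    then show "continuous (at t within {0..}) (\<lambda>s. Y s c /\<^sub>R b)"
      by (intro continuous_scaleR continuous_const Y_continuous)
  qed
qed

lemma g_derivative: "t \<ge> 0 \<Longrightarrow> ((\<lambda>s. f (x s)) has_vector_derivative g' t) (at t within {0..})"
  using function_derivative chart_ex unfolding g'_def by blast

lemma g'_expansion:
  assumes t: "t \<ge> 0" shows "b * g' t = (\<Sum>e\<in>U. ip (y t) e * \<alpha> e t)"
proof -
  have z: "(\<lambda>_. 0) \<in> tangent N (x t)" using tsubspace_tangent[OF smooth] by (simp add: tsubspace_def)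
  have lin: "dfun N f (x t) (\<lambda>c. r *\<^sub>R u c + u' c) = r * dfun N f (x t) u + dfun N f (x t) u'" for r u u'
    by (rule dfun_linear[OF smooth smooth_f x_points[OF t]])
  have "dfun N f (x t) (\<lambda>_. 0) = 0" using lin[of 1 "\<lambda>_. 0" "\<lambda>_. 0"] by simp
  then have "g' t = inverse b * dfun N f (x t) (Y t)" using lin[of "inverse b" "Y t" "\<lambda>_. 0"] by (simp add: g'_def)
  then have "b * g' t = \<alpha> (y t) t" using b_pos by (simp add: \<alpha>_def Y_eq[OF t])
  then show ?thesis using \<alpha>_expansion[OF t y_tangent[OF t]] by simp
qed

text \<open>With the vector \<open>y t\<close> frozen, its expansion in the basis gives two
  expressions for one function of \<open>s\<close>, whose derivatives at \<open>s = t\<close> must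
  coincide; this replaces a chart proof of linearity in the second argument. The factor
  \<open>b\<close> undoes the division by \<open>b\<close> in the velocity.\<close>

lemma hessian_expansion:
  assumes t: "t \<ge> 0"
  shows "b * (\<Sum>e\<in>U. ip (y t) e * \<alpha>' e t) = hessian N \<Gamma> f (x t) (Y t) (Y t)"
proof -
  note u = y_tangent[OF t]
  have "((\<lambda>s. \<Sum>e\<in>U. ip (y t) e * \<alpha> e s) has_vector_derivative (\<Sum>e\<in>U. ip (y t) e * \<alpha>' e t)) (at t within {0..})"
    by (intro has_vector_derivative_sum has_vector_derivative_mult_right \<alpha>_C1(1)[OF U(2) t])
  then have "(\<alpha> (y t) has_vector_derivative (\<Sum>e\<in>U. ip (y t) e * \<alpha>' e t)) (at t within {0..})"
    by (rule has_vector_derivative_transform[rotated 2]) (use t \<alpha>_expansion[OF _ u] in auto)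
  then have "(\<Sum>e\<in>U. ip (y t) e * \<alpha>' e t) = \<alpha>' (y t) t"
    by (rule vector_derivative_unique_within[OF at_within_nonneg_nontrivial[OF t] _ \<alpha>_C1(1)[OF u t]])
  also have "\<dots> = inverse b * hessian N \<Gamma> f (x t) (Y t) (Y t)"
    unfolding \<alpha>'_def Y_eq[OF t, symmetric] by (rule hessian_scale[OF x_points[OF t] Y_tangent[OF t] Y_tangent[OF t]])
  finally show ?thesis using b_pos by simp
qed

text \<open>The component p = ip(y,e) is rough, but q = p - \<beta>/b has the derivative -p/b^2, so
  the ordinary product rule applies to q \<alpha>. Moving the terms with \<beta> to the other side
  produces the pathwise form of the Ito integral, divided by \<open>b\<close>.\<close>

lemma product_integral:
  assumes t: "t \<ge> 0" and e: "e \<in> U"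
    and \<beta>: "continuous_on {0..} \<beta>"
    and y_int: "\<And>s. s \<ge> 0 \<Longrightarrow> ip (y s) e = ip (y 0) e - integral {0..s} (\<lambda>r. ip (y r) e) / b\<^sup>2 + (\<beta> s - \<beta> 0) / b"
  shows "ip (y t) e * \<alpha> e t - ip (y 0) e * \<alpha> e 0
    = integral {0..t} (\<lambda>s. ip (y s) e * \<alpha>' e s) - integral {0..t} (\<lambda>s. ip (y s) e * \<alpha> e s) / b\<^sup>2
      + (\<alpha> e t * \<beta> t - \<alpha> e 0 * \<beta> 0 - integral {0..t} (\<lambda>s. \<alpha>' e s * \<beta> s)) / b"
proof -
  define p where "p s = ip (y s) e" for s
  define q where "q s = p s - \<beta> s / b" for s
  note eT = U(2)[OF e]
  have p_cont: "continuous_on {0..t} p"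
    unfolding p_def[abs_def] by (rule continuous_on_subset[OF y_cont[OF e]]) auto
  have \<beta>_cont: "continuous_on {0..t} \<beta>" by (rule continuous_on_subset[OF \<beta>]) auto
  have \<alpha>'_cont: "continuous_on {0..t} (\<alpha>' e)" by (rule continuous_on_subset[OF \<alpha>_C1(2)[OF eT]]) auto
  have \<alpha>_der: "(\<alpha> e has_vector_derivative \<alpha>' e s) (at s within {0..t})" if "s \<in> {0..t}" for s
    by (rule has_vector_derivative_within_subset[OF \<alpha>_C1(1)[OF eT]]) (use that in auto)
  have \<alpha>_cont: "continuous_on {0..t} (\<alpha> e)" by (rule continuous_on_vector_derivative[OF \<alpha>_der])
  have q_der: "(q has_vector_derivative - p s / b\<^sup>2) (at s within {0..t})" if s: "s \<in> {0..t}" for s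
  proof -
    have q_eq: "q r = p 0 - \<beta> 0 / b - integral {0..r} p / b\<^sup>2" if "r \<in> {0..t}" for r
      using y_int[of r] that by (simp add: q_def p_def[abs_def] diff_divide_distrib)
    have "((\<lambda>r. integral {0..r} p) has_vector_derivative p s) (at s within {0..t})"
      by (rule integral_has_vector_derivative[OF p_cont s])
    then have "((\<lambda>r. p 0 - \<beta> 0 / b - integral {0..r} p / b\<^sup>2) has_vector_derivative 0 - p s / b\<^sup>2) (at s within {0..t})"
      by (intro has_vector_derivative_diff has_vector_derivative_const has_vector_derivative_divide)
    then show ?thesis
      by (intro has_vector_derivative_transform[OF s q_eq]) simp_all
  qed
  have "((\<lambda>s. q s * \<alpha>' e s + (- p s / b\<^sup>2) * \<alpha> e s) has_integral (q t * \<alpha> e t - q 0 * \<alpha> e 0)) {0..t}"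
    by (rule fundamental_theorem_of_calculus[OF t]) (rule has_vector_derivative_mult[OF q_der \<alpha>_der])
  then have 1: "q t * \<alpha> e t - q 0 * \<alpha> e 0 = integral {0..t} (\<lambda>s. q s * \<alpha>' e s + (- p s / b\<^sup>2) * \<alpha> e s)"
    by (rule integral_unique[symmetric])
  have int: "(\<lambda>s. p s * \<alpha>' e s) integrable_on {0..t}" "(\<lambda>s. p s * \<alpha> e s) integrable_on {0..t}" "(\<lambda>s. \<alpha>' e s * \<beta> s) integrable_on {0..t}"
    by (intro integrable_continuous_real continuous_intros p_cont \<alpha>_cont \<alpha>'_cont \<beta>_cont)+
  have I: "((\<lambda>s. p s * \<alpha>' e s - (\<alpha>' e s * \<beta> s) / b - (p s * \<alpha> e s) / b\<^sup>2) has_integral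
    integral {0..t} (\<lambda>s. p s * \<alpha>' e s) - integral {0..t} (\<lambda>s. \<alpha>' e s * \<beta> s) / b - integral {0..t} (\<lambda>s. p s * \<alpha> e s) / b\<^sup>2) {0..t}"
    by (intro has_integral_diff has_integral_divide integrable_integral int)
  have "(\<lambda>s. q s * \<alpha>' e s + (- p s / b\<^sup>2) * \<alpha> e s) = (\<lambda>s. p s * \<alpha>' e s - (\<alpha>' e s * \<beta> s) / b - (p s * \<alpha> e s) / b\<^sup>2)"
    by (auto simp: q_def algebra_simps)
  with 1 integral_unique[OF I] have "q t * \<alpha> e t - q 0 * \<alpha> e 0 = 
    integral {0..t} (\<lambda>s. p s * \<alpha>' e s) - integral {0..t} (\<lambda>s. \<alpha>' e s * \<beta> s) / b - integral {0..t} (\<lambda>s. p s * \<alpha> e s) / b\<^sup>2" by simp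
  then show ?thesis unfolding q_def p_def by (simp add: algebra_simps diff_divide_distrib add_divide_distrib)
qed

text \<open>Summed over the basis, the product formula says that b (g' t - g' 0) equals 1/b times
  the sum of the Hessian integral, the \<open>J e t\<close> and - (f(x t) - f(x 0)). The last term
  is the damping of \<open>Y\<close>: it integrates b g'/b^2, and this is how \<open>f (x t)\<close>
  itself enters the identity. Multiplication by \<open>b\<close> finishes.\<close>

theorem path_identity:
  assumes \<beta>: "\<And>e. e \<in> U \<Longrightarrow> continuous_on {0..} (\<beta> e)"
    and y_int: "\<And>e s. e \<in> U \<Longrightarrow> s \<ge> 0 \<Longrightarrow>
       ip (y s) e = ip (y 0) e - integral {0..s} (\<lambda>r. ip (y r) e) / b\<^sup>2 + (\<beta> e s - \<beta> e 0) / b"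
    and J: "\<And>e t. e \<in> U \<Longrightarrow> t \<ge> 0 \<Longrightarrow> J e t = \<alpha> e t * \<beta> e t - \<alpha> e 0 * \<beta> e 0 - integral {0..t} (\<lambda>s. \<alpha>' e s * \<beta> e s)"
    and t: "t \<ge> 0"
  shows "b\<^sup>2 * g' t + f (x t) = b\<^sup>2 * g' 0 + f (x 0)
    + (integral {0..t} (\<lambda>s. hessian N \<Gamma> f (x s) (Y s) (Y s)) + (\<Sum>e\<in>U. J e t))"
proof -
  have p_cont: "continuous_on {0..t} (\<lambda>s. ip (y s) e)" if "e \<in> U" for e
    by (rule continuous_on_subset[OF y_cont[OF that]]) auto
  have \<alpha>_cont: "continuous_on {0..t} (\<alpha> e)" if "e \<in> U" for e
  proof -
    have "continuous_on {0..} (\<alpha> e)"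
      by (rule continuous_on_vector_derivative) (use \<alpha>_C1(1)[OF U(2)[OF that]] in auto)
    then show ?thesis by (rule continuous_on_subset) auto
  qed
  have \<alpha>'_cont: "continuous_on {0..t} (\<alpha>' e)" if "e \<in> U" for e
    by (rule continuous_on_subset[OF \<alpha>_C1(2)[OF U(2)[OF that]]]) auto
  have "(\<Sum>e\<in>U. ip (y t) e * \<alpha> e t) - (\<Sum>e\<in>U. ip (y 0) e * \<alpha> e 0)
      = (\<Sum>e\<in>U. integral {0..t} (\<lambda>s. ip (y s) e * \<alpha>' e s)) - (\<Sum>e\<in>U. integral {0..t} (\<lambda>s. ip (y s) e * \<alpha> e s)) / b\<^sup>2
        + (\<Sum>e\<in>U. J e t) / b"
    unfolding sum_subtractf[symmetric] sum_divide_distrib sum.distrib[symmetric]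
    by (rule sum.cong[OF refl]) (simp only: product_integral[OF t _ \<beta> y_int] J t)
  moreover have "(\<Sum>e\<in>U. integral {0..t} (\<lambda>s. ip (y s) e * \<alpha>' e s)) = integral {0..t} (\<lambda>s. \<Sum>e\<in>U. ip (y s) e * \<alpha>' e s)"
    by (rule integral_sum[symmetric]) (use U(1) p_cont \<alpha>'_cont in \<open>auto intro!: integrable_continuous_real continuous_intros\<close>)
  moreover have "(\<Sum>e\<in>U. integral {0..t} (\<lambda>s. ip (y s) e * \<alpha> e s)) = integral {0..t} (\<lambda>s. \<Sum>e\<in>U. ip (y s) e * \<alpha> e s)"
    by (rule integral_sum[symmetric]) (use U(1) p_cont \<alpha>_cont in \<open>auto intro!: integrable_continuous_real continuous_intros\<close>)
  moreover have "integral {0..t} (\<lambda>s. hessian N \<Gamma> f (x s) (Y s) (Y s)) = integral {0..t} (\<lambda>s. b * (\<Sum>e\<in>U. ip (y s) e * \<alpha>' e s))"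
    by (rule Henstock_Kurzweil_Integration.integral_cong) (simp only: hessian_expansion atLeastAtMost_iff)
  moreover have "integral {0..t} (\<lambda>s. \<Sum>e\<in>U. ip (y s) e * \<alpha> e s) = integral {0..t} (\<lambda>s. b * g' s)"
    by (rule Henstock_Kurzweil_Integration.integral_cong) (simp only: g'_expansion atLeastAtMost_iff)
  moreover have "(g' has_integral f (x t) - f (x 0)) {0..t}"
  proof (rule fundamental_theorem_of_calculus[OF t])
    fix s assume "s \<in> {0..t}"
    then show "((\<lambda>s. f (x s)) has_vector_derivative g' s) (at s within {0..t})"
      by (intro has_vector_derivative_within_subset[OF g_derivative]) auto
  qed
  then have "integral {0..t} g' = f (x t) - f (x 0)" by (rule integral_unique)
  ultimately have "b * g' t - b * g' 0 = integral {0..t} (\<lambda>s. hessian N \<Gamma> f (x s) (Y s) (Y s)) / b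
      - (b * (f (x t) - f (x 0))) / b\<^sup>2 + (\<Sum>e\<in>U. J e t) / b"
    using b_pos by (simp add: g'_expansion t)
  then have "b * (b * g' t - b * g' 0) = b * (integral {0..t} (\<lambda>s. hessian N \<Gamma> f (x s) (Y s) (Y s)) / b
      - (b * (f (x t) - f (x 0))) / b\<^sup>2 + (\<Sum>e\<in>U. J e t) / b)" by simp
  also have "\<dots> = integral {0..t} (\<lambda>s. hessian N \<Gamma> f (x s) (Y s) (Y s)) - (f (x t) - f (x 0)) + (\<Sum>e\<in>U. J e t)"
    using b_pos by (simp add: field_simps power2_eq_square)
  finally show ?thesis by (simp add: power2_eq_square algebra_simps)
qed

end

text \<open>The integrated equation for \<open>y\<close> is stated in chart components. Applying the
  linear function \<open>L\<close> that represents the inner product with \<open>e\<close> in one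
  chart, and moving it through the integral, gives the scalar equation. The constant
  \<open>L (Y0 c)\<close> is eliminated with the instance at time 0, whence the increment of
  \<open>w\<close> from time 0.\<close>

lemma diffusion_AE_path:
  fixes N :: "('m, 'e::euclidean_space) manifold"
  assumes smooth: "smooth_manifold N" and lc: "levi_civita N met \<Gamma>" and f: "smooth_fun N f"
    and z: "z \<in> points N" and ip: "bilinear_form_on (tangent N z) ip"
    and w: "\<And>t \<omega>. t \<ge> 0 \<Longrightarrow> \<omega> \<in> space P \<Longrightarrow> w t \<omega> \<in> tangent N z"
    and w_cont: "AE \<omega> in P. \<forall>c. continuous_on {0..} (\<lambda>t. w t \<omega> c)"
    and b: "b > 0" and basis: "orthonormal_basis (tangent N z) ip U"
    and diff: "hypoelliptic_diffusion P F N \<Gamma> b z Y0 w x Y \<tau>"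
  shows "AE \<omega> in P. x 0 \<omega> = z \<and> (\<exists>y. diffusion_path N met \<Gamma> f (\<lambda>t. x t \<omega>) (\<lambda>t. Y t \<omega>) b (\<lambda>t. \<tau> t \<omega>) y ip U \<and>
    (\<forall>e\<in>U. continuous_on {0..} (\<lambda>t. ip (w t \<omega>) e) \<and>
      (\<forall>s\<ge>0. ip (y s) e = ip (y 0) e - integral {0..s} (\<lambda>r. ip (y r) e) / b\<^sup>2 + (ip (w s \<omega>) e - ip (w 0 \<omega>) e) / b)))"
proof -
  note diff' = diff[unfolded hypoelliptic_diffusion_def]
  have pts: "x t \<omega> \<in> points N \<and> Y t \<omega> \<in> tangent N (x t \<omega>)" if "t \<ge> 0" "\<omega> \<in> space P" for t \<omega>
    by (rule diff'[THEN conjunct1, rule_format, OF that])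
  obtain c where c: "c \<in> charts_at N z" using z by (auto simp: points_def charts_at_def)
  have bil: "ip (\<lambda>c. r *\<^sub>R u c + v c) e = r * ip u e + ip v e"
    if "e \<in> U" "u \<in> tangent N z" "v \<in> tangent N z" for e u v r
    using ip basis that unfolding bilinear_form_on_def orthonormal_basis_def by blast
  from diff'[THEN conjunct2, THEN conjunct2, THEN conjunct2] w_cont AE_space show ?thesis
  proof eventually_elim
    case (elim \<omega>)
    then have x0: "x 0 \<omega> = z" and vel: "has_velocity N (\<lambda>t. x t \<omega>) (\<lambda>t c. Y t \<omega> c /\<^sub>R b)"
      and par: "parallel_transport N \<Gamma> (\<lambda>t. x t \<omega>) (\<lambda>t c. Y t \<omega> c /\<^sub>R b) (\<lambda>t. \<tau> t \<omega>)" by simp_all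
    obtain y where y_cont: "\<forall>c. continuous_on {0..} (\<lambda>t. y t c)"
      and y: "\<forall>t\<ge>0. y t \<in> tangent N z \<and> Y t \<omega> = \<tau> t \<omega> (y t) \<and>
              (\<forall>c. y t c = Y0 c - integral {0..t} (\<lambda>s. y s c) /\<^sub>R b\<^sup>2 + w t \<omega> c /\<^sub>R b)"
      using elim(1) by blast
    note yc = y_cont[THEN spec[of _ c]]
    have y_tan: "y t \<in> tangent N z" and Y_eq: "Y t \<omega> = \<tau> t \<omega> (y t)"
      and y_int: "y t c = Y0 c - integral {0..t} (\<lambda>s. y s c) /\<^sub>R b\<^sup>2 + w t \<omega> c /\<^sub>R b" if "t \<ge> 0" for t
      using y that by blast+
    have comp: "continuous_on {0..} (\<lambda>t. ip (y t) e) \<and> continuous_on {0..} (\<lambda>t. ip (w t \<omega>) e) \<and>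
      (\<forall>s\<ge>0. ip (y s) e = ip (y 0) e - integral {0..s} (\<lambda>r. ip (y r) e) / b\<^sup>2 + (ip (w s \<omega>) e - ip (w 0 \<omega>) e) / b)"
      if e: "e \<in> U" for e
    proof -
      obtain L where L: "linear L" "\<And>v. v \<in> tangent N z \<Longrightarrow> ip v e = L (v c)"
        using tangent_form_in_chart[where \<phi> = "\<lambda>v. ip v e", OF smooth c bil[OF e]] by blast
      have bl: "bounded_linear L" using L(1) by (simp add: linear_conv_bounded_linear)
      have L_cont: "continuous_on UNIV L" by (rule linear_continuous_on[OF bl])
      have cy: "continuous_on {0..} (\<lambda>t. ip (y t) e)"
      proof -
        have "continuous_on {0..} (\<lambda>t. L (y t c))" by (rule continuous_on_compose2[OF L_cont yc]) simp
        then show ?thesis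
          by (rule continuous_on_cong[THEN iffD1, rotated 2]) (use L(2)[OF y_tan] in auto)
      qed
      have cw: "continuous_on {0..} (\<lambda>t. ip (w t \<omega>) e)"
      proof -
        have "continuous_on {0..} (\<lambda>t. L (w t \<omega> c))"
          by (rule continuous_on_compose2[OF L_cont elim(2)[THEN spec[of _ c]]]) simp
        then show ?thesis
          by (rule continuous_on_cong[THEN iffD1, rotated 2]) (use L(2)[OF w[OF _ elim(3)]] in auto)
      qed
      have eq: "ip (y s) e = L (Y0 c) - integral {0..s} (\<lambda>r. ip (y r) e) / b\<^sup>2 + ip (w s \<omega>) e / b" if s: "s \<ge> 0" for s
      proof -
        have "(\<lambda>r. y r c) integrable_on {0..s}"
          by (rule integrable_continuous_real[OF continuous_on_subset[OF yc]]) auto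
        then have "integral {0..s} (L \<circ> (\<lambda>r. y r c)) = L (integral {0..s} (\<lambda>r. y r c))"
          by (rule integral_linear[OF _ bl])
        moreover have "integral {0..s} (L \<circ> (\<lambda>r. y r c)) = integral {0..s} (\<lambda>r. ip (y r) e)"
          by (rule Henstock_Kurzweil_Integration.integral_cong) (simp add: L(2)[OF y_tan])
        ultimately have I: "L (integral {0..s} (\<lambda>r. y r c)) = integral {0..s} (\<lambda>r. ip (y r) e)" by simp
        have "ip (y s) e = L (Y0 c - integral {0..s} (\<lambda>s. y s c) /\<^sub>R b\<^sup>2 + w s \<omega> c /\<^sub>R b)"
          unfolding L(2)[OF y_tan[OF s]] y_int[OF s] ..
        then show ?thesis
          by (simp add: linear_add[OF L(1)] linear_diff[OF L(1)] linear_scale[OF L(1)] I L(2)[OF w[OF s elim(3)]] divide_inverse mult.commute)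
      qed
      have eq0: "ip (y 0) e = L (Y0 c) + ip (w 0 \<omega>) e / b" using eq[of 0] by simp
      have "ip (y s) e = ip (y 0) e - integral {0..s} (\<lambda>r. ip (y r) e) / b\<^sup>2 + (ip (w s \<omega>) e - ip (w 0 \<omega>) e) / b" if "s \<ge> 0" for s
        using eq[OF that] eq0 by (simp add: diff_divide_distrib)
      then show ?thesis using cy cw by blast
    qed
    have "diffusion_path N met \<Gamma> f (\<lambda>t. x t \<omega>) (\<lambda>t. Y t \<omega>) b (\<lambda>t. \<tau> t \<omega>) y ip U"
      by (unfold_locales, unfold x0)
        (rule smooth lc f vel par b basis y_tan Y_eq pts[OF _ elim(3), THEN conjunct1]
          pts[OF _ elim(3), THEN conjunct2] comp[THEN conjunct1] | assumption)+
    then show ?case using x0 comp by blast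
  qed
qed

text \<open>One null set serves all times and all claims. \<open>time_deriv\<close> is a total
  operator, and the differentiability claim is what makes its values genuine derivatives.\<close>

theorem theorem9p18:
  fixes G :: "'g monoid"
    and M :: "('g, 'e::euclidean_space) manifold"
    and \<theta> :: "'g \<Rightarrow> 'g"
    and K :: "'g set"
    and B :: "('g, 'e) tvec \<Rightarrow> ('g, 'e) tvec \<Rightarrow> real"
    and X :: "('g set, 'a::euclidean_space) manifold"
    and met :: "'g set \<Rightarrow> ('g set, 'a) tvec \<Rightarrow> ('g set, 'a) tvec \<Rightarrow> real"
    and \<Gamma> :: "('g set, 'a) christoffel"
    and P :: "'w measure"
    and F :: "real \<Rightarrow> 'w measure"
    and w :: "real \<Rightarrow> 'w \<Rightarrow> ('g set, 'a) tvec"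
    and b :: real
    and Yp :: "('g, 'e) tvec"
    and x :: "real \<Rightarrow> 'w \<Rightarrow> 'g set"
    and Y :: "real \<Rightarrow> 'w \<Rightarrow> ('g set, 'a) tvec"
    and \<tau> :: "real \<Rightarrow> 'w \<Rightarrow> ('g set, 'a) tvec \<Rightarrow> ('g set, 'a) tvec"
    and f :: "'g set \<Rightarrow> real"
    and I A :: "real \<Rightarrow> 'w \<Rightarrow> real"
  assumes "symmetric_space G M \<theta> K B X met"
    and "levi_civita X met \<Gamma>"
    and "filtered_prob_space P F"
    and "brownian_motion P F X met (base_point G K) w"
    and "b > 0"
    and "Yp \<in> cartan_p G M \<theta>"
    and "hypoelliptic_diffusion P F X \<Gamma> b (base_point G K) (p_to_tangent G M K X Yp) w x Y \<tau>"
    and "smooth_fun X f"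
    and "has_vector_ito_integral P F (tangent X (base_point G K)) (met (base_point G K)) w
           (\<lambda>s \<omega> u. dfun X f (x s \<omega>) (\<tau> s \<omega> u)) I"
    and "\<And>t \<omega>. A t \<omega> =
           integral {0..t} (\<lambda>s. hessian X \<Gamma> f (x s \<omega>) (Y s \<omega>) (Y s \<omega>)) + I t \<omega>"
  shows "AE \<omega> in P. \<forall>t\<ge>0.
      (\<lambda>s. f (x s \<omega>)) differentiable (at t within {0..}) \<and>
      b\<^sup>2 * time_deriv (\<lambda>s. f (x s \<omega>)) t + f (x t \<omega>)
        = b\<^sup>2 * time_deriv (\<lambda>s. f (x s \<omega>)) 0 + f (x 0 \<omega>) + A t \<omega> \<and>
      f (x t \<omega>)
        = f (x 0 \<omega>) + b\<^sup>2 * time_deriv (\<lambda>s. f (x s \<omega>)) 0 * (1 - exp (- t / b\<^sup>2))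
          + integral {0..t} (\<lambda>s. exp (- (t - s) / b\<^sup>2) / b\<^sup>2 * A s \<omega>)"
proof -
  define z where "z = base_point G K"
  interpret symmetric_space G M \<theta> K B X met by fact
  have z: "z \<in> points X"
  proof -
    interpret group G using lie_group by (simp add: lie_group_def)
    show ?thesis unfolding X_points z_def base_point_def LCOSETS_def by blast
  qed
  have met: "bilinear_form_on (tangent X z) (met z)"
    using met_riemannian z by (simp add: riemannian_metric_def)
  note brown = assms(4)[folded z_def]
  note brown' = brown[unfolded brownian_motion_def]
  interpret prob_space P using assms(3) by (simp add: filtered_prob_space_def)
  \<comment> \<open>The basis witnessing the vector integral is also used for the expansions along
    paths, so that the two match term by term.\<close>
  obtain U J where U: "orthonormal_basis (tangent X z) (met z) U"
    and J: "\<forall>e\<in>U. has_ito_integral P F (\<lambda>t \<omega>. met z (w t \<omega>) e) (\<lambda>s \<omega>. dfun X f (x s \<omega>) (\<tau> s \<omega> e)) (J e)"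
    and I: "AE \<omega> in P. \<forall>t\<ge>0. I t \<omega> = (\<Sum>e\<in>U. J e t \<omega>)"
    using assms(9)[folded z_def] unfolding has_vector_ito_integral_def by blast
  have U': "finite U" "\<And>e. e \<in> U \<Longrightarrow> e \<in> tangent X z" "\<And>e. e \<in> U \<Longrightarrow> met z e e = 1"
    using U unfolding orthonormal_basis_def by auto
  have path: "AE \<omega> in P. x 0 \<omega> = z \<and> (\<exists>y. diffusion_path X met \<Gamma> f (\<lambda>t. x t \<omega>) (\<lambda>t. Y t \<omega>) b (\<lambda>t. \<tau> t \<omega>) y (met z) U \<and>
    (\<forall>e\<in>U. continuous_on {0..} (\<lambda>t. met z (w t \<omega>) e) \<and>
      (\<forall>s\<ge>0. met z (y s) e = met z (y 0) e - integral {0..s} (\<lambda>r. met z (y r) e) / b\<^sup>2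
        + (met z (w s \<omega>) e - met z (w 0 \<omega>) e) / b)))"
    by (rule diffusion_AE_path[OF X_manifold assms(2,8) z met brown'[THEN conjunct1, rule_format]
          brown'[THEN conjunct2, THEN conjunct2, THEN conjunct2, THEN conjunct1] assms(5) U assms(7)[folded z_def]])
  \<comment> \<open>Expressed through \<open>x\<close>, \<open>Y\<close> and \<open>\<tau>\<close>
    instead of \<open>y\<close>, whose existence is asserted separately for each path, this is a
    single process that can be fed to the Ito lemma.\<close>
  define H' where "H' e s \<omega> = hessian X \<Gamma> f (x s \<omega>) (\<lambda>c. Y s \<omega> c /\<^sub>R b) (\<tau> s \<omega> e)" for e s \<omega>
  have ito: "AE \<omega> in P. \<forall>t\<ge>0. J e t \<omega> = dfun X f (x t \<omega>) (\<tau> t \<omega> e) * met z (w t \<omega>) e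
      - dfun X f (x 0 \<omega>) (\<tau> 0 \<omega> e) * met z (w 0 \<omega>) e - integral {0..t} (\<lambda>s. H' e s \<omega> * met z (w s \<omega>) e)"
    if e: "e \<in> U" for e
  proof (rule scalar_brownian_motion.ito_integral_C1)
    show "scalar_brownian_motion P F (\<lambda>t \<omega>. met z (w t \<omega>) e)"
      by (rule brownian_motion_component[OF X_manifold z met assms(3) brown U'(2,3)[OF e]])
    show "has_ito_integral P F (\<lambda>t \<omega>. met z (w t \<omega>) e) (\<lambda>s \<omega>. dfun X f (x s \<omega>) (\<tau> s \<omega> e)) (J e)"
      using J e by blast
    show "AE \<omega> in P. (\<forall>r\<ge>0. ((\<lambda>s. dfun X f (x s \<omega>) (\<tau> s \<omega> e)) has_vector_derivative H' e r \<omega>) (at r within {0..})) \<and>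
       continuous_on {0..} (\<lambda>s. H' e s \<omega>)"
      using path
    proof eventually_elim
      case (elim \<omega>)
      then obtain y where x0: "x 0 \<omega> = z"
        and D: "diffusion_path X met \<Gamma> f (\<lambda>t. x t \<omega>) (\<lambda>t. Y t \<omega>) b (\<lambda>t. \<tau> t \<omega>) y (met z) U" by blast
      interpret D: diffusion_path X met \<Gamma> f "\<lambda>t. x t \<omega>" "\<lambda>t. Y t \<omega>" b "\<lambda>t. \<tau> t \<omega>" y "met z" U by (rule D)
      show ?case
        using D.\<alpha>_C1[OF D.U(2)[OF e]] by (simp add: D.\<alpha>_def[abs_def] D.\<alpha>'_def[abs_def] H'_def)
    qed
  qed
  have ito_all: "AE \<omega> in P. \<forall>e\<in>U. \<forall>t\<ge>0. J e t \<omega> = dfun X f (x t \<omega>) (\<tau> t \<omega> e) * met z (w t \<omega>) e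
      - dfun X f (x 0 \<omega>) (\<tau> 0 \<omega> e) * met z (w 0 \<omega>) e - integral {0..t} (\<lambda>s. H' e s \<omega> * met z (w s \<omega>) e)"
    by (rule AE_ball_countable'[OF ito countable_finite[OF U'(1)]])
  from path ito_all I show ?thesis
  proof eventually_elim
    case (elim \<omega>)
    then obtain y where x0: "x 0 \<omega> = z"
      and D: "diffusion_path X met \<Gamma> f (\<lambda>t. x t \<omega>) (\<lambda>t. Y t \<omega>) b (\<lambda>t. \<tau> t \<omega>) y (met z) U"
      and w_cont: "\<And>e. e \<in> U \<Longrightarrow> continuous_on {0..} (\<lambda>t. met z (w t \<omega>) e)"
      and y_int: "\<And>e s. e \<in> U \<Longrightarrow> s \<ge> 0 \<Longrightarrow> met z (y s) e = met z (y 0) e - integral {0..s} (\<lambda>r. met z (y r) e) / b\<^sup>2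
        + (met z (w s \<omega>) e - met z (w 0 \<omega>) e) / b" by blast
    interpret D: diffusion_path X met \<Gamma> f "\<lambda>t. x t \<omega>" "\<lambda>t. Y t \<omega>" b "\<lambda>t. \<tau> t \<omega>" y "met z" U by (rule D)
    have identity: "b\<^sup>2 * D.g' t + f (x t \<omega>) = b\<^sup>2 * D.g' 0 + f (x 0 \<omega>) + A t \<omega>" if t: "t \<ge> 0" for t
    proof -
      have "b\<^sup>2 * D.g' t + f (x t \<omega>) = b\<^sup>2 * D.g' 0 + f (x 0 \<omega>)
        + (integral {0..t} (\<lambda>s. hessian X \<Gamma> f (x s \<omega>) (Y s \<omega>) (Y s \<omega>)) + (\<Sum>e\<in>U. J e t \<omega>))"
      proof (rule D.path_identity[OF w_cont y_int _ t])
        show "J e t \<omega> = D.\<alpha> e t * met z (w t \<omega>) e - D.\<alpha> e 0 * met z (w 0 \<omega>) e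
            - integral {0..t} (\<lambda>s. D.\<alpha>' e s * met z (w s \<omega>) e)" if "e \<in> U" "t \<ge> 0" for e t
          using elim(2) that by (simp add: D.\<alpha>_def D.\<alpha>'_def H'_def)
      qed
      then show ?thesis using elim(3) t by (simp add: assms(10))
    qed
    have td: "time_deriv (\<lambda>s. f (x s \<omega>)) t = D.g' t" if "t \<ge> 0" for t
      unfolding time_deriv_def
      by (rule vector_derivative_within[OF at_within_nonneg_nontrivial[OF that] D.g_derivative[OF that]])
    have b2: "b\<^sup>2 > 0" using assms(5) by simp
    show ?case
    proof (intro allI impI conjI)
      fix t :: real assume t: "t \<ge> 0"
      show "(\<lambda>s. f (x s \<omega>)) differentiable (at t within {0..})"
        by (rule differentiableI_vector[OF D.g_derivative[OF t]])
      show "b\<^sup>2 * time_deriv (\<lambda>s. f (x s \<omega>)) t + f (x t \<omega>)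
          = b\<^sup>2 * time_deriv (\<lambda>s. f (x s \<omega>)) 0 + f (x 0 \<omega>) + A t \<omega>"
        using identity[OF t] by (simp add: td t)
      show "f (x t \<omega>)
        = f (x 0 \<omega>) + b\<^sup>2 * time_deriv (\<lambda>s. f (x s \<omega>)) 0 * (1 - exp (- t / b\<^sup>2))
          + integral {0..t} (\<lambda>s. exp (- (t - s) / b\<^sup>2) / b\<^sup>2 * A s \<omega>)"
        unfolding td[OF order_refl]
        by (rule first_order_ode_solution[OF D.g_derivative b2 identity t])
    qed
  qed
qed

end
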